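(* There is a randomized polynomial-time algorithm for the $k$-column sparse packing integer program problem ($k$-CS-PIP) with approximation ratio $ek+o(k)$; that is, on every instance it outputs a feasible solution $x\in\{0,1\}^n$ whose expected weight is at least $\mathrm{OPT}/(ek+o(k))$, where $\mathrm{OPT}$ is the optimum value of the instance and $o(k)$ denotes a function of $k$ alone with $o(k)/k\to 0$ as $k\to\infty$.
   Context: A packing integer program is $\max\{w^T x \mid Sx\le c,\ x\in\{0,1\}^n\}$ with $w\in\mathbb{R}^n_+$, $c\in\mathbb{R}^m_+$, $S=(s_{ij})\in\mathbb{R}_+^{m\times n}$ (rows $j\in[m]$ are constraints, columns $i\in[n]$ are items). It is $k$-column sparse ($k$-CS-PIP) if every column of $S$ has at most $k$ nonzero entries, i.e. each item participates in at most $k$ constraints. A feasible solution is an $x\in\{0,1\}^n$ with $Sx\le c$.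
   Formalization: The weights, capacities and matrix entries are rational, given in binary as numerator/denominator pairs, instead of arbitrary reals, since polynomial time in the instance's bit length is undefined for real data; the ratio is stated for k ≥ 1. *)

theory Defs
  imports
    "HOL-Probability.Probability_Mass_Function"
    "HOL-Computational_Algebra.Polynomial"
    "HOL-Library.Landau_Symbols"
    "HOL-Library.Log_Nat"
    "Jordan_Normal_Form.Matrix"
begin

section \<open>Packing integer programs\<close>

definition pip :: "'a::linordered_field vec \<Rightarrow> 'a mat \<Rightarrow> 'a vec \<Rightarrow> bool" where
  "pip w S c \<longleftrightarrow>
     dim_vec w = dim_col S \<and> dim_vec c = dim_row S \<and>
     (\<forall>i < dim_col S. 0 \<le> w $ i) \<and> (\<forall>j < dim_row S. 0 \<le> c $ j) \<and>
     (\<forall>j < dim_row S. \<forall>i < dim_col S. 0 \<le> S $$ (j, i))"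

definition column_sparse :: "nat \<Rightarrow> 'a::zero mat \<Rightarrow> bool" where
  "column_sparse k S \<longleftrightarrow>
     (\<forall>i < dim_col S. card {j. j < dim_row S \<and> S $$ (j, i) \<noteq> 0} \<le> k)"

definition feasible :: "'a::linordered_field mat \<Rightarrow> 'a vec \<Rightarrow> 'a vec set" where
  "feasible S c =
     {x \<in> carrier_vec (dim_col S). (\<forall>i < dim_col S. x $ i \<in> {0, 1}) \<and> S *\<^sub>v x \<le> c}"

definition OPT :: "'a::linordered_field vec \<Rightarrow> 'a mat \<Rightarrow> 'a vec \<Rightarrow> 'a" where
  "OPT w S c = Max ((\<lambda>x. scalar_prod w x) ` feasible S c)"


section \<open>Randomized random access machines with logarithmic cost\<close>

text \<open>
  The machine model is the random access machine over the integers under the logarithmic cost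
  criterion, in structured form and extended by an instruction that flips a fair coin. Every
  operation is charged according to the bit lengths of the integers and addresses involved, so
  polynomial time here agrees with polynomial time on probabilistic Turing machines.
\<close>

text \<open>The number of binary digits of the absolute value, plus one for the sign.\<close>

definition bits :: "int \<Rightarrow> nat" where
  "bits z = floorlog 2 (nat \<bar>z\<bar>) + 1"

type_synonym mem = "int \<Rightarrow> int"

datatype aexp =
    Const int
  | Cell aexp  \<comment> \<open>contents of the cell whose address is the value of the argument\<close>
  | Plus aexp aexp
  | Minus aexp aexp
  | Times aexp aexp
  | Div aexp aexp

primrec aval :: "aexp \<Rightarrow> mem \<Rightarrow> int" where
  "aval (Const z) M = z"
| "aval (Cell a) M = M (aval a M)"
| "aval (Plus a b) M = aval a M + aval b M"
| "aval (Minus a b) M = aval a M - aval b M"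
| "aval (Times a b) M = aval a M * aval b M"
| "aval (Div a b) M = aval a M div aval b M"

text \<open>
  A binary operation is charged the product of the operand lengths, which up to a constant factor
  bounds the bit complexity of the schoolbook algorithm for each of the four operations.
\<close>

primrec acost :: "aexp \<Rightarrow> mem \<Rightarrow> nat" where
  "acost (Const z) M = bits z"
| "acost (Cell a) M = acost a M + bits (aval a M) + bits (M (aval a M))"
| "acost (Plus a b) M = acost a M + acost b M + bits (aval a M) * bits (aval b M)"
| "acost (Minus a b) M = acost a M + acost b M + bits (aval a M) * bits (aval b M)"
| "acost (Times a b) M = acost a M + acost b M + bits (aval a M) * bits (aval b M)"
| "acost (Div a b) M = acost a M + acost b M + bits (aval a M) * bits (aval b M)"

datatype com =
    Assign aexp aexp  \<comment> \<open>target address, value\<close>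
  | Flip aexp  \<comment> \<open>store a fair random bit at the address\<close>
  | Seq com com
  | If aexp com com  \<comment> \<open>the condition holds if the value is positive\<close>
  | While aexp com

text \<open>
  The relation \<open>exec C (M, t) \<mu>\<close> says that \<open>C\<close>, started in memory \<open>M\<close> at time \<open>t\<close>, halts for
  every outcome of its coin flips, and that \<open>\<mu>\<close> is the joint distribution of the final memory and
  the final time.
\<close>

inductive exec :: "com \<Rightarrow> mem \<times> nat \<Rightarrow> (mem \<times> nat) pmf \<Rightarrow> bool" where
  Assign: "exec (Assign a b) (M, t)
     (return_pmf (M(aval a M := aval b M),
        t + acost a M + acost b M + bits (aval a M) + bits (aval b M)))"
| Flip: "exec (Flip a) (M, t)
     (map_pmf (\<lambda>h. (M(aval a M := of_bool h), t + acost a M + bits (aval a M) + 1))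
        (bernoulli_pmf (1 / 2)))"
| Seq: "exec C s \<mu> \<Longrightarrow> (\<And>s'. s' \<in> set_pmf \<mu> \<Longrightarrow> exec D s' (\<nu> s')) \<Longrightarrow>
     exec (Seq C D) s (bind_pmf \<mu> \<nu>)"
| If_True: "0 < aval b M \<Longrightarrow> exec C (M, t + acost b M + 1) \<mu> \<Longrightarrow> exec (If b C D) (M, t) \<mu>"
| If_False: "\<not> 0 < aval b M \<Longrightarrow> exec D (M, t + acost b M + 1) \<mu> \<Longrightarrow> exec (If b C D) (M, t) \<mu>"
| While_True: "0 < aval b M \<Longrightarrow> exec C (M, t + acost b M + 1) \<mu> \<Longrightarrow>
     (\<And>s'. s' \<in> set_pmf \<mu> \<Longrightarrow> exec (While b C) s' (\<nu> s')) \<Longrightarrow>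
     exec (While b C) (M, t) (bind_pmf \<mu> \<nu>)"
| While_False: "\<not> 0 < aval b M \<Longrightarrow>
     exec (While b C) (M, t) (return_pmf (M, t + acost b M + 1))"

lemma exec_deterministic: "exec C s \<mu> \<Longrightarrow> exec C s \<mu>' \<Longrightarrow> \<mu> = \<mu>'"
proof (induction arbitrary: \<mu>' rule: exec.induct)
  case (Seq C s \<mu> D \<nu>)
  from Seq.prems obtain \<mu>1 \<nu>1 where *: "\<mu>' = bind_pmf \<mu>1 \<nu>1" "exec C s \<mu>1"
    "\<And>s'. s' \<in> set_pmf \<mu>1 \<Longrightarrow> exec D s' (\<nu>1 s')"
    by (cases rule: exec.cases) auto
  have "\<mu> = \<mu>1" using Seq.IH(1) * by blast
  thus ?case using * Seq.IH(2) by (auto intro!: bind_pmf_cong)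
next
  case (While_True b M C t \<mu> \<nu>)
  from While_True.prems While_True.hyps(1) obtain \<mu>1 \<nu>1 where *: "\<mu>' = bind_pmf \<mu>1 \<nu>1"
    "exec C (M, t + acost b M + 1) \<mu>1"
    "\<And>s'. s' \<in> set_pmf \<mu>1 \<Longrightarrow> exec (While b C) s' (\<nu>1 s')"
    by (cases rule: exec.cases) auto
  have "\<mu> = \<mu>1" using While_True.IH(1) * by blast
  thus ?case using * While_True.IH(2) by (auto intro!: bind_pmf_cong)
qed (erule exec.cases; auto)+


section \<open>Input and output\<close>

definition encode_rat :: "rat \<Rightarrow> int list" where
  "encode_rat q = [fst (quotient_of q), snd (quotient_of q)]"

definition encode_pip :: "rat vec \<Rightarrow> rat mat \<Rightarrow> rat vec \<Rightarrow> int list" where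
  "encode_pip w S c =
     [int (dim_row S), int (dim_col S)] @
     concat (map encode_rat
       (list_of_vec w @ list_of_vec c @ concat (map list_of_vec (rows S))))"

definition input_size :: "int list \<Rightarrow> nat" where
  "input_size zs = sum_list (map bits zs)"

text \<open>The input occupies the cells from address 0 on; all other cells are initially 0.\<close>

definition load :: "int list \<Rightarrow> mem" where
  "load zs = (\<lambda>a. if 0 \<le> a \<and> a < int (length zs) then zs ! nat a else 0)"

text \<open>The output vector is read off the first \<open>n\<close> cells.\<close>

definition output_vec :: "nat \<Rightarrow> mem \<Rightarrow> rat vec" where
  "output_vec n M = vec n (\<lambda>i. of_int (M (int i)))"

end

theory Submission
  imports Defs
begin

text \<open>
  Consider the linear relaxation strengthened by the constraints that each row contains at most one
  item occupying more than half of its capacity. Multiplicative weights with exact integer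
  arithmetic give a fractional solution \<open>x\<close> whose value is within a factor \<open>1 - 2 / D\<close> of the integral
  optimum, where \<open>D = k + 1000\<close>. Each item is then sampled independently with probability about
  \<open>x\<^sub>i / D\<close>, and a sampled item is dropped if in one of its rows the sampled items that are at least
  as large overflow the capacity. What is kept is feasible: look at the smallest kept item of a row.

  A sampled item is dropped only if one of its rows contains another sampled big item, or at least
  two further sampled items that are small for that row and together overflow it. No rival big item
  is sampled with probability at least \<open>(1 - 1 / D - 1 / D\<^sup>2) ^ k\<close>, directly by independence,
  and the second event has probability \<open>O(1 / D\<^sup>2)\<close> per row. So an item survives with probability
  at least \<open>1 / e\<close>, the lower order terms being absorbed by the constant 1000, and the ratio is
  \<open>e (k + 1000)\<close>.

  The running time is polynomial because the program is a sequence of array assignments with bounded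
  inner loops, whose accumulators grow by a bounded number of bits per step, and because the
  iterations of the multiplicative weights method multiply the weights by numbers of fixed length.
\<close>

subsection \<open>Bit lengths and polynomial bounds\<close>

text \<open>Without the extra rows, the big items of one row could have total fractional value close
  to 2, so rivals would cost a factor near 1 - 2 / D per row and survival would fall towards 1 /
  e^2; with them the total is at most 1. Overflow by small items cannot be charged by first moments,
  which give O(1 / D) per row and hence a constant over k rows. Charging it to pairs of small items
  gives O(1 / D^2) per row, O(1 / D) altogether. The constant 1000 leaves only k = D - 1000 factors,
  so the no-rival bound exceeds 1 / e by the relative amount 998 / D. Overflow by small items
  consumes 216 / D of it, and the remaining 782 / D pays for the relative loss 2 / D of the
  fractional optimum. D is computed from the largest column count, not from k, so one program serves
  every k. Since D is at most m + 1000, precision 1 / D costs polynomially many iterations.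
  Multiplicative weights are chosen because an iteration consists of additions, multiplications and
  comparisons of products, whose bit lengths can be tracked.\<close>

lemma bits_pos: "1 \<le> bits z"
  by (simp add: bits_def)

lemma floorlog_two_le_iff: "floorlog 2 x \<le> w \<longleftrightarrow> x < 2 ^ w"
  by (simp add: floorlog_le_iff)

lemma bits_le_iff: "bits z \<le> Suc b \<longleftrightarrow> \<bar>z\<bar> < 2 ^ b"
proof -
  have "bits z \<le> Suc b \<longleftrightarrow> nat \<bar>z\<bar> < 2 ^ b"
    by (simp add: bits_def floorlog_two_le_iff)
  also have "\<dots> \<longleftrightarrow> \<bar>z\<bar> < 2 ^ b"
    by (simp add: nat_less_iff)
  finally show ?thesis .
qed

lemma abs_less_two_power_bits: "\<bar>z\<bar> < 2 ^ (bits z - 1)"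
  using bits_le_iff[of z "bits z - 1"] bits_pos[of z] by simp

lemma bits_mono: "\<bar>x\<bar> \<le> \<bar>y\<bar> \<Longrightarrow> bits x \<le> bits y"
  by (simp add: bits_def floorlog_mono nat_mono)

lemma bits_0 [simp]: "bits 0 = 1"
  by (simp add: bits_def floorlog_def)

lemma bits_mult: "bits (x * y) \<le> bits x + bits y"
proof -
  have "\<bar>x * y\<bar> < 2 ^ (bits x - 1) * 2 ^ (bits y - 1)"
    unfolding abs_mult
    by (rule mult_strict_mono'[OF abs_less_two_power_bits abs_less_two_power_bits]) auto
  hence "bits (x * y) \<le> Suc (bits x - 1 + (bits y - 1))"
    by (simp only: bits_le_iff power_add)
  thus ?thesis using bits_pos[of x] bits_pos[of y] by linarith
qed

text \<open>Weaker than max plus 1 on purpose: sums, differences and products then obey one common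
  bound, the sum of the lengths.\<close>

lemma bits_add: "bits (x + y) \<le> bits x + bits y"
proof -
  define a b where "a = bits x - 1" and "b = bits y - 1"
  have xy: "\<bar>x\<bar> < 2 ^ a" "\<bar>y\<bar> < 2 ^ b"
    using abs_less_two_power_bits[of x] abs_less_two_power_bits[of y] by (simp_all add: a_def b_def)
  have *: "u + v \<le> 2 * (u * v)" if "1 \<le> u" "1 \<le> v" for u v :: int
  proof -
    have "u \<le> u * v" "v \<le> u * v" using that by (simp_all add: mult_le_cancel_left1 mult_le_cancel_right1)
    thus ?thesis by linarith
  qed
  have "\<bar>x + y\<bar> < 2 ^ a + (2 ^ b :: int)" using xy by linarith
  also have "\<dots> \<le> 2 * (2 ^ a * 2 ^ b)" by (intro *) auto
  finally have "bits (x + y) \<le> Suc (Suc (a + b))"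
    unfolding bits_le_iff by (simp add: power_add)
  thus ?thesis using bits_pos[of x] bits_pos[of y] by (simp add: a_def b_def)
qed

lemma bits_minus [simp]: "bits (- x) = bits x"
  by (simp add: bits_def)

lemma bits_diff: "bits (x - y) \<le> bits x + bits y"
  using bits_add[of x "- y"] by simp

text \<open>Division rounds downwards, so negative dividends need their own argument; division by 0
  gives 0.\<close>

lemma abs_div_le: "\<bar>x div y\<bar> \<le> \<bar>x :: int\<bar>"
proof (cases "y = 0")
  case False
  have pos: "\<bar>u div v\<bar> \<le> \<bar>u\<bar>" if v: "v > 0" for u v :: int
  proof (cases "u \<ge> 0")
    case True
    have "u div v \<le> u" using zdiv_mono2[of u 1 v] True v by simp
    moreover have "0 \<le> u div v" using True v by (simp add: pos_imp_zdiv_nonneg_iff)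
    ultimately show ?thesis by simp
  next
    case False
    have "u \<le> u div v" using zdiv_mono2_neg[of u 1 v] False v by simp
    moreover have "u div v < 0" using False v by (simp add: pos_imp_zdiv_neg_iff)
    ultimately show ?thesis using False by simp
  qed
  show ?thesis
  proof (cases "y > 0")
    case True thus ?thesis by (rule pos)
  next
    case F: False
    hence "- y > 0" using False by simp
    from pos[OF this, of "- x"] show ?thesis by simp
  qed
qed simp

lemma bits_div: "bits (x div y) \<le> bits x"
  by (intro bits_mono abs_div_le)

lemma bits_of_nat: "bits (int n) \<le> n + 1"
proof -
  have "int n < 2 ^ n" by (rule of_nat_less_two_power)
  thus ?thesis by (simp flip: Suc_eq_plus1 add: bits_le_iff)
qed

lemma bits_le_of_nonneg: "0 \<le> z \<Longrightarrow> z < int U \<Longrightarrow> bits z \<le> U"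
  using bits_of_nat[of "nat z"] by (simp; linarith)

lemma bits_of_bool: "bits (of_bool b) \<le> 2"
  by (cases b) (simp_all flip: numeral_2_eq_2 add: bits_le_iff[of _ 1, simplified])

section \<open>Polynomial growth and cost bounds for machine expressions\<close>

definition poly_bounded :: "(nat \<Rightarrow> nat) \<Rightarrow> bool" where
  "poly_bounded f \<longleftrightarrow> (\<exists>p :: nat poly. \<forall>x. f x \<le> poly p x)"

text \<open>The coefficients are natural numbers, hence nonnegative. This monotonicity is what
  closes \<open>poly_bounded\<close> under composition.\<close>

lemma poly_nat_mono: "x \<le> y \<Longrightarrow> poly p x \<le> poly p (y :: nat)"
  by (induction p) (auto intro: add_mono mult_mono)

named_theorems poly_bounded_intros

lemma poly_bounded_const [poly_bounded_intros]: "poly_bounded (\<lambda>_. c)"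
  unfolding poly_bounded_def by (intro exI[of _ "[:c:]"]) simp

lemma poly_bounded_id [poly_bounded_intros]: "poly_bounded (\<lambda>x. x)"
  unfolding poly_bounded_def by (intro exI[of _ "[:0, 1:]"]) simp

lemma poly_bounded_add [poly_bounded_intros]:
  "poly_bounded f \<Longrightarrow> poly_bounded g \<Longrightarrow> poly_bounded (\<lambda>x. f x + g x)"
  unfolding poly_bounded_def by (metis add_mono poly_add)

lemma poly_bounded_mult [poly_bounded_intros]:
  "poly_bounded f \<Longrightarrow> poly_bounded g \<Longrightarrow> poly_bounded (\<lambda>x. f x * g x)"
  unfolding poly_bounded_def by (metis mult_le_mono poly_mult)

lemma poly_bounded_power [poly_bounded_intros]: "poly_bounded f \<Longrightarrow> poly_bounded (\<lambda>x. f x ^ n)"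
  by (induction n) (auto intro!: poly_bounded_intros)

lemma poly_bounded_compose:
  assumes "poly_bounded f" "poly_bounded g"
  shows "poly_bounded (\<lambda>x. f (g x))"
proof -
  obtain p q where p: "\<And>x. f x \<le> poly p x" and q: "\<And>x. g x \<le> poly q x"
    using assms unfolding poly_bounded_def by blast
  have "f (g x) \<le> poly (pcompose p q) x" for x
    using order.trans[OF p poly_nat_mono[OF q]] by (simp add: poly_pcompose)
  thus ?thesis unfolding poly_bounded_def by blast
qed

definition mem_bound :: "nat \<Rightarrow> mem \<Rightarrow> bool" where
  "mem_bound U M \<longleftrightarrow> (\<forall>a. bits (M a) \<le> U)"

text \<open>A read has length at most \<open>U\<close> whatever its address, so the bound depends on
  the shape of the expression and on \<open>U\<close>, not on the memory.\<close>

primrec val_bound :: "aexp \<Rightarrow> nat \<Rightarrow> nat" where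
  "val_bound (Const z) U = bits z"
| "val_bound (Cell a) U = U"
| "val_bound (Plus a b) U = val_bound a U + val_bound b U"
| "val_bound (Minus a b) U = val_bound a U + val_bound b U"
| "val_bound (Times a b) U = val_bound a U + val_bound b U"
| "val_bound (Div a b) U = val_bound a U"

primrec cost_bound :: "aexp \<Rightarrow> nat \<Rightarrow> nat" where
  "cost_bound (Const z) U = bits z"
| "cost_bound (Cell a) U = cost_bound a U + val_bound a U + U"
| "cost_bound (Plus a b) U = cost_bound a U + cost_bound b U + val_bound a U * val_bound b U"
| "cost_bound (Minus a b) U = cost_bound a U + cost_bound b U + val_bound a U * val_bound b U"
| "cost_bound (Times a b) U = cost_bound a U + cost_bound b U + val_bound a U * val_bound b U"
| "cost_bound (Div a b) U = cost_bound a U + cost_bound b U + val_bound a U * val_bound b U"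

lemma bits_aval: "mem_bound U M \<Longrightarrow> bits (aval a M) \<le> val_bound a U"
proof (induction a)
  case (Plus a b) thus ?case using bits_add[of "aval a M" "aval b M"] by simp
next
  case (Minus a b) thus ?case using bits_diff[of "aval a M" "aval b M"] by simp
next
  case (Times a b) thus ?case using bits_mult[of "aval a M" "aval b M"] by simp
next
  case (Div a b) thus ?case using bits_div[of "aval a M" "aval b M"] by simp
qed (auto simp: mem_bound_def)

lemma acost_le: "mem_bound U M \<Longrightarrow> acost a M \<le> cost_bound a U"
  by (induction a) (auto intro!: add_mono mult_le_mono bits_aval simp: mem_bound_def)

lemma poly_bounded_val_bound [poly_bounded_intros]: "poly_bounded (val_bound a)"
  by (induction a) (auto intro!: poly_bounded_intros)

lemma poly_bounded_cost_bound [poly_bounded_intros]: "poly_bounded (cost_bound a)"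
  by (induction a) (auto intro!: poly_bounded_intros)

text \<open>A point distribution expresses a deterministic run. Quantifying over the start time
  makes the time bounds add up under sequencing.\<close>

definition runs :: "com \<Rightarrow> mem \<Rightarrow> mem \<Rightarrow> nat \<Rightarrow> bool" where
  "runs C M M' \<tau> \<longleftrightarrow> (\<forall>t. \<exists>t' \<le> t + \<tau>. exec C (M, t) (return_pmf (M', t')))"

definition assign_bound :: "aexp \<Rightarrow> aexp \<Rightarrow> nat \<Rightarrow> nat" where
  "assign_bound a b U = cost_bound a U + cost_bound b U + val_bound a U + val_bound b U"

lemma poly_bounded_assign_bound [poly_bounded_intros]: "poly_bounded (assign_bound a b)"
  unfolding assign_bound_def by (intro poly_bounded_intros)

lemma runs_Assign:
  assumes "mem_bound U M" "M' = M(aval a M := aval b M)"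
  shows "runs (Assign a b) M M' (assign_bound a b U)"
  unfolding runs_def
proof (intro allI)
  fix t
  have "exec (Assign a b) (M, t) (return_pmf (M',
        t + acost a M + acost b M + bits (aval a M) + bits (aval b M)))"
    unfolding assms(2) by (rule exec.Assign)
  moreover have "t + acost a M + acost b M + bits (aval a M) + bits (aval b M) \<le> t + assign_bound a b U"
    using acost_le[OF assms(1), of a] acost_le[OF assms(1), of b]
      bits_aval[OF assms(1), of a] bits_aval[OF assms(1), of b] by (simp add: assign_bound_def)
  ultimately show "\<exists>t'\<le>t + assign_bound a b U. exec (Assign a b) (M, t) (return_pmf (M', t'))"
    by blast
qed

lemma runs_Seq:
  assumes "runs C M M' \<tau>" "runs D M' M'' \<tau>'"
  shows "runs (Seq C D) M M'' (\<tau> + \<tau>')"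
  unfolding runs_def
proof (intro allI)
  fix t
  obtain t1 where 1: "t1 \<le> t + \<tau>" "exec C (M, t) (return_pmf (M', t1))"
    using assms(1) unfolding runs_def by blast
  obtain t2 where 2: "t2 \<le> t1 + \<tau>'" "exec D (M', t1) (return_pmf (M'', t2))"
    using assms(2) unfolding runs_def by blast
  have "exec (Seq C D) (M, t) (bind_pmf (return_pmf (M', t1)) (\<lambda>_. return_pmf (M'', t2)))"
    using 1 2 by (intro exec.Seq) auto
  thus "\<exists>t'\<le>t + (\<tau> + \<tau>'). exec (Seq C D) (M, t) (return_pmf (M'', t'))"
    using 1 2 by (intro exI[of _ t2]) (auto simp: bind_return_pmf)
qed

text \<open>The states \<open>Ms\<close> before the rounds are given in advance, so the induction
  peels off the first round by shifting the sequence. The trailing \<open>c + 1\<close> pays for the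
  failing test.\<close>

lemma runs_While:
  assumes "\<And>i. i < k \<Longrightarrow> 0 < aval b (Ms i)" "\<not> 0 < aval b (Ms k)"
    and "\<And>i. i \<le> k \<Longrightarrow> acost b (Ms i) \<le> c"
    and "\<And>i. i < k \<Longrightarrow> runs C (Ms i) (Ms (Suc i)) \<tau>"
  shows "runs (While b C) (Ms 0) (Ms k) (k * (\<tau> + c + 1) + c + 1)"
  using assms
proof (induction k arbitrary: Ms)
  case 0
  have "exec (While b C) (Ms 0, t) (return_pmf (Ms 0, t + acost b (Ms 0) + 1))" for t
    using 0 by (intro exec.While_False) auto
  moreover have "acost b (Ms 0) \<le> c" using 0(3)[of 0] by simp
  hence "t + acost b (Ms 0) + 1 \<le> t + (0 * (\<tau> + c + 1) + c + 1)" for t by simp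
  ultimately show ?case unfolding runs_def by blast
next
  case (Suc k)
  have IH: "runs (While b C) (Ms (Suc 0)) (Ms (Suc k)) (k * (\<tau> + c + 1) + c + 1)"
    using Suc.prems by (intro Suc.IH[of "\<lambda>i. Ms (Suc i)"]) auto
  show ?case unfolding runs_def
  proof (intro allI)
    fix t
    let ?t0 = "t + acost b (Ms 0) + 1"
    have t0: "?t0 \<le> t + c + 1" using Suc.prems(3)[of 0] by simp
    have r0: "runs C (Ms 0) (Ms (Suc 0)) \<tau>" using Suc.prems(4)[of 0] by simp
    obtain t1 where 1: "t1 \<le> ?t0 + \<tau>" "exec C (Ms 0, ?t0) (return_pmf (Ms (Suc 0), t1))"
      using r0 unfolding runs_def by blast
    obtain t2 where 2: "t2 \<le> t1 + (k * (\<tau> + c + 1) + c + 1)"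
        "exec (While b C) (Ms (Suc 0), t1) (return_pmf (Ms (Suc k), t2))"
      using IH unfolding runs_def by blast
    have "exec (While b C) (Ms 0, t) (bind_pmf (return_pmf (Ms (Suc 0), t1)) (\<lambda>_. return_pmf (Ms (Suc k), t2)))"
      using 1 2 Suc.prems(1)[of 0] by (intro exec.While_True) auto
    thus "\<exists>t'\<le>t + (Suc k * (\<tau> + c + 1) + c + 1). exec (While b C) (Ms 0, t) (return_pmf (Ms (Suc k), t'))"
      using 1 2 t0 by (intro exI[of _ t2]) (auto simp: bind_return_pmf)
  qed
qed

lemma runs_mono: "runs C M M' \<tau> \<Longrightarrow> \<tau> \<le> \<tau>' \<Longrightarrow> runs C M M' \<tau>'"
  unfolding runs_def by (meson add_left_mono order_trans)

subsection \<open>Array programs\<close>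

type_synonym arrays = "nat \<Rightarrow> nat \<Rightarrow> int"

text \<open>Array 0 occupies the nonnegative addresses because input and output are fixed there. All
  other arrays share the addresses from -8 downwards through the pairing function, which leaves a
  few negative cells free for scratch variables.\<close>

definition addr :: "nat \<Rightarrow> nat \<Rightarrow> int" where
  "addr r i = (case r of 0 \<Rightarrow> int i | Suc r' \<Rightarrow> - 8 - int (prod_encode (r', i)))"

definition mem_of :: "arrays \<Rightarrow> mem" where
  "mem_of \<sigma> a = (if 0 \<le> a then \<sigma> 0 (nat a)
     else if a \<le> - 8 then (case prod_decode (nat (- 8 - a)) of (r, i) \<Rightarrow> \<sigma> (Suc r) i) else 0)"

lemma mem_of_addr [simp]: "mem_of \<sigma> (addr r i) = \<sigma> r i"
  by (cases r) (simp_all add: addr_def mem_of_def)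

lemma addr_cases: "(0 \<le> a \<or> a \<le> - 8) \<Longrightarrow> \<exists>r i. a = addr r i"
proof (cases "0 \<le> a")
  case True
  thus ?thesis by (intro exI[of _ 0] exI[of _ "nat a"]) (simp add: addr_def)
next
  case False
  assume "0 \<le> a \<or> a \<le> - 8"
  hence "a \<le> - 8" using False by simp
  thus ?thesis
    by (intro exI[of _ "Suc (fst (prod_decode (nat (- 8 - a))))"] exI[of _ "snd (prod_decode (nat (- 8 - a)))"])
       (simp add: addr_def)
qed

lemma addr_range: "0 \<le> addr r i \<or> addr r i \<le> - 8"
  by (cases r) (simp_all add: addr_def)

lemma addr_inject [simp]: "addr r i = addr r' i' \<longleftrightarrow> r = r' \<and> i = i'"
  by (auto simp: addr_def split: nat.splits dest!: injD[OF inj_prod_encode])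

lemma mem_of_other: "\<not> (0 \<le> a \<or> a \<le> - 8) \<Longrightarrow> mem_of \<sigma> a = 0"
  by (simp add: mem_of_def)

lemma mem_of_upd: "(mem_of \<sigma>)(addr r i := v) = mem_of (\<sigma>(r := (\<sigma> r)(i := v)))"
proof
  fix a
  show "((mem_of \<sigma>)(addr r i := v)) a = mem_of (\<sigma>(r := (\<sigma> r)(i := v))) a"
  proof (cases "0 \<le> a \<or> a \<le> - 8")
    case True
    then obtain r' i' where "a = addr r' i'" using addr_cases by blast
    thus ?thesis by auto
  next
    case False
    thus ?thesis using addr_range[of r i] by (auto simp: mem_of_other)
  qed
qed

text \<open>Loop variables and temporaries live in the cells -1 to -5, which \<^const>\<open>mem_of\<close> leaves at 0.\<close>

definition work_mem :: "arrays \<Rightarrow> int \<Rightarrow> int \<Rightarrow> int \<Rightarrow> int \<Rightarrow> int \<Rightarrow> mem" where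
  "work_mem \<sigma> i l a n b = (mem_of \<sigma>)(- 1 := i, - 2 := l, - 3 := a, - 4 := n, - 5 := b)"

lemma work_mem_0: "work_mem \<sigma> 0 0 0 0 0 = mem_of \<sigma>"
  by (auto simp: work_mem_def mem_of_other)

lemma work_mem_simps [simp]:
  "work_mem \<sigma> i l a n b (- 1) = i" "work_mem \<sigma> i l a n b (- 2) = l"
  "work_mem \<sigma> i l a n b (- 3) = a" "work_mem \<sigma> i l a n b (- 4) = n"
  "work_mem \<sigma> i l a n b (- 5) = b"
  by (simp_all add: work_mem_def)

lemma work_mem_addr [simp]: "work_mem \<sigma> i l a n b (addr r j) = \<sigma> r j"
proof -
  have "addr r j \<notin> {- 1, - 2, - 3, - 4, - 5}" using addr_range[of r j] by auto
  thus ?thesis by (simp add: work_mem_def)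
qed

lemma work_mem_upd [simp]:
  "(work_mem \<sigma> i l a n b)(- 1 := v) = work_mem \<sigma> v l a n b"
  "(work_mem \<sigma> i l a n b)(- 2 := v) = work_mem \<sigma> i v a n b"
  "(work_mem \<sigma> i l a n b)(- 3 := v) = work_mem \<sigma> i l v n b"
  "(work_mem \<sigma> i l a n b)(- 4 := v) = work_mem \<sigma> i l a v b"
  "(work_mem \<sigma> i l a n b)(- 5 := v) = work_mem \<sigma> i l a n v"
  by (auto simp: work_mem_def)

lemma work_mem_upd_addr [simp]:
  "(work_mem \<sigma> i l a n b)(addr r j := v) = work_mem (\<sigma>(r := (\<sigma> r)(j := v))) i l a n b"
proof -
  have "addr r j \<notin> {- 1, - 2, - 3, - 4, - 5}" using addr_range[of r j] by auto
  thus ?thesis by (auto simp: work_mem_def simp flip: mem_of_upd)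
qed

definition arrays_bound :: "nat \<Rightarrow> arrays \<Rightarrow> bool" where
  "arrays_bound U \<sigma> \<longleftrightarrow> (\<forall>r i. bits (\<sigma> r i) \<le> U)"

lemma arrays_boundD: "arrays_bound U \<sigma> \<Longrightarrow> bits (\<sigma> r i) \<le> U"
  by (simp add: arrays_bound_def)

lemma arrays_bound_pos: "arrays_bound U \<sigma> \<Longrightarrow> 1 \<le> U"
  using bits_pos order_trans unfolding arrays_bound_def by blast

lemma arrays_bound_mono: "arrays_bound U \<sigma> \<Longrightarrow> U \<le> U' \<Longrightarrow> arrays_bound U' \<sigma>"
  unfolding arrays_bound_def using order_trans by blast

lemma mem_bound_work_mem:
  assumes "arrays_bound U \<sigma>" "bits i \<le> U" "bits l \<le> U" "bits a \<le> U" "bits n \<le> U" "bits b \<le> U"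
  shows "mem_bound U (work_mem \<sigma> i l a n b)"
  using assms arrays_bound_pos[OF assms(1)]
  by (auto simp: mem_bound_def work_mem_def mem_of_def arrays_bound_def split: prod.splits)

lemma mem_bound_mem_of: "arrays_bound U \<sigma> \<Longrightarrow> mem_bound U (mem_of \<sigma>)"
  using arrays_bound_pos[of U \<sigma>]
  by (auto simp: mem_bound_def mem_of_def arrays_bound_def split: prod.splits)

text \<open>
  \<open>Ix\<close>, \<open>Lx\<close> and \<open>Ac\<close> stand for the index of the array entry being computed, the index of the inner
  loop, and its accumulator. Array indices are taken in absolute value, so that no side condition
  on their sign is needed.
\<close>

datatype ex = N int | Ix | Lx | Ac | Rd nat ex | Add ex ex | Sub ex ex | Mul ex ex | Dv ex ex

primrec ev :: "ex \<Rightarrow> int \<Rightarrow> int \<Rightarrow> int \<Rightarrow> arrays \<Rightarrow> int" where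
  "ev (N z) i l a \<sigma> = z"
| "ev Ix i l a \<sigma> = i"
| "ev Lx i l a \<sigma> = l"
| "ev Ac i l a \<sigma> = a"
| "ev (Rd r e) i l a \<sigma> = \<sigma> r (nat \<bar>ev e i l a \<sigma>\<bar>)"
| "ev (Add e f) i l a \<sigma> = ev e i l a \<sigma> + ev f i l a \<sigma>"
| "ev (Sub e f) i l a \<sigma> = ev e i l a \<sigma> - ev f i l a \<sigma>"
| "ev (Mul e f) i l a \<sigma> = ev e i l a \<sigma> * ev f i l a \<sigma>"
| "ev (Dv e f) i l a \<sigma> = ev e i l a \<sigma> div ev f i l a \<sigma>"

definition neg_exp :: "aexp \<Rightarrow> aexp" where
  "neg_exp e = Times (Const (- 1)) (Div e (Plus (Times e e) (Const 1)))"

text \<open>For x < 0 the exact quotient lies strictly between -1 and 0 and is floored to -1;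
  otherwise it lies in [0, 1). This turns a sign into a value, so comparisons become expressions
  although the machine branches only in commands.\<close>

lemma div_Suc_square: "(x :: int) div (x * x + 1) = - of_bool (x < 0)"
proof (cases "x < 0")
  case True
  have sq: "- x * 1 \<le> - x * - x" using True by (intro mult_left_mono) auto
  have "x div (x * x + 1) = - 1"
    by (rule int_div_pos_eq[of _ _ _ "x + (x * x + 1)"]) (use sq True in auto)
  thus ?thesis using True by simp
next
  case False
  have "x \<le> x * x"
  proof (cases "x = 0")
    case False
    hence "x * 1 \<le> x * x" using \<open>\<not> x < 0\<close> by (intro mult_left_mono) auto
    thus ?thesis by simp
  qed simp
  hence "x div (x * x + 1) = 0" using False by (intro div_pos_pos_trivial) auto
  thus ?thesis using False by simp
qed

lemma aval_neg_exp [simp]: "aval (neg_exp e) M = of_bool (aval e M < 0)"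
  by (simp add: neg_exp_def div_Suc_square)

definition abs_exp :: "aexp \<Rightarrow> aexp" where
  "abs_exp e = Times e (Minus (Const 1) (Times (Const 2) (neg_exp e)))"

lemma aval_abs_exp [simp]: "aval (abs_exp e) M = \<bar>aval e M\<bar>"
  by (simp add: abs_exp_def abs_if)

text \<open>Cantor's pairing function in closed form, s (s + 1) / 2 + r' with s the sum of both
  components, computed by machine arithmetic.\<close>

definition addr_exp :: "nat \<Rightarrow> aexp \<Rightarrow> aexp" where
  "addr_exp r e = (case r of 0 \<Rightarrow> abs_exp e | Suc r' \<Rightarrow>
     (let s = Plus (Const (int r')) (abs_exp e) in
      Minus (Const (- 8)) (Plus (Div (Times s (Plus s (Const 1))) (Const 2)) (Const (int r')))))"

lemma aval_addr_exp [simp]: "aval (addr_exp r e) M = addr r (nat \<bar>aval e M\<bar>)"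
  by (simp add: addr_exp_def addr_def Let_def prod_encode_def triangle_def zdiv_int algebra_simps split: nat.splits)

primrec compile :: "ex \<Rightarrow> aexp" where
  "compile (N z) = Const z"
| "compile Ix = Cell (Const (- 1))"
| "compile Lx = Cell (Const (- 2))"
| "compile Ac = Cell (Const (- 3))"
| "compile (Rd r e) = Cell (addr_exp r (compile e))"
| "compile (Add e f) = Plus (compile e) (compile f)"
| "compile (Sub e f) = Minus (compile e) (compile f)"
| "compile (Mul e f) = Times (compile e) (compile f)"
| "compile (Dv e f) = Div (compile e) (compile f)"

lemma aval_compile [simp]: "aval (compile e) (work_mem \<sigma> i l a n b) = ev e i l a \<sigma>"
  by (induction e) auto

primrec reads :: "ex \<Rightarrow> nat set" where
  "reads (N z) = {}"
| "reads Ix = {}"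
| "reads Lx = {}"
| "reads Ac = {}"
| "reads (Rd r e) = insert r (reads e)"
| "reads (Add e f) = reads e \<union> reads f"
| "reads (Sub e f) = reads e \<union> reads f"
| "reads (Mul e f) = reads e \<union> reads f"
| "reads (Dv e f) = reads e \<union> reads f"

lemma ev_cong: "(\<And>r. r \<in> reads e \<Longrightarrow> \<sigma> r = \<sigma>' r) \<Longrightarrow> ev e i l a \<sigma> = ev e i l a \<sigma>'"
  by (induction e) auto

primrec ex_bound :: "ex \<Rightarrow> nat \<Rightarrow> nat" where
  "ex_bound (N z) U = bits z"
| "ex_bound Ix U = U"
| "ex_bound Lx U = U"
| "ex_bound Ac U = U"
| "ex_bound (Rd r e) U = U"
| "ex_bound (Add e f) U = ex_bound e U + ex_bound f U"
| "ex_bound (Sub e f) U = ex_bound e U + ex_bound f U"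
| "ex_bound (Mul e f) U = ex_bound e U + ex_bound f U"
| "ex_bound (Dv e f) U = ex_bound e U"

lemma poly_bounded_ex_bound [poly_bounded_intros]: "poly_bounded (ex_bound e)"
  by (induction e) (auto intro!: poly_bounded_intros)

lemma bits_ev:
  assumes "arrays_bound U \<sigma>" "bits i \<le> U" "bits l \<le> U" "bits a \<le> U"
  shows "bits (ev e i l a \<sigma>) \<le> ex_bound e U"
proof (induction e)
  case (Add e f) thus ?case using bits_add[of "ev e i l a \<sigma>" "ev f i l a \<sigma>"] by simp
next
  case (Sub e f) thus ?case using bits_diff[of "ev e i l a \<sigma>" "ev f i l a \<sigma>"] by simp
next
  case (Mul e f) thus ?case using bits_mult[of "ev e i l a \<sigma>" "ev f i l a \<sigma>"] by simp
next
  case (Dv e f) thus ?case using bits_div[of "ev e i l a \<sigma>" "ev f i l a \<sigma>"] by simp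
qed (use assms in \<open>auto simp: arrays_bound_def\<close>)

primrec no_acc :: "ex \<Rightarrow> bool" where
  "no_acc (N z) = True"
| "no_acc Ix = True"
| "no_acc Lx = True"
| "no_acc Ac = False"
| "no_acc (Rd r e) = no_acc e"
| "no_acc (Add e f) = (no_acc e \<and> no_acc f)"
| "no_acc (Sub e f) = (no_acc e \<and> no_acc f)"
| "no_acc (Mul e f) = (no_acc e \<and> no_acc f)"
| "no_acc (Dv e f) = (no_acc e \<and> no_acc f)"

lemma ev_no_acc: "no_acc e \<Longrightarrow> ev e i l a \<sigma> = ev e i l a' \<sigma>"
  by (induction e) auto

definition Lt :: "ex \<Rightarrow> ex \<Rightarrow> ex" where
  "Lt e f = Mul (N (- 1)) (Dv (Sub e f) (Add (Mul (Sub e f) (Sub e f)) (N 1)))"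

definition Ite :: "ex \<Rightarrow> ex \<Rightarrow> ex \<Rightarrow> ex" where
  "Ite c e f = Add (Mul c e) (Mul (Sub (N 1) c) f)"

definition Eq :: "ex \<Rightarrow> ex \<Rightarrow> ex" where
  "Eq e f = Sub (Sub (N 1) (Lt e f)) (Lt f e)"

lemma ev_Lt [simp]: "ev (Lt e f) i l a \<sigma> = of_bool (ev e i l a \<sigma> < ev f i l a \<sigma>)"
  by (simp add: Lt_def div_Suc_square)

lemma ev_Eq [simp]: "ev (Eq e f) i l a \<sigma> = of_bool (ev e i l a \<sigma> = ev f i l a \<sigma>)"
  by (simp add: Eq_def)

lemma ev_Ite [simp]:
  "ev (Ite c e f) i l a \<sigma> = ev c i l a \<sigma> * ev e i l a \<sigma> + (1 - ev c i l a \<sigma>) * ev f i l a \<sigma>"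
  by (simp add: Ite_def)

lemma reads_macros [simp]:
  "reads (Lt e f) = reads e \<union> reads f" "reads (Eq e f) = reads e \<union> reads f"
  "reads (Ite c e f) = reads c \<union> reads e \<union> reads f"
  by (auto simp: Lt_def Eq_def Ite_def)

lemma no_acc_macros [simp]:
  "no_acc (Lt e f) \<longleftrightarrow> no_acc e \<and> no_acc f" "no_acc (Eq e f) \<longleftrightarrow> no_acc e \<and> no_acc f"
  "no_acc (Ite c e f) \<longleftrightarrow> no_acc c \<and> no_acc e \<and> no_acc f"
  by (auto simp: Lt_def Eq_def Ite_def)

text \<open>Every step adds to, multiplies or conditionally overwrites the accumulator by a value that
  does not depend on it, so that its length grows by a bounded amount per step.\<close>

datatype step = SAdd ex | SMul ex | SIf ex ex ex

fun step_ex :: "step \<Rightarrow> ex" where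
  "step_ex (SAdd e) = Add Ac e"
| "step_ex (SMul e) = Mul Ac e"
| "step_ex (SIf c d e) = Ite (Lt c d) e Ac"

lemma poly_bounded_Suc [poly_bounded_intros]: "poly_bounded f \<Longrightarrow> poly_bounded (\<lambda>x. Suc (f x))"
  using poly_bounded_add[OF _ poly_bounded_const[of 1], of f] by simp

primrec step_operand :: "step \<Rightarrow> ex" where
  "step_operand (SAdd e) = e"
| "step_operand (SMul e) = e"
| "step_operand (SIf c d e) = e"

text \<open>The result of \<open>SIf\<close> is either the operand or the old accumulator, so its
  condition may read the accumulator without any effect on the length.\<close>

lemma bits_step:
  assumes "no_acc (step_operand s)" "arrays_bound U \<sigma>" "bits i \<le> U" "bits l \<le> U"
  shows "bits (ev (step_ex s) i l a \<sigma>) \<le> bits a + ex_bound (step_operand s) U"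
proof -
  \<comment> \<open>The accumulator may be longer than \<open>U\<close>; as the operand ignores it,
    it is replaced by 0 before \<open>bits_ev\<close> is applied.\<close>
  have e: "bits (ev (step_operand s) i l a \<sigma>) \<le> ex_bound (step_operand s) U"
    unfolding ev_no_acc[OF assms(1), of i l a \<sigma> 0]
    using assms arrays_bound_pos[OF assms(2)] by (intro bits_ev) auto
  show ?thesis
  proof (cases s)
    case (SAdd x)
    thus ?thesis using e bits_add[of a "ev x i l a \<sigma>"] by simp
  next
    case (SMul x)
    thus ?thesis using e bits_mult[of a "ev x i l a \<sigma>"] by simp
  next
    case (SIf c d x)
    thus ?thesis using e by (auto simp: of_bool_def)
  qed
qed

primrec iter :: "ex \<Rightarrow> arrays \<Rightarrow> int \<Rightarrow> int \<Rightarrow> nat \<Rightarrow> int" where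
  "iter e \<sigma> i a 0 = a"
| "iter e \<sigma> i a (Suc l) = ev e i (int l) (iter e \<sigma> i a l) \<sigma>"

text \<open>\<open>Fill r len bnd init s\<close> recomputes the first \<open>len\<close> entries of array \<open>r\<close>: entry \<open>i\<close> becomes the
  accumulator after \<open>bnd\<close> steps \<open>s\<close> started from \<open>init\<close>, in which \<open>Ac\<close> denotes the old entry.\<close>

datatype fill = Fill nat ex ex ex step

primrec fill_val :: "fill \<Rightarrow> arrays \<Rightarrow> nat \<Rightarrow> int" where
  "fill_val (Fill r len bnd init s) \<sigma> i =
     iter (step_ex s) \<sigma> (int i) (ev init (int i) 0 (\<sigma> r i) \<sigma>) (nat (ev bnd (int i) 0 (\<sigma> r i) \<sigma>))"

primrec fill_den :: "fill \<Rightarrow> arrays \<Rightarrow> arrays" where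
  "fill_den (Fill r len bnd init s) \<sigma> =
     \<sigma>(r := (\<lambda>i. if int i < ev len 0 0 0 \<sigma> then fill_val (Fill r len bnd init s) \<sigma> i else \<sigma> r i))"

text \<open>\<open>fill_den\<close> computes all entries from the old state, while the machine
  overwrites the array in place. Both agree if an entry sees its own array only through
  \<open>Ac\<close>, its own old value. The length is evaluated before the first write.\<close>

primrec fill_wf :: "fill \<Rightarrow> bool" where
  "fill_wf (Fill r len bnd init s) \<longleftrightarrow>
     r \<notin> reads bnd \<and> r \<notin> reads init \<and> r \<notin> reads (step_ex s) \<and> no_acc (step_operand s)"

primrec fill_ok :: "nat \<Rightarrow> fill \<Rightarrow> arrays \<Rightarrow> bool" where
  "fill_ok U (Fill r len bnd init s) \<sigma> \<longleftrightarrow>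
     0 \<le> ev len 0 0 0 \<sigma> \<and> ev len 0 0 0 \<sigma> < int U \<and>
     (\<forall>i. int i < ev len 0 0 0 \<sigma> \<longrightarrow>
        0 \<le> ev bnd (int i) 0 (\<sigma> r i) \<sigma> \<and> ev bnd (int i) 0 (\<sigma> r i) \<sigma> < int U)"

lemma fill_ok_mono: "fill_ok U f \<sigma> \<Longrightarrow> U \<le> U' \<Longrightarrow> fill_ok U' f \<sigma>"
  by (cases f) force

definition inc :: "int \<Rightarrow> com" where
  "inc z = Assign (Const z) (Plus (Cell (Const z)) (Const 1))"

definition clear :: "int \<Rightarrow> com" where
  "clear z = Assign (Const z) (Const 0)"

definition inner_com :: "step \<Rightarrow> com" where
  "inner_com s = Seq (Assign (Const (- 3)) (compile (step_ex s))) (inc (- 2))"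

definition inner_cond :: aexp where
  "inner_cond = Minus (Cell (Const (- 5))) (Cell (Const (- 2)))"

definition outer_cond :: aexp where
  "outer_cond = Minus (Cell (Const (- 4))) (Cell (Const (- 1)))"

text \<open>Cell -3 holds the old entry while the bound and the start value are evaluated, and the
  accumulator afterwards. The final resets give every round the same initial shape.\<close>

primrec outer_com :: "fill \<Rightarrow> com" where
  "outer_com (Fill r len bnd init s) =
     Seq (Assign (Const (- 3)) (compile (Rd r Ix)))
    (Seq (Assign (Const (- 5)) (compile bnd))
    (Seq (Assign (Const (- 3)) (compile init))
    (Seq (While inner_cond (inner_com s))
    (Seq (Assign (addr_exp r (compile Ix)) (compile Ac))
    (Seq (clear (- 2)) (Seq (clear (- 3)) (Seq (clear (- 5)) (inc (- 1)))))))))"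

primrec fill_com :: "fill \<Rightarrow> com" where
  "fill_com (Fill r len bnd init s) =
     Seq (Assign (Const (- 4)) (compile len))
    (Seq (While outer_cond (outer_com (Fill r len bnd init s)))
    (Seq (clear (- 4)) (clear (- 1))))"

definition inc_time :: "int \<Rightarrow> nat \<Rightarrow> nat" where
  "inc_time z = assign_bound (Const z) (Plus (Cell (Const z)) (Const 1))"

definition clear_time :: "int \<Rightarrow> nat \<Rightarrow> nat" where
  "clear_time z = assign_bound (Const z) (Const 0)"

definition inner_time :: "step \<Rightarrow> nat \<Rightarrow> nat" where
  "inner_time s U = assign_bound (Const (- 3)) (compile (step_ex s)) U + inc_time (- 2) U"

primrec outer_time :: "fill \<Rightarrow> nat \<Rightarrow> nat" where
  "outer_time (Fill r len bnd init s) U =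
     assign_bound (Const (- 3)) (compile (Rd r Ix)) U + assign_bound (Const (- 5)) (compile bnd) U +
     assign_bound (Const (- 3)) (compile init) U +
     (U * (inner_time s U + cost_bound inner_cond U + 1) + cost_bound inner_cond U + 1) +
     assign_bound (addr_exp r (compile Ix)) (compile Ac) U +
     clear_time (- 2) U + clear_time (- 3) U + clear_time (- 5) U + inc_time (- 1) U"

primrec fill_time :: "fill \<Rightarrow> nat \<Rightarrow> nat" where
  "fill_time (Fill r len bnd init s) U =
     assign_bound (Const (- 4)) (compile len) U +
     (U * (outer_time (Fill r len bnd init s) U + cost_bound outer_cond U + 1) + cost_bound outer_cond U + 1) +
     clear_time (- 4) U + clear_time (- 1) U"

lemma poly_bounded_fill_time: "poly_bounded (\<lambda>U. fill_time f U)"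
  by (cases f) (auto simp: inc_time_def clear_time_def inner_time_def intro!: poly_bounded_intros)

lemma runs_inc: "mem_bound U M \<Longrightarrow> runs (inc z) M (M(z := M z + 1)) (inc_time z U)"
  unfolding inc_def inc_time_def by (rule runs_Assign) simp_all

lemma runs_clear: "mem_bound U M \<Longrightarrow> runs (clear z) M (M(z := 0)) (clear_time z U)"
  unfolding clear_def clear_time_def by (rule runs_Assign) simp_all

lemma runs_inner:
  assumes "arrays_bound U \<sigma>" "bits i \<le> U" "bits n \<le> U"
    and b: "0 \<le> b" "b < int U"
    and acc: "\<And>l. l \<le> nat b \<Longrightarrow> bits (iter (step_ex s) \<sigma> i a l) \<le> U"
  shows "runs (While inner_cond (inner_com s)) (work_mem \<sigma> i 0 a n b)
     (work_mem \<sigma> i b (iter (step_ex s) \<sigma> i a (nat b)) n b)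
     (U * (inner_time s U + cost_bound inner_cond U + 1) + cost_bound inner_cond U + 1)"
proof -
  define Ms where "Ms l = work_mem \<sigma> i (int l) (iter (step_ex s) \<sigma> i a l) n b" for l
  have mb: "mem_bound U (Ms l)" if "l \<le> nat b" for l
    unfolding Ms_def using that assms bits_le_of_nonneg[of "int l" U] bits_le_of_nonneg[OF b]
    by (intro mem_bound_work_mem acc) auto
  have *: "runs (While inner_cond (inner_com s)) (Ms 0) (Ms (nat b))
     (nat b * (inner_time s U + cost_bound inner_cond U + 1) + cost_bound inner_cond U + 1)"
  proof (rule runs_While)
    fix l assume l: "l < nat b"
    show "0 < aval inner_cond (Ms l)" using l by (simp add: inner_cond_def Ms_def)
    have mb': "mem_bound U (work_mem \<sigma> i (int l) (iter (step_ex s) \<sigma> i a (Suc l)) n b)"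
      using l assms bits_le_of_nonneg[of "int l" U] bits_le_of_nonneg[OF b]
      by (intro mem_bound_work_mem acc) auto
    have "runs (Assign (Const (- 3)) (compile (step_ex s))) (Ms l)
        (work_mem \<sigma> i (int l) (iter (step_ex s) \<sigma> i a (Suc l)) n b)
        (assign_bound (Const (- 3)) (compile (step_ex s)) U)"
      using l by (intro runs_Assign mb) (simp_all add: Ms_def)
    moreover have "runs (inc (- 2)) (work_mem \<sigma> i (int l) (iter (step_ex s) \<sigma> i a (Suc l)) n b)
        (Ms (Suc l)) (inc_time (- 2) U)"
      using runs_inc[OF mb', of "- 2"] by (simp add: Ms_def add.commute)
    ultimately show "runs (inner_com s) (Ms l) (Ms (Suc l)) (inner_time s U)"
      unfolding inner_com_def inner_time_def by (rule runs_Seq)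
  next
    show "\<not> 0 < aval inner_cond (Ms (nat b))" using b by (simp add: inner_cond_def Ms_def)
    show "acost inner_cond (Ms l) \<le> cost_bound inner_cond U" if "l \<le> nat b" for l
      by (intro acost_le mb that)
  qed
  have "Ms 0 = work_mem \<sigma> i 0 a n b" "Ms (nat b) = work_mem \<sigma> i b (iter (step_ex s) \<sigma> i a (nat b)) n b"
    using b by (simp_all add: Ms_def)
  with * have "runs (While inner_cond (inner_com s)) (work_mem \<sigma> i 0 a n b)
     (work_mem \<sigma> i b (iter (step_ex s) \<sigma> i a (nat b)) n b)
     (nat b * (inner_time s U + cost_bound inner_cond U + 1) + cost_bound inner_cond U + 1)" by simp
  thus ?thesis by (rule runs_mono) (use b in \<open>intro add_mono mult_le_mono, auto\<close>)
qed

lemma iter_cong: "(\<And>r. r \<in> reads e \<Longrightarrow> \<sigma> r = \<sigma>' r) \<Longrightarrow> iter e \<sigma> i a l = iter e \<sigma>' i a l"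
  by (induction l) (auto intro: ev_cong)

text \<open>\<open>\<sigma>\<close> is the state before the whole fill, \<open>\<sigma>'\<close> the
  one with some entries already overwritten. They agree outside \<open>r\<close> and at entry
  \<open>k\<close>, which is all that well-formed expressions can see.\<close>

lemma runs_outer:
  assumes wf: "fill_wf (Fill r len bnd init s)"
    and same: "\<And>r'. r' \<noteq> r \<Longrightarrow> \<sigma>' r' = \<sigma> r'" "\<sigma>' r k = \<sigma> r k"
    and U: "arrays_bound U \<sigma>'" "bits n \<le> U" "int k < int U"
    and bnd: "b = ev bnd (int k) 0 (\<sigma> r k) \<sigma>" "0 \<le> b" "b < int U"
    and acc: "\<And>l. l \<le> nat b \<Longrightarrow> bits (iter (step_ex s) \<sigma> (int k) (ev init (int k) 0 (\<sigma> r k) \<sigma>) l) \<le> U"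
    and \<sigma>'': "\<sigma>'' = \<sigma>'(r := (\<sigma>' r)(k := fill_val (Fill r len bnd init s) \<sigma> k))"
  shows "runs (outer_com (Fill r len bnd init s)) (work_mem \<sigma>' (int k) 0 0 n 0)
     (work_mem \<sigma>'' (int (Suc k)) 0 0 n 0) (outer_time (Fill r len bnd init s) U)"
proof -
  define a where "a = \<sigma> r k"
  define a0 where "a0 = ev init (int k) 0 a \<sigma>"
  define a1 where "a1 = iter (step_ex s) \<sigma> (int k) a0 (nat b)"
  have evb: "ev bnd (int k) 0 a \<sigma>' = b" unfolding bnd(1) a_def
    using wf by (intro ev_cong same(1)) auto
  have evi: "ev init (int k) 0 a \<sigma>' = a0" unfolding a0_def
    using wf by (intro ev_cong same(1)) auto
  have it: "iter (step_ex s) \<sigma>' (int k) a0 l = iter (step_ex s) \<sigma> (int k) a0 l" for l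
    using wf by (intro iter_cong same(1)) auto
  have acc': "bits (iter (step_ex s) \<sigma> (int k) a0 l) \<le> U" if "l \<le> nat b" for l
    using acc[OF that] by (simp add: a0_def a_def)
  have bb: "bits b \<le> U" "bits (int k) \<le> U" "bits 0 \<le> U" "bits a \<le> U" "bits a0 \<le> U" "bits a1 \<le> U"
    "bits (int k) \<le> U"
    using bnd U arrays_bound_pos[OF U(1)] arrays_boundD[OF U(1), of r k] same acc'[of 0] acc'[of "nat b"]
    by (auto intro!: bits_le_of_nonneg simp: a_def a1_def)
  have fv: "fill_val (Fill r len bnd init s) \<sigma> k = a1"
    by (simp add: a1_def a0_def a_def bnd(1))
  have ab'': "arrays_bound U \<sigma>''"
    using U(1) bb fv unfolding \<sigma>'' arrays_bound_def by auto
  note mb = mem_bound_work_mem[OF U(1)] mem_bound_work_mem[OF ab'']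
  have 1: "runs (Assign (Const (- 3)) (compile (Rd r Ix))) (work_mem \<sigma>' (int k) 0 0 n 0)
      (work_mem \<sigma>' (int k) 0 a n 0) (assign_bound (Const (- 3)) (compile (Rd r Ix)) U)"
    using bb U same by (intro runs_Assign mb) (simp_all add: a_def)
  have 2: "runs (Assign (Const (- 5)) (compile bnd)) (work_mem \<sigma>' (int k) 0 a n 0)
      (work_mem \<sigma>' (int k) 0 a n b) (assign_bound (Const (- 5)) (compile bnd) U)"
    using bb U by (intro runs_Assign mb) (simp_all add: evb)
  have 3: "runs (Assign (Const (- 3)) (compile init)) (work_mem \<sigma>' (int k) 0 a n b)
      (work_mem \<sigma>' (int k) 0 a0 n b) (assign_bound (Const (- 3)) (compile init) U)"
    using bb U by (intro runs_Assign mb) (simp_all add: evi)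
  have 4: "runs (While inner_cond (inner_com s)) (work_mem \<sigma>' (int k) 0 a0 n b)
      (work_mem \<sigma>' (int k) b a1 n b)
      (U * (inner_time s U + cost_bound inner_cond U + 1) + cost_bound inner_cond U + 1)"
    unfolding a1_def it[symmetric] using bb U bnd acc' by (intro runs_inner) (auto simp: it)
  have 5: "runs (Assign (addr_exp r (compile Ix)) (compile Ac)) (work_mem \<sigma>' (int k) b a1 n b)
      (work_mem \<sigma>'' (int k) b a1 n b) (assign_bound (addr_exp r (compile Ix)) (compile Ac) U)"
    using bb U by (intro runs_Assign mb) (simp_all add: \<sigma>'' fv del: fill_val.simps)
  have 6: "runs (clear (- 2)) (work_mem \<sigma>'' (int k) b a1 n b) (work_mem \<sigma>'' (int k) 0 a1 n b) (clear_time (- 2) U)"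
    using runs_clear[OF mb(2), of "int k" b a1 n b "- 2"] bb U by simp
  have 7: "runs (clear (- 3)) (work_mem \<sigma>'' (int k) 0 a1 n b) (work_mem \<sigma>'' (int k) 0 0 n b) (clear_time (- 3) U)"
    using runs_clear[OF mb(2), of "int k" 0 a1 n b "- 3"] bb U by simp
  have 8: "runs (clear (- 5)) (work_mem \<sigma>'' (int k) 0 0 n b) (work_mem \<sigma>'' (int k) 0 0 n 0) (clear_time (- 5) U)"
    using runs_clear[OF mb(2), of "int k" 0 0 n b "- 5"] bb U by simp
  have 9: "runs (inc (- 1)) (work_mem \<sigma>'' (int k) 0 0 n 0) (work_mem \<sigma>'' (int (Suc k)) 0 0 n 0) (inc_time (- 1) U)"
    using runs_inc[OF mb(2), of "int k" 0 0 n 0 "- 1"] bb U by (simp add: add.commute)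
  show ?thesis unfolding outer_com.simps
    by (rule runs_mono[OF runs_Seq[OF 1 runs_Seq[OF 2 runs_Seq[OF 3 runs_Seq[OF 4 runs_Seq[OF 5 runs_Seq[OF 6
          runs_Seq[OF 7 runs_Seq[OF 8 9]]]]]]]]]) simp
qed

lemma runs_fill:
  assumes wf: "fill_wf (Fill r len bnd init s)" and ok: "fill_ok U (Fill r len bnd init s) \<sigma>"
    and U: "arrays_bound U \<sigma>"
    and acc: "\<And>i l. int i < ev len 0 0 0 \<sigma> \<Longrightarrow> l \<le> nat (ev bnd (int i) 0 (\<sigma> r i) \<sigma>) \<Longrightarrow>
        bits (iter (step_ex s) \<sigma> (int i) (ev init (int i) 0 (\<sigma> r i) \<sigma>) l) \<le> U"
  shows "runs (fill_com (Fill r len bnd init s)) (mem_of \<sigma>) (mem_of (fill_den (Fill r len bnd init s) \<sigma>))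
     (fill_time (Fill r len bnd init s) U)"
proof -
  let ?f = "Fill r len bnd init s"
  define n where "n = ev len 0 0 0 \<sigma>"
  have n: "0 \<le> n" "n < int U" using ok by (auto simp: n_def)
  define \<sigma>s where "\<sigma>s k = \<sigma>(r := (\<lambda>i. if i < k then fill_val ?f \<sigma> i else \<sigma> r i))" for k
  define Ms where "Ms k = work_mem (\<sigma>s k) (int k) 0 0 n 0" for k
  have ab: "arrays_bound U (\<sigma>s k)" if "k \<le> nat n" for k
  proof -
    have "bits (fill_val ?f \<sigma> i) \<le> U" if "i < k" for i
      using acc[of i] that \<open>k \<le> nat n\<close> by (simp add: n_def)
    thus ?thesis using U by (auto simp: arrays_bound_def \<sigma>s_def)
  qed
  have b0: "bits 0 \<le> U" "bits n \<le> U" using arrays_bound_pos[OF U] n by (auto intro: bits_le_of_nonneg)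
  have mb: "mem_bound U (Ms k)" if "k \<le> nat n" for k
    unfolding Ms_def using ab[OF that] b0 that n by (intro mem_bound_work_mem) (auto intro: bits_le_of_nonneg)
  have loop: "runs (While outer_cond (outer_com ?f)) (Ms 0) (Ms (nat n))
     (nat n * (outer_time ?f U + cost_bound outer_cond U + 1) + cost_bound outer_cond U + 1)"
  proof (rule runs_While)
    fix k assume k: "k < nat n"
    show "0 < aval outer_cond (Ms k)" using k by (simp add: outer_cond_def Ms_def)
    have kn: "int k < ev len 0 0 0 \<sigma>" using k by (simp add: n_def)
    show "runs (outer_com ?f) (Ms k) (Ms (Suc k)) (outer_time ?f U)"
      unfolding Ms_def
    proof (rule runs_outer[OF wf, where \<sigma> = \<sigma> and b = "ev bnd (int k) 0 (\<sigma> r k) \<sigma>"])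
      show "\<sigma>s (Suc k) = (\<sigma>s k)(r := (\<sigma>s k r)(k := fill_val ?f \<sigma> k))"
        by (auto simp: \<sigma>s_def fun_eq_iff less_Suc_eq)
    qed (use ok kn k acc ab[of k] b0 n in \<open>auto simp: \<sigma>s_def\<close>)
  next
    show "\<not> 0 < aval outer_cond (Ms (nat n))" using n by (simp add: outer_cond_def Ms_def)
    show "acost outer_cond (Ms l) \<le> cost_bound outer_cond U" if "l \<le> nat n" for l
      by (intro acost_le mb that)
  qed
  have loop': "runs (While outer_cond (outer_com ?f)) (Ms 0) (Ms (nat n))
     (U * (outer_time ?f U + cost_bound outer_cond U + 1) + cost_bound outer_cond U + 1)"
    by (rule runs_mono[OF loop]) (use n in \<open>intro add_mono mult_le_mono, auto\<close>)
  have \<sigma>s: "\<sigma>s 0 = \<sigma>" "\<sigma>s (nat n) = fill_den ?f \<sigma>"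
    using n by (auto simp: \<sigma>s_def n_def fun_eq_iff)
  have 1: "runs (Assign (Const (- 4)) (compile len)) (mem_of \<sigma>) (Ms 0)
      (assign_bound (Const (- 4)) (compile len) U)"
    unfolding work_mem_0[symmetric, of \<sigma>] Ms_def
    using U b0 by (intro runs_Assign mem_bound_work_mem) (simp_all add: n_def \<sigma>s)
  have 2: "runs (clear (- 4)) (Ms (nat n)) (work_mem (fill_den ?f \<sigma>) n 0 0 0 0) (clear_time (- 4) U)"
    using runs_clear[OF mb, of "nat n" "- 4"] n by (simp add: Ms_def \<sigma>s)
  have "mem_bound U (work_mem (fill_den ?f \<sigma>) n 0 0 0 0)"
    using ab[of "nat n"] b0 by (intro mem_bound_work_mem) (auto simp: \<sigma>s)
  from runs_clear[OF this, of "- 1"]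
  have 3: "runs (clear (- 1)) (work_mem (fill_den ?f \<sigma>) n 0 0 0 0) (mem_of (fill_den ?f \<sigma>)) (clear_time (- 1) U)"
    by (simp add: work_mem_0)
  show ?thesis unfolding fill_com.simps
    by (rule runs_mono[OF runs_Seq[OF 1 runs_Seq[OF loop' runs_Seq[OF 2 3]]]]) simp
qed

primrec fill_growth :: "fill \<Rightarrow> nat \<Rightarrow> nat" where
  "fill_growth (Fill r len bnd init s) U = U + ex_bound init U + U * ex_bound (step_operand s) U"

lemma poly_bounded_fill_growth: "poly_bounded (\<lambda>U. fill_growth f U)"
  by (cases f) (auto intro!: poly_bounded_intros)

lemma fill_growth_ge: "U \<le> fill_growth f U"
  by (cases f) auto

text \<open>Fewer than \<open>U\<close> steps each lengthen the accumulator by at most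
  \<open>ex_bound (step_operand s) U\<close>, so the length grows additively. The run is then
  charged at the enlarged length throughout.\<close>

lemma runs_fill_growth:
  assumes wf: "fill_wf f" and ok: "fill_ok U f \<sigma>" and U: "arrays_bound U \<sigma>"
  shows "runs (fill_com f) (mem_of \<sigma>) (mem_of (fill_den f \<sigma>)) (fill_time f (fill_growth f U))"
    and "arrays_bound (fill_growth f U) (fill_den f \<sigma>)"
proof -
  obtain r len bnd init s where f: "f = Fill r len bnd init s" by (cases f)
  let ?W = "fill_growth f U"
  have acc: "bits (iter (step_ex s) \<sigma> (int i) (ev init (int i) 0 (\<sigma> r i) \<sigma>) l) \<le> ?W"
    if i: "int i < ev len 0 0 0 \<sigma>" and l: "l \<le> nat (ev bnd (int i) 0 (\<sigma> r i) \<sigma>)" for i l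
  proof -
    have iU: "int i < int U" using ok i f by auto
    have lU: "l < U" using ok i l f by force
    have "bits (iter (step_ex s) \<sigma> (int i) (ev init (int i) 0 (\<sigma> r i) \<sigma>) l)
        \<le> ex_bound init U + l * ex_bound (step_operand s) U"
      using lU
    proof (induction l)
      case 0
      show ?case using bits_ev[OF U bits_le_of_nonneg[OF _ iU], of 0 "\<sigma> r i" init]
          arrays_bound_pos[OF U] arrays_boundD[OF U] by simp
    next
      case (Suc l)
      have "bits (iter (step_ex s) \<sigma> (int i) (ev init (int i) 0 (\<sigma> r i) \<sigma>) (Suc l))
         \<le> bits (iter (step_ex s) \<sigma> (int i) (ev init (int i) 0 (\<sigma> r i) \<sigma>) l) + ex_bound (step_operand s) U"
        unfolding iter.simps using wf f Suc U iU by (intro bits_step) (auto intro!: bits_le_of_nonneg)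
      thus ?case using Suc by simp
    qed
    also have "\<dots> \<le> ex_bound init U + U * ex_bound (step_operand s) U" using lU by simp
    finally show ?thesis unfolding f by simp
  qed
  have UW: "arrays_bound ?W \<sigma>" by (rule arrays_bound_mono[OF U fill_growth_ge])
  show "runs (fill_com f) (mem_of \<sigma>) (mem_of (fill_den f \<sigma>)) (fill_time f ?W)"
    using wf fill_ok_mono[OF ok fill_growth_ge, of f] UW acc unfolding f by (rule runs_fill)
  show "arrays_bound ?W (fill_den f \<sigma>)"
    unfolding arrays_bound_def
  proof (intro allI)
    fix r' i
    show "bits (fill_den f \<sigma> r' i) \<le> ?W"
      using arrays_boundD[OF UW, of r' i] acc[of i] by (auto simp: f simp del: fill_growth.simps)
  qed
qed

text \<open>The machine has no skip command; clearing cell -1, which \<open>mem_of\<close> keeps at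
  0, serves as one.\<close>

fun fills_com :: "fill list \<Rightarrow> com" where
  "fills_com [] = clear (- 1)"
| "fills_com (f # fs) = Seq (fill_com f) (fills_com fs)"

fun fills_den :: "fill list \<Rightarrow> arrays \<Rightarrow> arrays" where
  "fills_den [] \<sigma> = \<sigma>"
| "fills_den (f # fs) \<sigma> = fills_den fs (fill_den f \<sigma>)"

fun fills_ok :: "nat \<Rightarrow> fill list \<Rightarrow> arrays \<Rightarrow> bool" where
  "fills_ok U [] \<sigma> \<longleftrightarrow> True"
| "fills_ok U (f # fs) \<sigma> \<longleftrightarrow> fill_ok U f \<sigma> \<and> fills_ok U fs (fill_den f \<sigma>)"

fun fills_time :: "fill list \<Rightarrow> nat \<Rightarrow> nat" where
  "fills_time [] U = clear_time (- 1) U"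
| "fills_time (f # fs) U = fill_time f (fill_growth f U) + fills_time fs (fill_growth f U)"

fun fills_growth :: "fill list \<Rightarrow> nat \<Rightarrow> nat" where
  "fills_growth [] U = U"
| "fills_growth (f # fs) U = fills_growth fs (fill_growth f U)"

lemma poly_bounded_fills_time: "poly_bounded (\<lambda>U. fills_time fs U)"
proof (induction fs)
  case (Cons f fs)
  show ?case unfolding fills_time.simps
    by (intro poly_bounded_intros poly_bounded_compose[OF poly_bounded_fill_time poly_bounded_fill_growth]
        poly_bounded_compose[OF Cons poly_bounded_fill_growth])
qed (auto simp: clear_time_def intro!: poly_bounded_intros)

lemma poly_bounded_fills_growth: "poly_bounded (\<lambda>U. fills_growth fs U)"
proof (induction fs)
  case (Cons f fs)
  show ?case unfolding fills_growth.simps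
    by (intro poly_bounded_compose[OF Cons poly_bounded_fill_growth])
qed (auto intro!: poly_bounded_intros)

lemma fills_ok_mono: "fills_ok U fs \<sigma> \<Longrightarrow> U \<le> U' \<Longrightarrow> fills_ok U' fs \<sigma>"
  by (induction fs arbitrary: \<sigma>) (auto intro: fill_ok_mono)

lemma runs_fills:
  assumes "list_all fill_wf fs" "fills_ok U fs \<sigma>" "arrays_bound U \<sigma>"
  shows "runs (fills_com fs) (mem_of \<sigma>) (mem_of (fills_den fs \<sigma>)) (fills_time fs U)
    \<and> arrays_bound (fills_growth fs U) (fills_den fs \<sigma>)"
  using assms
proof (induction fs arbitrary: \<sigma> U)
  case Nil
  thus ?case using runs_clear[OF mem_bound_mem_of, of U \<sigma> "- 1"]
    by (simp add: mem_of_other fun_upd_idem)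
next
  case (Cons f fs)
  note f = runs_fill_growth[of f U \<sigma>]
  have "fills_ok (fill_growth f U) fs (fill_den f \<sigma>)"
    using Cons.prems fill_growth_ge by (auto intro: fills_ok_mono)
  with Cons f show ?case by (auto intro: runs_Seq)
qed

subsection \<open>Multiplicative weights for packing programs\<close>

text \<open>Minimises the ratio \<open>c i / W i\<close> by cross-multiplication, so weight 0 counts
  as ratio infinity. Ties keep the earlier index.\<close>

primrec argmin_upto :: "(nat \<Rightarrow> int) \<Rightarrow> (nat \<Rightarrow> int) \<Rightarrow> nat \<Rightarrow> nat" where
  "argmin_upto c W 0 = 0"
| "argmin_upto c W (Suc l) =
     (if c l * W (argmin_upto c W l) < c (argmin_upto c W l) * W l then l else argmin_upto c W l)"

lemma argmin_upto_less: "0 < n \<Longrightarrow> argmin_upto c W n < n"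
proof (induction n)
  case (Suc n)
  thus ?case by (cases "n = 0") auto
qed simp

lemma argmin_upto_le: "argmin_upto c W n \<le> n"
  by (induction n) auto

lemma argmin_upto_minimal:
  assumes "\<And>i. i < n \<Longrightarrow> 0 < c i" "\<And>i. i < n \<Longrightarrow> 0 \<le> W i" "i < n"
  shows "c (argmin_upto c W n) * W i \<le> c i * W (argmin_upto c W n)"
  using assms
proof (induction n arbitrary: i)
  case (Suc l)
  show ?case
  proof (cases "l = 0")
    case False
    define b where "b = argmin_upto c W l"
    have b: "b < l" using argmin_upto_less False by (simp add: b_def)
    have IH: "c b * W j \<le> c j * W b" if "j < l" for j
      using Suc.IH[of j] Suc.prems that by (simp add: b_def)
    show ?thesis
    proof (cases "c l * W b < c b * W l")
      case True
      \<comment> \<open>Transitivity cancels \<open>W b\<close>, which must be positive for that. If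
        it is 0, the induction hypothesis forces all earlier weights to be 0 as well.\<close>
      have "c l * W i \<le> c i * W l" if "i < l"
      proof (cases "W b = 0")
        case True
        with IH[OF that] Suc.prems(1)[of b] Suc.prems(2)[of i] b that have "W i = 0"
          by (simp add: mult_le_0_iff)
        thus ?thesis using Suc.prems(1)[of i] Suc.prems(2)[of l] that by simp
      next
        case F: False
        hence Wb: "W b > 0" using Suc.prems(2)[of b] b by simp
        have "(c l * W i) * W b = (c l * W b) * W i" by (simp add: ac_simps)
        also have "\<dots> \<le> (c b * W l) * W i"
          using True Suc.prems(2)[of i] that by (intro mult_right_mono) auto
        also have "\<dots> = (c b * W i) * W l" by (simp add: ac_simps)
        also have "\<dots> \<le> (c i * W b) * W l"
          using IH[OF that] Suc.prems(2)[of l] by (intro mult_right_mono) auto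
        also have "\<dots> = (c i * W l) * W b" by (simp add: ac_simps)
        finally show ?thesis using Wb by simp
      qed
      thus ?thesis using True Suc.prems(3) by (cases "i = l") (auto simp: b_def[symmetric])
    next
      case F: False
      thus ?thesis using IH Suc.prems(3) by (cases "i = l") (auto simp: b_def[symmetric])
    qed
  qed (use Suc.prems in auto)
qed simp

definition mw_cost :: "nat \<Rightarrow> (nat \<Rightarrow> nat \<Rightarrow> int) \<Rightarrow> (nat \<Rightarrow> int) \<Rightarrow> nat \<Rightarrow> int" where
  "mw_cost R A Y i = (\<Sum>q<R. Y q * A q i)"

text \<open>Only the ratios of the weights \<open>Y\<close> matter, so scaling each update by the common factor
  \<open>D * n\<close> keeps them integral: \<open>A / n\<close> is the packing matrix and \<open>1 / D\<close> the step size.\<close>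

primrec mw :: "nat \<Rightarrow> nat \<Rightarrow> int \<Rightarrow> (nat \<Rightarrow> nat \<Rightarrow> int) \<Rightarrow> (nat \<Rightarrow> int) \<Rightarrow> nat \<Rightarrow> (nat \<Rightarrow> int) \<times> (nat \<Rightarrow> int)" where
  "mw n R D A W 0 = (\<lambda>_. 0, \<lambda>_. 1)"
| "mw n R D A W (Suc t) = (let X = fst (mw n R D A W t); Y = snd (mw n R D A W t);
       b = argmin_upto (mw_cost R A Y) W n in
     (X(b := X b + 1), \<lambda>q. Y q * (D * int n + A q b)))"

text \<open>Weighted arithmetic-geometric mean inequality for \<open>1 + x\<close> and 1. The
  exponent will be the share of a row used up by one item, which is at most 1.\<close>

lemma powr_le_one_plus_mult:
  fixes x z :: real
  assumes "0 \<le> x" "0 \<le> z" "z \<le> 1"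
  shows "(1 + x) powr z \<le> 1 + x * z"
proof -
  have "(1 + x) powr z * 1 powr (1 - z) \<le> z * (1 + x) + (1 - z) * 1"
    using Youngs_inequality_0[of z "1 - z" "1 + x" 1] assms by simp
  thus ?thesis by (simp add: algebra_simps)
qed

text \<open>\<open>S\<close> is an arbitrary integral solution against which the fractional value is
  measured; every row has capacity \<open>n\<close>. The bound \<open>A_le\<close> is restricted to
  positive weights because items that do not fit stay in the matrix with weight 0.\<close>

locale packing =
  fixes n R :: nat and D :: int and A :: "nat \<Rightarrow> nat \<Rightarrow> int" and W :: "nat \<Rightarrow> int" and S :: "nat set"
  assumes D: "D > 0" and W: "\<And>i. i < n \<Longrightarrow> 0 \<le> W i"
    and A: "\<And>q i. q < R \<Longrightarrow> i < n \<Longrightarrow> 0 \<le> A q i"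
    and A_le: "\<And>q i. q < R \<Longrightarrow> i < n \<Longrightarrow> 0 < W i \<Longrightarrow> A q i \<le> int n"
    and unit: "\<And>i. i < n \<Longrightarrow> \<exists>q<R. A q i = int n"
    and S: "S \<subseteq> {..<n}" "\<And>q. q < R \<Longrightarrow> (\<Sum>i\<in>S. A q i) \<le> int n" and opt: "0 < (\<Sum>i\<in>S. W i)"
begin

abbreviation "X t \<equiv> fst (mw n R D A W t)"
abbreviation "Y t \<equiv> snd (mw n R D A W t)"
abbreviation "bst t \<equiv> argmin_upto (mw_cost R A (Y t)) W n"
abbreviation "opt_val \<equiv> (\<Sum>i\<in>S. W i)"

lemma n_pos: "0 < n"
  using opt S(1) by (cases n) auto

lemma R_pos: "0 < R"
  using unit[OF n_pos] by auto

lemma bst_less: "bst t < n"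
  by (rule argmin_upto_less[OF n_pos])

lemma Y_pos: "q < R \<Longrightarrow> 0 < Y t q"
proof (induction t)
  case (Suc t)
  have "0 < D * int n + A q (bst t)"
    using D n_pos A[OF Suc.prems bst_less[of t]] by (simp add: add_pos_nonneg)
  thus ?case using Suc by (simp add: Let_def)
qed simp

lemma cost_pos: "i < n \<Longrightarrow> 0 < mw_cost R A (Y t) i"
proof -
  assume i: "i < n"
  obtain q where q: "q < R" "A q i = int n" using unit[OF i] by blast
  show ?thesis unfolding mw_cost_def
    using q i A Y_pos[of _ t] n_pos by (intro sum_pos2[of _ q]) (auto simp: less_imp_le)
qed

text \<open>Averaging: the chosen item has at most the cost per weight of each item of
  \<open>S\<close>, and the items of \<open>S\<close> together use at most \<open>n\<close> of every
  row.\<close>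

lemma bst_cost: "mw_cost R A (Y t) (bst t) * opt_val \<le> W (bst t) * (int n * (\<Sum>q<R. Y t q))"
proof -
  have "mw_cost R A (Y t) (bst t) * opt_val = (\<Sum>i\<in>S. mw_cost R A (Y t) (bst t) * W i)"
    by (simp add: sum_distrib_left)
  also have "\<dots> \<le> (\<Sum>i\<in>S. mw_cost R A (Y t) i * W (bst t))"
    using S(1) cost_pos W by (intro sum_mono argmin_upto_minimal) auto
  also have "\<dots> = W (bst t) * (\<Sum>q<R. Y t q * (\<Sum>i\<in>S. A q i))"
    unfolding mw_cost_def sum_distrib_left sum_distrib_right
    by (subst sum.swap) (simp add: ac_simps)
  also have "\<dots> \<le> W (bst t) * (\<Sum>q<R. Y t q * int n)"
    using W[OF bst_less[of t]] S(2) Y_pos[of _ t]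
    by (intro mult_left_mono sum_mono) (auto simp: less_imp_le)
  finally show ?thesis by (simp add: sum_distrib_left ac_simps)
qed

text \<open>The cost is positive, whereas the bound of \<open>bst_cost\<close> vanishes with the
  weight. This makes \<open>A_le\<close> applicable to every chosen item.\<close>

lemma W_bst_pos: "0 < W (bst t)"
proof -
  have "0 < mw_cost R A (Y t) (bst t) * opt_val"
    using cost_pos[OF bst_less] opt by simp
  also note bst_cost
  finally show ?thesis using W[OF bst_less[of t]] by (cases "W (bst t) = 0") auto
qed

lemma sum_weight_Suc:
  "(\<Sum>i<n. f i * real_of_int (X (Suc t) i)) = (\<Sum>i<n. f i * real_of_int (X t i)) + f (bst t)"
proof -
  have "(\<Sum>i<n. f i * real_of_int (X (Suc t) i)) =
      (\<Sum>i<n. f i * real_of_int (X t i) + (if i = bst t then f i else 0))"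
    by (intro sum.cong) (auto simp: Let_def algebra_simps)
  also have "\<dots> = (\<Sum>i<n. f i * real_of_int (X t i)) + f (bst t)"
    using bst_less[of t] by (simp add: sum.distrib sum.delta)
  finally show ?thesis .
qed

lemma sum_X: "(\<Sum>i<n. real_of_int (X t i)) = real t"
proof (induction t)
  case (Suc t)
  thus ?case using sum_weight_Suc[of "\<lambda>_. 1" t] by simp
qed simp

lemma X_nonneg: "0 \<le> X t i"
  by (induction t) (auto simp: Let_def)

text \<open>By \<open>bst_cost\<close>, a round multiplies the sum of the row weights by at most D n
  (1 + w / (D opt)), with w the weight of the chosen item; then 1 + y is bounded by exp y.\<close>

lemma potential_le:
  "(\<Sum>q<R. real_of_int (Y t q)) \<le>
     real R * (real_of_int D * real n) ^ t * exp ((\<Sum>i<n. W i * real_of_int (X t i)) / (D * opt_val))"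
proof (induction t)
  case (Suc t)
  let ?Z = "\<Sum>q<R. real_of_int (Y t q)"
  let ?w = "real_of_int (W (bst t)) / (real_of_int D * real_of_int opt_val)"
  have Dn: "0 < real_of_int D * real n" using D n_pos by simp
  have e1: "(\<Sum>q<R. real_of_int (Y (Suc t) q)) =
      real_of_int D * real n * ?Z + real_of_int (mw_cost R A (Y t) (bst t))"
    by (simp add: Let_def mw_cost_def algebra_simps sum.distrib sum_distrib_left)
  have e2: "real_of_int (mw_cost R A (Y t) (bst t)) \<le> W (bst t) * (real n * ?Z) / opt_val"
  proof -
    have "real_of_int (mw_cost R A (Y t) (bst t)) * real_of_int opt_val
        \<le> real_of_int (W (bst t)) * (real n * ?Z)"
      using bst_cost[of t, THEN of_int_le_iff[where 'a = real, THEN iffD2]] by simp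
    moreover have "0 < real_of_int opt_val" using opt by (simp only: of_int_0_less_iff)
    ultimately show ?thesis by (simp add: pos_le_divide_eq del: of_int_sum)
  qed
  have e3: "real_of_int D * real n * ?Z + W (bst t) * (real n * ?Z) / opt_val
      = real_of_int D * real n * ?Z * (1 + ?w)"
  proof -
    have "d * k * z + w * (k * z) / v = d * k * z * (1 + w / (d * v))" if "0 < d" "0 < v" for d k z w v :: real
      using that by (simp add: field_simps)
    thus ?thesis using D opt by (simp only: of_int_0_less_iff)
  qed
  have "(\<Sum>q<R. real_of_int (Y (Suc t) q)) \<le> real_of_int D * real n * ?Z * (1 + ?w)"
    using add_left_mono[OF e2] unfolding e1 e3[symmetric] .
  also have "\<dots> \<le> real_of_int D * real n * ?Z * exp ?w"
    using D Dn Y_pos[of _ t]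
    by (intro mult_left_mono exp_ge_add_one_self mult_nonneg_nonneg sum_nonneg) (auto simp: less_imp_le)
  also have "\<dots> \<le> real_of_int D * real n * (real R * (real_of_int D * real n) ^ t *
      exp ((\<Sum>i<n. W i * real_of_int (X t i)) / (D * opt_val))) * exp ?w"
    using D Dn by (intro mult_right_mono mult_left_mono Suc) auto
  also have "\<dots> = real R * (real_of_int D * real n) ^ Suc t *
      exp ((\<Sum>i<n. W i * real_of_int (X t i)) / (D * opt_val) + ?w)"
    by (simp add: exp_add)
  also have "(\<Sum>i<n. W i * real_of_int (X t i)) / (D * opt_val) + ?w
      = (\<Sum>i<n. W i * real_of_int (X (Suc t) i)) / (D * opt_val)"
    unfolding sum_weight_Suc by (simp add: add_divide_distrib)
  finally show ?case by simp
qed simp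

text \<open>A round multiplies the row weight by D n (1 + a / D), where a in [0, 1] is the share of
  the row used by the chosen item. Replacing 1 + a / D by the power (1 + 1 / D)^a makes the
  exponents add up to the total usage.\<close>

lemma Y_ge:
  assumes q: "q < R"
  shows "(real_of_int D * real n) ^ t * (1 + 1 / D) powr ((\<Sum>i<n. A q i * real_of_int (X t i)) / n)
     \<le> real_of_int (Y t q)"
proof (induction t)
  case (Suc t)
  have Dn: "0 < real_of_int D * real n" using D n_pos by simp
  let ?a = "real_of_int (A q (bst t)) / real n"
  have "(real_of_int D * real n) ^ Suc t * (1 + 1 / D) powr ((\<Sum>i<n. A q i * real_of_int (X (Suc t) i)) / n)
     = (real_of_int D * real n) ^ t * (1 + 1 / D) powr ((\<Sum>i<n. A q i * real_of_int (X t i)) / n)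
       * (real_of_int D * real n * (1 + 1 / D) powr ?a)"
    unfolding sum_weight_Suc by (simp add: add_divide_distrib powr_add)
  also have "\<dots> \<le> real_of_int (Y t q) * (real_of_int D * real n * (1 + 1 / D * ?a))"
    using D Dn Y_pos[OF q, of t] A[OF q bst_less[of t]] A_le[OF q bst_less[of t] W_bst_pos] n_pos
    by (intro mult_mono Suc powr_le_one_plus_mult mult_left_mono) auto
  also have "\<dots> = real_of_int (Y (Suc t) q)"
    using D n_pos by (simp add: Let_def field_simps)
  finally show ?case .
qed (use D n_pos in simp)

text \<open>Comparing \<open>Y_ge\<close> for the fullest row with \<open>potential_le\<close> and
  taking logarithms gives (L / n) ln (1 + 1 / D) <= ln R + W X / (D opt). The estimates ln (1 + 1 /
  D) >= 1 / D - 1 / D^2 and ln R <= (L / n) / D^2 each lose a relative 1 / D, which explains the 2 /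
  D.\<close>

lemma mw_approx:
  assumes T: "int T = int n * int R * D * D"
    and L: "\<And>q. q < R \<Longrightarrow> (\<Sum>i<n. A q i * X T i) \<le> L" "q0 < R" "(\<Sum>i<n. A q0 i * X T i) = L"
  shows "(1 - 2 / D) * opt_val * L \<le> n * (\<Sum>i<n. W i * X T i)"
    and "0 < L" and "\<And>i. i < n \<Longrightarrow> n * X T i \<le> L"
proof -
  show nX: "int n * X T i \<le> L" if i: "i < n" for i
  proof -
    obtain q where q: "q < R" "A q i = int n" using unit[OF i] by blast
    have "A q i * X T i \<le> (\<Sum>i<n. A q i * X T i)"
      using i q A X_nonneg by (intro member_le_sum) auto
    also have "\<dots> \<le> L" by (rule L(1)[OF q(1)])
    finally show ?thesis using q by simp
  qed
  let ?WX = "\<Sum>i<n. W i * real_of_int (X T i)" and ?L = "real_of_int L / real n"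
  have nr: "0 < real n" "0 < real R" "0 < real_of_int D" using n_pos R_pos D by auto
  have opt': "0 < real_of_int opt_val" using opt by (simp only: of_int_0_less_iff)
  \<comment> \<open>The \<open>T\<close> increments are spread over \<open>n\<close> items with
    \<open>n * X T i\<close> at most \<open>L\<close>, so \<open>T\<close> is at most
    \<open>L\<close>. The prescribed \<open>T\<close> thus makes L / n at least R D^2, enough to
    absorb ln R.\<close>
  have "real T = (\<Sum>i<n. real_of_int (X T i))" by (simp add: sum_X)
  also have "\<dots> \<le> (\<Sum>i<n. ?L)"
  proof (intro sum_mono)
    fix i assume "i \<in> {..<n}"
    hence "real_of_int (int n * X T i) \<le> real_of_int L" using nX by (simp only: of_int_le_iff) simp
    thus "real_of_int (X T i) \<le> ?L" using nr by (simp add: field_simps)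
  qed
  also have "\<dots> = real_of_int L" using nr by simp
  finally have TL: "real T \<le> real_of_int L" .
  have "real_of_int (int T) = real n * real R * D * D" unfolding T by simp
  hence T': "real T = real n * (real R * D * D)" by simp
  with TL have Lge: "real R * D * D \<le> ?L" using nr by (simp add: field_simps)
  have "0 < real R * D * D" using nr by simp
  hence L0: "0 < ?L" using Lge by linarith
  thus "0 < L" using nr by (simp add: zero_less_divide_iff)
  let ?E = "(real_of_int D * real n) ^ T"
  have E: "0 < ?E" using nr by simp
  have q0: "(\<Sum>i<n. A q0 i * real_of_int (X T i)) = L" unfolding L(3)[symmetric] by simp
  have "?E * (1 + 1 / D) powr ?L \<le> real_of_int (Y T q0)" using Y_ge[OF L(2), of T] by (simp add: q0)
  also have "\<dots> \<le> (\<Sum>q<R. real_of_int (Y T q))"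
    using L(2) Y_pos by (intro member_le_sum) (auto simp: less_imp_le)
  also have "\<dots> \<le> ?E * (real R * exp (?WX / (D * opt_val)))"
    using potential_le[of T] by (simp add: ac_simps)
  finally have "(1 + 1 / D) powr ?L \<le> real R * exp (?WX / (D * opt_val))" using E by simp
  moreover have p1: "1 + 1 / real_of_int D \<noteq> 0" using nr by (simp add: add_pos_pos less_imp_neq[symmetric])
  ultimately have "ln ((1 + 1 / D) powr ?L) \<le> ln (real R * exp (?WX / (D * opt_val)))"
    using nr by (subst ln_le_cancel_iff) auto
  hence ln: "?L * ln (1 + 1 / D) \<le> ln (real R) + ?WX / (D * opt_val)"
    using nr p1 by (simp add: ln_powr ln_mult)
  have D1: "1 / real_of_int D - (1 / real_of_int D)\<^sup>2 \<le> ln (1 + 1 / D)"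
    using D by (intro ln_one_plus_pos_lower_bound) auto
  have "ln (real R) \<le> real R" using nr ln_le_minus_one[of "real R"] by simp
  also have "real R \<le> ?L / (D * D)" using Lge nr by (simp add: field_simps)
  finally have lnR: "ln (real R) \<le> ?L / (D * D)" .
  have "?L * (1 / real_of_int D - (1 / real_of_int D)\<^sup>2) \<le> ?L * ln (1 + 1 / D)"
    using D1 L0 by (intro mult_left_mono) auto
  with ln lnR have "?L * (1 / real_of_int D - (1 / real_of_int D)\<^sup>2) \<le> ?L / (D * D) + ?WX / (D * opt_val)"
    by linarith
  hence "?L * (1 / real_of_int D - (1 / real_of_int D)\<^sup>2) * D \<le> (?L / (D * D) + ?WX / (D * opt_val)) * D"
    using nr by (intro mult_right_mono) auto
  also have "?L * (1 / real_of_int D - (1 / real_of_int D)\<^sup>2) * D = ?L * (1 - 1 / D)"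
    using nr by (simp add: field_simps power2_eq_square)
  also have "(?L / (D * D) + ?WX / (D * opt_val)) * D = ?L / D + ?WX / opt_val"
    using nr opt' by (simp add: field_simps)
  finally have "?L * (1 - 2 / D) \<le> ?WX / opt_val" by (simp add: algebra_simps)
  hence "?L * (1 - 2 / D) * opt_val \<le> ?WX" using opt' by (simp add: pos_le_divide_eq del: of_int_sum)
  hence "real n * (?L * (1 - 2 / D) * opt_val) \<le> real n * ?WX" using nr by (intro mult_left_mono) auto
  moreover have "real n * (?L * (1 - 2 / D) * opt_val) = (1 - 2 / D) * opt_val * L" using nr by simp
  ultimately show "(1 - 2 / D) * opt_val * L \<le> n * (\<Sum>i<n. W i * X T i)" by simp
qed

end

subsection \<open>Randomized rounding with alteration\<close>

lemma sum_lessThan_mult: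
  fixes f :: "nat \<Rightarrow> real"
  assumes "0 < b"
  shows "(\<Sum>x<a * b. f x) = (\<Sum>u<a. \<Sum>v<b. f (v + b * u))"
proof (induction a)
  case (Suc a)
  have "(\<Sum>x<Suc a * b. f x) = (\<Sum>x<a * b. f x) + (\<Sum>x\<in>{a * b..<a * b + b}. f x)"
    by (subst sum.union_disjoint[symmetric]) (auto intro!: sum.cong)
  also have "(\<Sum>x\<in>{a * b..<a * b + b}. f x) = (\<Sum>v<b. f (v + b * a))"
    by (rule sum.reindex_bij_witness[of _ "\<lambda>v. v + b * a" "\<lambda>x. x - b * a"]) (auto simp: ac_simps)
  finally show ?case using Suc by simp
qed simp

text \<open>The base-\<open>Q\<close> digits of the numbers below \<open>Q ^ n\<close> run through
  all tuples exactly once. In probabilistic terms, the digits of one uniform number are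
  independent.\<close>

lemma sum_prod_digits:
  fixes g :: "nat \<Rightarrow> nat \<Rightarrow> real"
  assumes Q: "0 < Q"
  shows "(\<Sum>V<Q ^ n. \<Prod>i<n. g i (V div Q ^ i mod Q)) = (\<Prod>i<n. \<Sum>d<Q. g i d)"
proof (induction n)
  case (Suc n)
  have digit: "(v + Q ^ n * u) div Q ^ i mod Q = v div Q ^ i mod Q" if "i < n" for u v i
  proof -
    have "Q ^ n = Q ^ i * (Q * Q ^ (n - Suc i))"
      using that by (metis Suc_diff_Suc diff_Suc_Suc le_add_diff_inverse less_imp_le_nat power_Suc power_add)
    hence "(v + Q ^ n * u) div Q ^ i = v div Q ^ i + Q * (Q ^ (n - Suc i) * u)"
      using Q by (simp add: mult.assoc)
    thus ?thesis by simp
  qed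
  have top: "(v + Q ^ n * u) div Q ^ n mod Q = u" if "u < Q" "v < Q ^ n" for u v
    using that Q by simp
  have "(\<Sum>V<Q ^ Suc n. \<Prod>i<Suc n. g i (V div Q ^ i mod Q))
      = (\<Sum>u<Q. \<Sum>v<Q ^ n. \<Prod>i<Suc n. g i ((v + Q ^ n * u) div Q ^ i mod Q))"
    unfolding power_Suc by (rule sum_lessThan_mult) (use Q in simp)
  also have "\<dots> = (\<Sum>u<Q. \<Sum>v<Q ^ n. (\<Prod>i<n. g i (v div Q ^ i mod Q)) * g n u)"
    by (intro sum.cong) (auto simp: digit top)
  also have "\<dots> = (\<Prod>i<n. \<Sum>d<Q. g i d) * (\<Sum>u<Q. g n u)"
    unfolding Suc[symmetric] sum_product by (subst sum.swap) simp
  finally show ?case by simp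
qed simp

text \<open>All factors lie in [0, 1], so an index occurring in several sets only lowers the left
  side. Rivals shared between rows therefore do no harm.\<close>

lemma prod_UN_ge:
  fixes f :: "'a \<Rightarrow> real"
  assumes "finite J" "\<And>j. j \<in> J \<Longrightarrow> finite (B j)"
    and "\<And>j i. j \<in> J \<Longrightarrow> i \<in> B j \<Longrightarrow> 0 \<le> f i \<and> f i \<le> 1"
  shows "(\<Prod>j\<in>J. \<Prod>i\<in>B j. f i) \<le> (\<Prod>i\<in>(\<Union>j\<in>J. B j). f i)"
  using assms
proof (induction J rule: finite_induct)
  case (insert j J)
  let ?U = "\<Union>j\<in>J. B j"
  have fin: "finite (B j)" "finite ?U" using insert by auto
  have U01: "0 \<le> f i \<and> f i \<le> 1" if "i \<in> ?U \<union> B j" for i using insert.prems that by blast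
  have "(\<Prod>i\<in>?U. f i) = (\<Prod>i\<in>?U - B j. f i) * (\<Prod>i\<in>?U \<inter> B j. f i)"
    using fin by (subst prod.union_disjoint[symmetric]) (auto intro!: prod.cong)
  also have "\<dots> \<le> (\<Prod>i\<in>?U - B j. f i) * 1"
    using U01 by (intro mult_left_mono prod_le_1 prod_nonneg) auto
  finally have *: "(\<Prod>i\<in>?U. f i) \<le> (\<Prod>i\<in>?U - B j. f i)" by simp
  have "(\<Prod>j\<in>insert j J. \<Prod>i\<in>B j. f i) = (\<Prod>i\<in>B j. f i) * (\<Prod>j\<in>J. \<Prod>i\<in>B j. f i)"
    using insert by simp
  also have "\<dots> \<le> (\<Prod>i\<in>B j. f i) * (\<Prod>i\<in>?U - B j. f i)"
    using insert * U01 by (intro mult_left_mono order.trans[OF _ *] insert.IH prod_nonneg) auto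
  also have "\<dots> = (\<Prod>i\<in>(\<Union>j\<in>insert j J. B j). f i)"
    using fin by (subst prod.union_disjoint[symmetric]) (auto intro!: prod.cong)
  finally show ?case .
qed simp

text \<open>A single uniform number below \<open>Q ^ n\<close> supplies all samples: its digit
  \<open>i\<close> decides item \<open>i\<close> through \<open>P i\<close>.\<close>

locale rounding =
  fixes n m Q :: nat and s :: "nat \<Rightarrow> nat \<Rightarrow> int" and c :: "nat \<Rightarrow> int" and P :: "nat \<Rightarrow> nat \<Rightarrow> bool"
  assumes Q: "0 < Q" and s: "\<And>j i. j < m \<Longrightarrow> i < n \<Longrightarrow> 0 \<le> s j i"
begin

definition sel :: "nat \<Rightarrow> nat \<Rightarrow> bool" where
  "sel V i \<longleftrightarrow> P i (V div Q ^ i mod Q)"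

definition prb :: "nat \<Rightarrow> real" where
  "prb i = card {d. d < Q \<and> P i d} / Q"

text \<open>Rows with \<open>s j i = 0\<close> are skipped: there the sum would run over all sampled
  items, and the item could be lost to a row other than the at most k rows that contain it.\<close>

definition kept :: "nat \<Rightarrow> nat \<Rightarrow> bool" where
  "kept V i \<longleftrightarrow> sel V i \<and>
     (\<forall>j<m. s j i = 0 \<or> (\<Sum>i'<n. if sel V i' \<and> s j i \<le> s j i' then s j i' else 0) \<le> c j)"

definition mean :: "(nat \<Rightarrow> real) \<Rightarrow> real" where
  "mean f = (\<Sum>V<Q ^ n. f V) / Q ^ n"

lemma mean_mono: "(\<And>V. f V \<le> g V) \<Longrightarrow> mean f \<le> mean g"
  unfolding mean_def by (intro divide_right_mono sum_mono) auto

lemma mean_diff: "mean (\<lambda>V. f V - g V) = mean f - mean g"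
  by (simp add: mean_def sum_subtractf diff_divide_distrib)

lemma mean_sum: "mean (\<lambda>V. \<Sum>x\<in>A. f x V) = (\<Sum>x\<in>A. mean (f x))"
  unfolding mean_def by (subst sum.swap) (simp add: sum_divide_distrib)

lemma mean_cmult: "mean (\<lambda>V. a * f V) = a * mean f"
  by (simp add: mean_def sum_distrib_left)

lemma prb_01: "0 \<le> prb i" "prb i \<le> 1"
proof -
  have "card {d. d < Q \<and> P i d} \<le> card {..<Q}" by (intro card_mono) auto
  thus "0 \<le> prb i" "prb i \<le> 1" using Q by (auto simp: prb_def)
qed

text \<open>The indicator factors over the digits, with factor 1 for items outside \<open>A\<close>
  and \<open>B\<close>, so \<open>sum_prod_digits\<close> computes its mean.\<close>

lemma mean_sel:
  assumes "A \<subseteq> {..<n}" "B \<subseteq> {..<n}" "A \<inter> B = {}"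
  shows "mean (\<lambda>V. (\<Prod>i\<in>A. of_bool (sel V i)) * (\<Prod>i\<in>B. of_bool (\<not> sel V i)))
    = (\<Prod>i\<in>A. prb i) * (\<Prod>i\<in>B. 1 - prb i)"
proof -
  have fin: "finite A" "finite B" using assms finite_subset by blast+
  define g :: "nat \<Rightarrow> nat \<Rightarrow> real" where
    "g i d = (if i \<in> A then of_bool (P i d) else if i \<in> B then of_bool (\<not> P i d) else 1)" for i d
  have split: "(\<Prod>i<n. h i) = (\<Prod>i\<in>A. h i) * (\<Prod>i\<in>B. h i)"
    if "\<And>i. i \<notin> A \<Longrightarrow> i \<notin> B \<Longrightarrow> h i = 1" for h :: "nat \<Rightarrow> real"
  proof -
    have "(\<Prod>i<n. h i) = (\<Prod>i\<in>A \<union> B. h i)"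
      using assms that by (intro prod.mono_neutral_right) auto
    thus ?thesis using assms fin by (simp add: prod.union_disjoint)
  qed
  have card: "(\<Sum>d<Q. of_bool (P i d)) = real (card {d. d < Q \<and> P i d})" for i
  proof -
    have "{..<Q} \<inter> {d. P i d} = {d. d < Q \<and> P i d}" by auto
    thus ?thesis by (simp add: of_bool_def sum.If_cases)
  qed
  have card': "(\<Sum>d<Q. of_bool (\<not> P i d)) = real Q - real (card {d. d < Q \<and> P i d})" for i
  proof -
    have "(\<Sum>d<Q. of_bool (\<not> P i d) :: real) = (\<Sum>d<Q. 1 - of_bool (P i d))" by (intro sum.cong) auto
    thus ?thesis by (simp add: sum_subtractf card)
  qed
  have "(\<Prod>i\<in>A. of_bool (sel V i)) * (\<Prod>i\<in>B. of_bool (\<not> sel V i)) = (\<Prod>i<n. g i (V div Q ^ i mod Q))" for V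
    using assms by (subst split) (auto simp: g_def sel_def intro!: arg_cong2[of _ _ _ _ "(*)"] prod.cong)
  hence "mean (\<lambda>V. (\<Prod>i\<in>A. of_bool (sel V i)) * (\<Prod>i\<in>B. of_bool (\<not> sel V i)))
      = (\<Prod>i<n. \<Sum>d<Q. g i d) / Q ^ n"
    by (simp add: mean_def sum_prod_digits[OF Q])
  also have "\<dots> = (\<Prod>i<n. (\<Sum>d<Q. g i d) / Q)"
    by (simp add: prod_dividef)
  also have "\<dots> = (\<Prod>i\<in>A. prb i) * (\<Prod>i\<in>B. 1 - prb i)"
  proof (subst split)
    have "(\<Sum>d<Q. g i d) / Q = prb i" if "i \<in> A" for i using that by (simp add: g_def prb_def card)
    moreover have "(\<Sum>d<Q. g i d) / Q = 1 - prb i" if "i \<in> B" for i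
    proof -
      have "i \<notin> A" using that assms by blast
      thus ?thesis using that Q by (simp add: g_def prb_def card' diff_divide_distrib)
    qed
    ultimately show "(\<Prod>i\<in>A. (\<Sum>d<Q. g i d) / Q) * (\<Prod>i\<in>B. (\<Sum>d<Q. g i d) / Q)
        = (\<Prod>i\<in>A. prb i) * (\<Prod>i\<in>B. 1 - prb i)" by simp
  qed (use Q in \<open>simp add: g_def\<close>)
  finally show ?thesis .
qed

definition rows_of :: "nat \<Rightarrow> nat set" where
  "rows_of i = {j. j < m \<and> 0 < s j i}"

definition big :: "nat \<Rightarrow> nat set" where
  "big j = {i. i < n \<and> c j < 2 * s j i}"

definition small :: "nat \<Rightarrow> nat set" where
  "small j = {i. i < n \<and> 2 * s j i \<le> c j}"

definition rivals :: "nat \<Rightarrow> nat set" where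
  "rivals i = (\<Union>j\<in>rows_of i. big j - {i})"

definition pairs :: "nat \<Rightarrow> nat \<Rightarrow> (nat \<times> nat) set" where
  "pairs j i = {(x, y). x \<in> small j - {i} \<and> y \<in> small j - {i} \<and> x \<noteq> y}"

lemma finite_sets [simp]: "finite (rows_of i)" "finite (big j)" "finite (small j)" "finite (rivals i)" "finite (pairs j i)"
proof -
  show 1: "finite (rows_of i)" "finite (big j)" "finite (small j)" for i j
    by (simp_all add: rows_of_def big_def small_def)
  show "finite (rivals i)" using 1 by (simp add: rivals_def)
  have "pairs j i \<subseteq> small j \<times> small j" by (auto simp: pairs_def)
  thus "finite (pairs j i)" using 1 finite_subset by blast
qed

text \<open>Call the other sampled items that are at least as large as \<open>i\<close> competitors.
  Removing any one of them leaves competitors of total size at least c / 4. Summing this over the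
  removed x with weight \<open>s j x\<close>, where all weights add up to at least c / 2, bounds the
  sum over ordered pairs below by c^2 / 8.\<close>

lemma overload_pairs:
  assumes i: "i < n" and j: "j \<in> rows_of i" and fit: "s j i \<le> c j" and "sel V i"
    and over: "c j < (\<Sum>i'<n. if sel V i' \<and> s j i \<le> s j i' then s j i' else 0)"
    and no_rival: "\<And>i'. i' \<in> rivals i \<Longrightarrow> \<not> sel V i'"
  shows "real_of_int (c j) ^ 2 \<le>
    8 * (\<Sum>(x, y)\<in>pairs j i. s j x * s j y * of_bool (sel V x \<and> sel V y))"
proof -
  have jm: "j < m" "0 < s j i" using j by (auto simp: rows_of_def)
  define T where "T = {i'. i' < n \<and> i' \<noteq> i \<and> sel V i' \<and> s j i \<le> s j i'}"
  define \<sigma> where "\<sigma> = (\<Sum>x\<in>T. s j x)"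
  have finT: "finite T" by (simp add: T_def)
  have "(\<Sum>i'<n. if sel V i' \<and> s j i \<le> s j i' then s j i' else 0)
      = (\<Sum>i'\<in>insert i T. s j i')"
    using i \<open>sel V i\<close> by (intro sum.mono_neutral_cong_right) (auto simp: T_def)
  also have "\<dots> = s j i + \<sigma>" using finT by (simp add: \<sigma>_def T_def)
  finally have \<sigma>: "c j < s j i + \<sigma>" using over by simp
  have small: "2 * s j x \<le> c j" if "x \<in> T" for x
  proof (rule ccontr)
    assume "\<not> 2 * s j x \<le> c j"
    hence "x \<in> rivals i" using that j by (auto simp: rivals_def big_def T_def intro!: bexI[of _ j])
    thus False using no_rival that by (auto simp: T_def)
  qed
  \<comment> \<open>If \<open>i\<close> were big, every competitor would be a big item and thus a
    sampled rival. So there would be none, and \<open>i\<close> alone fits.\<close>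
  have i_small: "2 * s j i \<le> c j"
  proof (rule ccontr)
    assume "\<not> 2 * s j i \<le> c j"
    hence "T = {}" using small by (force simp: T_def)
    thus False using \<sigma> fit by (simp add: \<sigma>_def)
  qed
  \<comment> \<open>If \<open>s j i\<close> is at most c / 4, the competitors exceed 3 c / 4 and x
    takes at most c / 2. Otherwise \<open>i\<close> and x, both at most c / 2, cannot overflow
    alone; a further competitor exists and is at least as large as \<open>i\<close>, hence above c /
    4.\<close>
  have rest: "c j \<le> 4 * (\<sigma> - s j x)" if x: "x \<in> T" for x
  proof (cases "4 * s j i \<le> c j")
    case True
    have "c' \<le> 4 * (g - a)" if "4 * b \<le> c'" "2 * a \<le> c'" "c' < b + g" for a b c' g :: int
      using that by presburger
    thus ?thesis using True small[OF x] \<sigma> by blast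
  next
    case False
    have \<sigma>x: "\<sigma> = s j x + (\<Sum>y\<in>T - {x}. s j y)"
      unfolding \<sigma>_def using finT x by (rule sum.remove)
    have "T - {x} \<noteq> {}"
    proof
      assume e: "T - {x} = {}"
      have "\<sigma> = s j x" using \<sigma>x unfolding e by simp
      thus False using small[OF x] i_small \<sigma> by linarith
    qed
    then obtain y where y: "y \<in> T - {x}" by blast
    have "s j y \<le> (\<Sum>y\<in>T - {x}. s j y)"
      using finT y s jm by (intro member_le_sum) (auto simp: T_def)
    moreover have "s j i \<le> s j y" using y by (simp add: T_def)
    moreover have "c' \<le> 4 * (g - a)" if "b \<le> h" "d \<le> b" "g = a + h" "\<not> 4 * d \<le> c'" for a b c' d g h :: int
      using that by presburger
    ultimately show ?thesis using \<sigma>x False by blast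
  qed
  have "c j * c j \<le> 2 * \<sigma> * c j"
    using \<sigma> i_small jm by (intro mult_right_mono) linarith+
  also have "\<dots> = (\<Sum>x\<in>T. 2 * s j x * c j)" by (simp add: \<sigma>_def sum_distrib_left sum_distrib_right)
  also have "\<dots> \<le> (\<Sum>x\<in>T. 2 * s j x * (4 * (\<sigma> - s j x)))"
    using rest s jm by (intro sum_mono mult_left_mono) (auto simp: T_def)
  also have "\<dots> = 8 * (\<Sum>x\<in>T. \<Sum>y\<in>T - {x}. s j x * s j y)"
    unfolding sum_distrib_left
  proof (intro sum.cong refl)
    fix x assume x: "x \<in> T"
    have "\<sigma> - s j x = (\<Sum>y\<in>T - {x}. s j y)"
      unfolding \<sigma>_def using sum.remove[OF finT x, of "s j"] by simp
    thus "2 * s j x * (4 * (\<sigma> - s j x)) = (\<Sum>y\<in>T - {x}. 8 * (s j x * s j y))"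
      by (simp add: sum_distrib_left)
  qed
  also have "(\<Sum>x\<in>T. \<Sum>y\<in>T - {x}. s j x * s j y) = (\<Sum>(x, y)\<in>(SIGMA x:T. T - {x}). s j x * s j y)"
    using finT by (subst sum.Sigma) auto
  also have "\<dots> = (\<Sum>(x, y)\<in>(SIGMA x:T. T - {x}). s j x * s j y * of_bool (sel V x \<and> sel V y))"
    by (intro sum.cong) (auto simp: T_def)
  also have "\<dots> \<le> (\<Sum>(x, y)\<in>pairs j i. s j x * s j y * of_bool (sel V x \<and> sel V y))"
  proof (rule sum_mono2)
    show "(SIGMA x:T. T - {x}) \<subseteq> pairs j i"
      using small by (auto simp: pairs_def small_def T_def)
    show "finite (pairs j i)" by simp
  qed (use s jm in \<open>auto simp: pairs_def small_def\<close>)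
  finally have "c j * c j \<le> 8 * (\<Sum>(x, y)\<in>pairs j i. s j x * s j y * of_bool (sel V x \<and> sel V y))" by simp
  hence "real_of_int (c j * c j) \<le> real_of_int (8 * (\<Sum>(x, y)\<in>pairs j i. s j x * s j y * of_bool (sel V x \<and> sel V y)))"
    by (simp only: of_int_le_iff)
  thus ?thesis by (simp add: power2_eq_square case_prod_unfold)
qed

text \<open>A pointwise union bound: the subtracted sum is nonnegative, and it reaches 1 whenever a
  sampled item without sampled rivals is dropped. Both parts are built from products of sampling
  indicators, whose means are explicit.\<close>

lemma kept_ge:
  assumes i: "i < n" and fit: "\<And>j. j < m \<Longrightarrow> s j i \<le> c j"
  shows "(of_bool (sel V i) * (\<Prod>x\<in>rivals i. of_bool (\<not> sel V x))) -
     (\<Sum>j\<in>rows_of i. \<Sum>(x, y)\<in>pairs j i. 8 / (c j)\<^sup>2 * s j x * s j y *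
         of_bool (sel V i \<and> sel V x \<and> sel V y)) \<le> (of_bool (kept V i) :: real)"
    (is "?a - ?b \<le> _")
proof -
  have term0: "0 \<le> 8 / (c j)\<^sup>2 * s j x * s j y * (of_bool b :: real)"
    if "j \<in> rows_of i" "(x, y) \<in> pairs j i" for j x y b
    using that s by (auto simp: rows_of_def pairs_def small_def)
  have b0: "0 \<le> ?b" using term0 by (intro sum_nonneg) auto
  have a1: "?a \<le> 1" by (auto intro!: mult_le_one prod_le_1 prod_nonneg)
  show ?thesis
  proof (cases "kept V i")
    case True
    thus ?thesis using a1 b0 by simp
  next
    case nk: False
    show ?thesis
    proof (cases "sel V i \<and> (\<forall>x\<in>rivals i. \<not> sel V x)")
      case False
      hence "?a = 0" by (auto simp: prod_zero_iff)
      moreover have "of_bool (kept V i) = (0 :: real)" using nk by simp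
      ultimately show ?thesis using b0 by linarith
    next
      case True
      then obtain j where j: "j < m" "s j i \<noteq> 0"
        "c j < (\<Sum>i'<n. if sel V i' \<and> s j i \<le> s j i' then s j i' else 0)"
        using nk by (auto simp: kept_def not_le)
      hence jr: "j \<in> rows_of i" using s[OF j(1) i] by (simp add: rows_of_def)
      hence c: "0 < c j" using fit[of j] by (auto simp: rows_of_def)
      have "real_of_int (c j) ^ 2 \<le> 8 * (\<Sum>(x, y)\<in>pairs j i. s j x * s j y * of_bool (sel V x \<and> sel V y))"
        using True jr j fit by (intro overload_pairs i) auto
      hence "1 \<le> 8 / (c j)\<^sup>2 * (\<Sum>(x, y)\<in>pairs j i. s j x * s j y * of_bool (sel V x \<and> sel V y))"
        using c by (simp add: field_simps)
      also have "\<dots> = (\<Sum>(x, y)\<in>pairs j i. 8 / (c j)\<^sup>2 * s j x * s j y * of_bool (sel V i \<and> sel V x \<and> sel V y))"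
        using True by (simp add: sum_distrib_left case_prod_unfold mult.assoc)
      also have "\<dots> \<le> ?b"
        using term0 jr by (intro member_le_sum[of j "rows_of i"] sum_nonneg) auto
      finally show ?thesis using a1 by simp
    qed
  qed
qed

lemma mean_kept_ge:
  assumes i: "i < n" and fit: "\<And>j. j < m \<Longrightarrow> s j i \<le> c j"
  shows "prb i * ((\<Prod>x\<in>rivals i. 1 - prb x) -
     (\<Sum>j\<in>rows_of i. 8 / (c j)\<^sup>2 * (\<Sum>x\<in>small j. s j x * prb x)\<^sup>2)) \<le> mean (\<lambda>V. of_bool (kept V i))"
proof -
  have riv: "rivals i \<subseteq> {..<n}" "i \<notin> rivals i" by (auto simp: rivals_def big_def)
  have m1: "mean (\<lambda>V. of_bool (sel V i) * (\<Prod>x\<in>rivals i. of_bool (\<not> sel V x))) = prb i * (\<Prod>x\<in>rivals i. 1 - prb x)"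
    using mean_sel[of "{i}" "rivals i"] riv i by simp
  have m2: "mean (\<lambda>V. of_bool (sel V i \<and> sel V x \<and> sel V y)) = prb i * prb x * prb y"
    if "(x, y) \<in> pairs j i" for x y j
  proof -
    have xy: "x \<noteq> y" "x \<noteq> i" "y \<noteq> i" "x < n" "y < n" using that by (auto simp: pairs_def small_def)
    have "of_bool (sel V i \<and> sel V x \<and> sel V y) = (\<Prod>z\<in>{i, x, y}. of_bool (sel V z) :: real)" for V
      using xy by auto
    thus ?thesis using mean_sel[of "{i, x, y}" "{}"] xy i by (simp add: mult.assoc)
  qed
  \<comment> \<open>Dropping the conditions that x, y and \<open>i\<close> be distinct adds only
    nonnegative terms and completes the sum to a square.\<close>
  have pair_le: "(\<Sum>(x, y)\<in>pairs j i. s j x * s j y * (prb x * prb y)) \<le> (\<Sum>x\<in>small j. s j x * prb x)\<^sup>2"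
    if "j \<in> rows_of i" for j
  proof -
    have nn: "0 \<le> s j x * prb x" if "x \<in> small j" for x
      using that \<open>j \<in> rows_of i\<close> s prb_01 by (simp add: small_def rows_of_def)
    have "(\<Sum>(x, y)\<in>pairs j i. s j x * s j y * (prb x * prb y)) =
        (\<Sum>(x, y)\<in>pairs j i. (s j x * prb x) * (s j y * prb y))"
      by (intro sum.cong) auto
    also have "\<dots> \<le> (\<Sum>(x, y)\<in>small j \<times> small j. (s j x * prb x) * (s j y * prb y))"
      using nn by (intro sum_mono2) (auto simp: pairs_def)
    also have "\<dots> = (\<Sum>x\<in>small j. s j x * prb x)\<^sup>2"
      by (simp add: sum_product power2_eq_square sum.cartesian_product)
    finally show ?thesis .
  qed
  have m3: "mean (\<lambda>V. \<Sum>j\<in>rows_of i. \<Sum>(x, y)\<in>pairs j i. 8 / (c j)\<^sup>2 * s j x * s j y *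
         of_bool (sel V i \<and> sel V x \<and> sel V y)) =
       (\<Sum>j\<in>rows_of i. \<Sum>(x, y)\<in>pairs j i. 8 / (c j)\<^sup>2 * s j x * s j y * (prb i * prb x * prb y))"
    unfolding mean_sum case_prod_unfold mean_cmult
    by (intro sum.cong refl arg_cong2[of _ _ _ _ "(*)"]) (auto intro!: m2)
  also have "\<dots> = prb i * (\<Sum>j\<in>rows_of i. 8 / (c j)\<^sup>2 * (\<Sum>(x, y)\<in>pairs j i. s j x * s j y * (prb x * prb y)))"
    by (simp add: sum_distrib_left case_prod_unfold ac_simps)
  also have "\<dots> \<le> prb i * (\<Sum>j\<in>rows_of i. 8 / (c j)\<^sup>2 * (\<Sum>x\<in>small j. s j x * prb x)\<^sup>2)"
    using prb_01 by (intro mult_left_mono sum_mono pair_le) auto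
  finally have "mean (\<lambda>V. \<Sum>j\<in>rows_of i. \<Sum>(x, y)\<in>pairs j i. 8 / (c j)\<^sup>2 * s j x * s j y *
         of_bool (sel V i \<and> sel V x \<and> sel V y))
      \<le> prb i * (\<Sum>j\<in>rows_of i. 8 / (c j)\<^sup>2 * (\<Sum>x\<in>small j. s j x * prb x)\<^sup>2)" .
  moreover have "mean (\<lambda>V. of_bool (sel V i) * (\<Prod>x\<in>rivals i. of_bool (\<not> sel V x))) -
      mean (\<lambda>V. \<Sum>j\<in>rows_of i. \<Sum>(x, y)\<in>pairs j i. 8 / (c j)\<^sup>2 * s j x * s j y *
         of_bool (sel V i \<and> sel V x \<and> sel V y)) \<le> mean (\<lambda>V. of_bool (kept V i))"
    unfolding mean_diff[symmetric] using kept_ge[OF i fit] by (intro mean_mono) auto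
  ultimately show ?thesis unfolding m1 by (simp add: algebra_simps)
qed

text \<open>The excess 782 / D is 998 / D from the absence of rivals minus 216 / D for overflow by
  small items.\<close>

lemma mean_kept_ge_numeric:
  assumes i: "i < n" and fit: "\<And>j. j < m \<Longrightarrow> s j i \<le> c j"
    and D: "D = real k + 1000" and k: "card (rows_of i) \<le> k"
    and big_le: "\<And>j. j < m \<Longrightarrow> (\<Sum>x\<in>big j. prb x) \<le> 1 / D + 1 / D\<^sup>2"
    and small_le: "\<And>j. j < m \<Longrightarrow> 0 < c j \<Longrightarrow> (\<Sum>x\<in>small j. s j x * prb x) \<le> 3 * c j / D"
  shows "prb i * exp (- 1) * (1 + 782 / D) \<le> mean (\<lambda>V. of_bool (kept V i))"
proof -
  define u where "u = 1 / D + 1 / D\<^sup>2"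
  have D1: "1000 \<le> D" using D by simp
  \<comment> \<open>This simple upper bound makes \<open>1 - u\<close> at least (D - 2) / (D - 1),
    whose inverse 1 + 1 / (D - 2) is at most exp (1 / (D - 2)).\<close>
  have "u \<le> 1 / (D - 1)" using D1 by (simp add: u_def field_simps power2_eq_square)
  moreover have "1 - 1 / (D - 1) = (D - 2) / (D - 1)" using D1 by (simp add: field_simps)
  ultimately have u: "(D - 2) / (D - 1) \<le> 1 - u" by linarith
  have "exp (- (1 / (D - 2))) \<le> (D - 2) / (D - 1)"
  proof -
    have "(D - 1) / (D - 2) = 1 + 1 / (D - 2)" using D1 by (simp add: field_simps)
    also have "\<dots> \<le> exp (1 / (D - 2))" by (rule exp_ge_add_one_self)
    finally have "inverse (exp (1 / (D - 2))) \<le> inverse ((D - 1) / (D - 2))"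
      using D1 by (intro le_imp_inverse_le) auto
    thus ?thesis using D1 by (simp add: exp_minus)
  qed
  hence eu: "exp (- (1 / (D - 2))) \<le> 1 - u" using u by linarith
  hence u1: "0 \<le> 1 - u" using exp_ge_zero order.trans by blast
  have u0: "0 \<le> u" using D1 by (simp add: u_def)
  have "exp (- 1) * (1 + 998 / D) \<le> (1 - u) ^ k"
  proof -
    \<comment> \<open>As k = D - 1000, the exponent -k / (D - 2) equals -1 + 998 / (D - 2).\<close>
    have "998 / D \<le> 998 / (D - 2)" using D1 by (simp add: field_simps)
    hence "1 + 998 / D \<le> exp (998 / (D - 2))"
      using exp_ge_add_one_self[of "998 / (D - 2)"] by linarith
    hence "exp (- 1) * (1 + 998 / D) \<le> exp (- 1) * exp (998 / (D - 2))"
      by (intro mult_left_mono) auto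
    also have "\<dots> = exp (real k * - (1 / (D - 2)))"
      unfolding exp_add[symmetric] using D D1 by (simp add: field_simps)
    also have "\<dots> = exp (- (1 / (D - 2))) ^ k" by (rule exp_of_nat_mult)
    also have "\<dots> \<le> (1 - u) ^ k" using eu by (intro power_mono) auto
    finally show ?thesis .
  qed
  also have "\<dots> \<le> (1 - u) ^ card (rows_of i)" using u0 u1 k by (intro power_decreasing) auto
  also have "\<dots> = (\<Prod>j\<in>rows_of i. 1 - u)" by simp
  also have "\<dots> \<le> (\<Prod>j\<in>rows_of i. \<Prod>x\<in>big j - {i}. 1 - prb x)"
  proof (intro prod_mono conjI u1)
    fix j assume "j \<in> rows_of i"
    hence j: "j < m" by (simp add: rows_of_def)
    have "(\<Sum>x\<in>big j - {i}. prb x) \<le> (\<Sum>x\<in>big j. prb x)" using prb_01 by (intro sum_mono2) auto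
    also have "\<dots> \<le> u" unfolding u_def by (rule big_le[OF j])
    finally have "1 - u \<le> 1 - (\<Sum>x\<in>big j - {i}. prb x)" by simp
    also have "\<dots> \<le> (\<Prod>x\<in>big j - {i}. 1 - prb x)"
      using prb_01 by (intro Weierstrass_prod_ineq) auto
    finally show "1 - u \<le> (\<Prod>x\<in>big j - {i}. 1 - prb x)" .
  qed
  also have "\<dots> \<le> (\<Prod>x\<in>rivals i. 1 - prb x)"
    unfolding rivals_def using prb_01 by (intro prod_UN_ge) auto
  finally have 1: "exp (- 1) * (1 + 998 / D) \<le> (\<Prod>x\<in>rivals i. 1 - prb x)" .
  \<comment> \<open>72 is 8 times the square of the 3 in \<open>small_le\<close>. At most
    \<open>k\<close>, hence at most \<open>D\<close>, rows contribute, and 216 = 3 * 72 buys the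
    factor \<open>exp (- 1)\<close>, which is at least 1 / 3.\<close>
  have "(\<Sum>j\<in>rows_of i. 8 / (c j)\<^sup>2 * (\<Sum>x\<in>small j. s j x * prb x)\<^sup>2) \<le> (\<Sum>j\<in>rows_of i. 72 / D\<^sup>2)"
  proof (intro sum_mono)
    fix j assume jr: "j \<in> rows_of i"
    hence j: "j < m" "0 < c j" using fit[of j] by (auto simp: rows_of_def)
    have "0 \<le> (\<Sum>x\<in>small j. s j x * prb x)" using s j prb_01 by (intro sum_nonneg) (auto simp: small_def)
    hence "8 / (c j)\<^sup>2 * (\<Sum>x\<in>small j. s j x * prb x)\<^sup>2 \<le> 8 / (c j)\<^sup>2 * (3 * c j / D)\<^sup>2"
      using small_le[OF j] by (intro mult_left_mono power_mono) auto
    also have "\<dots> = 72 / D\<^sup>2" using j by (simp add: field_simps power2_eq_square)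
    finally show "8 / (c j)\<^sup>2 * (\<Sum>x\<in>small j. s j x * prb x)\<^sup>2 \<le> 72 / D\<^sup>2" .
  qed
  also have "\<dots> = card (rows_of i) * (72 / D\<^sup>2)" by simp
  also have "\<dots> \<le> D * (72 / D\<^sup>2)" using k D by (intro mult_right_mono) auto
  also have "\<dots> = 72 / D" using D1 by (simp add: power2_eq_square)
  also have "\<dots> \<le> exp (- 1) * (216 / D)"
  proof -
    have "exp 1 \<le> (3::real)" by (rule exp_le)
    hence "inverse 3 \<le> inverse (exp 1 :: real)" by (intro le_imp_inverse_le) auto
    hence "1 / 3 \<le> exp (- 1 :: real)" by (simp add: exp_minus inverse_eq_divide)
    hence "1 / 3 * (216 / D) \<le> exp (- 1) * (216 / D)" using D1 by (intro mult_right_mono) auto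
    thus ?thesis by simp
  qed
  finally have 2: "(\<Sum>j\<in>rows_of i. 8 / (c j)\<^sup>2 * (\<Sum>x\<in>small j. s j x * prb x)\<^sup>2) \<le> exp (- 1) * (216 / D)" .
  have "exp (- 1) * (1 + 782 / D) = exp (- 1) * (1 + 998 / D) - exp (- 1) * (216 / D)"
    by (simp add: algebra_simps)
  also have "\<dots> \<le> (\<Prod>x\<in>rivals i. 1 - prb x) -
     (\<Sum>j\<in>rows_of i. 8 / (c j)\<^sup>2 * (\<Sum>x\<in>small j. s j x * prb x)\<^sup>2)" by (rule diff_mono[OF 1 2])
  finally have "prb i * (exp (- 1) * (1 + 782 / D)) \<le> prb i * \<dots>"
    using prb_01 by (intro mult_left_mono) auto
  also note mean_kept_ge[OF i fit]
  finally show ?thesis by (simp add: mult.assoc)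
qed

lemma kept_feasible:
  assumes "j < m" "0 \<le> c j"
  shows "(\<Sum>i<n. s j i * of_bool (kept V i)) \<le> c j"
proof -
  define K where "K = {i. i < n \<and> kept V i \<and> s j i \<noteq> 0}"
  have sumK: "(\<Sum>i<n. s j i * of_bool (kept V i)) = (\<Sum>i\<in>K. s j i)"
    by (rule sum.mono_neutral_cong_right) (auto simp: K_def)
  show ?thesis
  proof (cases "K = {}")
    case True
    thus ?thesis using assms sumK by simp
  next
    case False
    have finK: "finite K" by (simp add: K_def)
    obtain i where i: "i \<in> K" "\<And>x. x \<in> K \<Longrightarrow> s j i \<le> s j x"
    proof -
      have "Min (s j ` K) \<in> s j ` K" using finK False by (intro Min_in) auto
      then obtain i where "i \<in> K" "s j i = Min (s j ` K)" by auto
      thus ?thesis using finK by (intro that[of i]) auto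
    qed
    have "(\<Sum>x\<in>K. s j x) \<le> (\<Sum>i'<n. if sel V i' \<and> s j i \<le> s j i' then s j i' else 0)"
    proof -
      have "(\<Sum>x\<in>K. s j x) = (\<Sum>i'\<in>K. if sel V i' \<and> s j i \<le> s j i' then s j i' else 0)"
        using i(2) by (intro sum.cong) (auto simp: K_def kept_def)
      also have "\<dots> \<le> (\<Sum>i'<n. if sel V i' \<and> s j i \<le> s j i' then s j i' else 0)"
        using s assms by (intro sum_mono2) (auto simp: K_def)
      finally show ?thesis .
    qed
    also have "\<dots> \<le> c j" using i(1) assms by (auto simp: K_def kept_def)
    finally show ?thesis unfolding sumK .
  qed
qed

end

subsection \<open>The program\<close>

text \<open>
  Array \<open>rB\<close> holds the input numbers times the product \<open>rP\<close> of all denominators: first the weights,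
  then the capacities, then the matrix row by row. \<open>rC\<close> are the column counts, \<open>rD\<close> is the maximal
  count plus 1000, and \<open>rW\<close> are the weights with those of items that do not fit set to 0. \<open>rA\<close> is the
  packing matrix with common capacity \<open>n\<close>: the rounded original rows, the rows counting big items,
  and the unit rows, which make every column maximum \<open>n\<close>. \<open>rK\<close> counts down the iterations of the two
  outer loops.
\<close>

abbreviation (input) "rM \<equiv> 23 :: nat"
abbreviation (input) "rN \<equiv> 2 :: nat"
abbreviation (input) "rP \<equiv> 3 :: nat"
abbreviation (input) "rB \<equiv> 4 :: nat"
abbreviation (input) "rC \<equiv> 5 :: nat"
abbreviation (input) "rD \<equiv> 6 :: nat"
abbreviation (input) "rW \<equiv> 7 :: nat"
abbreviation (input) "rA \<equiv> 8 :: nat"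
abbreviation (input) "rY \<equiv> 9 :: nat"
abbreviation (input) "rCost \<equiv> 10 :: nat"
abbreviation (input) "rBest \<equiv> 11 :: nat"
abbreviation (input) "rX \<equiv> 12 :: nat"
abbreviation (input) "rK \<equiv> 13 :: nat"
abbreviation (input) "rLd \<equiv> 14 :: nat"
abbreviation (input) "rLam \<equiv> 15 :: nat"
abbreviation (input) "rV \<equiv> 16 :: nat"
abbreviation (input) "rCoin \<equiv> 17 :: nat"
abbreviation (input) "rQ \<equiv> 18 :: nat"
abbreviation (input) "rPw \<equiv> 19 :: nat"
abbreviation (input) "rSel \<equiv> 20 :: nat"
abbreviation (input) "rLoad \<equiv> 21 :: nat"
abbreviation (input) "rKeep \<equiv> 22 :: nat"

abbreviation "eM \<equiv> Rd rM (N 0)"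
abbreviation "eN \<equiv> Rd rN (N 0)"
abbreviation "eD \<equiv> Rd rD (N 0)"
abbreviation "eTot \<equiv> Add (Add eN eM) (Mul eM eN)"
abbreviation "eR \<equiv> Add (Mul (N 2) eM) eN"
abbreviation "eC j \<equiv> Rd rB (Add eN j)"
abbreviation "eS j i \<equiv> Rd rB (Add (Add eN eM) (Add (Mul j eN) i))"
abbreviation "eBits \<equiv> Add (Add eN (Mul (N 2) eM)) (N 20)"
abbreviation "noop \<equiv> SAdd (N 0)"

text \<open>\<open>Ite\<close> is arithmetic, so every branch is evaluated, with meaningless indices
  in the wrong ones. Total reads and total division make this harmless, since those values are
  multiplied by 0.\<close>

definition entry_ex :: ex where
  "entry_ex = (let q = Dv Ix eN; i = Sub Ix (Mul eN q); q' = Sub q eM; q'' = Sub q' eM in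
     Ite (Lt q eM) (Dv (Mul eN (eS q i)) (eC q))
      (Ite (Lt q' eM) (Mul eN (Lt (eC q') (Mul (N 2) (eS q' i)))) (Mul eN (Eq q'' i))))"

definition get_m :: fill where
  "get_m = Fill rM (N 1) (N 0) (Rd 0 (N 0)) noop"

definition get_n :: fill where
  "get_n = Fill rN (N 1) (N 0) (Rd 0 (N 1)) noop"

text \<open>After the two dimensions, the l-th rational occupies cells 2 l + 2 (numerator) and 2 l +
  3 (denominator).\<close>

definition get_dens :: fill where
  "get_dens = Fill rP (N 1) eTot (N 1) (SMul (Rd 0 (Add (Mul (N 2) Lx) (N 3))))"

definition get_num :: fill where
  "get_num = Fill rB eTot (N 0)
     (Mul (Rd 0 (Add (Mul (N 2) Ix) (N 2))) (Dv (Rd rP (N 0)) (Rd 0 (Add (Mul (N 2) Ix) (N 3))))) noop"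

definition get_cnt :: fill where
  "get_cnt = Fill rC eN eM (N 0) (SAdd (Lt (N 0) (eS Lx Ix)))"

text \<open>A running maximum; the start value 1000 also covers instances without items.\<close>

definition get_D :: fill where
  "get_D = Fill rD (N 1) eN (N 1000) (SIf Ac (Add (Rd rC Lx) (N 1000)) (Add (Rd rC Lx) (N 1000)))"

definition get_wgt :: fill where
  "get_wgt = Fill rW eN eM (Rd rB Ix) (SIf (eC Lx) (eS Lx Ix) (N 0))"

definition get_coef :: fill where
  "get_coef = Fill rA (Mul eR eN) (N 0) entry_ex noop"

definition init_Y :: fill where
  "init_Y = Fill rY eR (N 0) (N 1) noop"

definition init_T :: fill where
  "init_T = Fill rK (N 1) (N 0) (Mul (Mul (Mul eN eR) eD) eD) noop"

definition pre_fills :: "fill list" where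
  "pre_fills = [get_m, get_n, get_dens, get_num, get_cnt, get_D, get_wgt, get_coef, init_Y, init_T]"

definition get_cost :: fill where
  "get_cost = Fill rCost eN eR (N 0) (SAdd (Mul (Rd rY Lx) (Rd rA (Add (Mul Lx eN) Ix))))"

text \<open>Here the accumulator is an index, namely the current value of
  \<open>argmin_upto\<close>.\<close>

definition best_step :: step where
  "best_step = SIf (Mul (Rd rCost Lx) (Rd rW Ac)) (Mul (Rd rCost Ac) (Rd rW Lx)) Lx"

definition get_best :: fill where
  "get_best = Fill rBest (N 1) eN (N 0) best_step"

definition incr_X :: fill where
  "incr_X = Fill rX eN (N 0) (Add Ac (Eq Ix (Rd rBest (N 0)))) noop"

definition scale_Y :: fill where
  "scale_Y = Fill rY eR (N 0) (Mul Ac (Add (Mul eD eN) (Rd rA (Add (Mul Ix eN) (Rd rBest (N 0)))))) noop"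

definition decr_K :: fill where
  "decr_K = Fill rK (N 1) (N 0) (Sub Ac (N 1)) noop"

definition mw_fills :: "fill list" where
  "mw_fills = [get_cost, get_best, incr_X, scale_Y, decr_K]"

definition get_rowsum :: fill where
  "get_rowsum = Fill rLd eR eN (N 0) (SAdd (Mul (Rd rA (Add (Mul Ix eN) Lx)) (Rd rX Lx)))"

definition lam_step :: step where
  "lam_step = SIf Ac (Rd rLd Lx) (Rd rLd Lx)"

definition get_lam :: fill where
  "get_lam = Fill rLam (N 1) eR (N 0) lam_step"

definition init_flips :: fill where
  "init_flips = Fill rK (N 1) (N 0) (Mul eN eBits) noop"

definition mid_fills :: "fill list" where
  "mid_fills = [get_rowsum, get_lam, init_flips]"

text \<open>The flipped bit is appended to the binary number in \<open>rV\<close>. The coin cell is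
  reset so that the state depends only on this number and the countdown.\<close>

definition coin_fills :: "fill list" where
  "coin_fills =
    [Fill rV (N 1) (N 0) (Add (Mul (N 2) Ac) (Rd rCoin (N 0))) noop,
     Fill rCoin (N 1) (N 0) (N 0) noop,
     Fill rK (N 1) (N 0) (Sub Ac (N 1)) noop]"

definition get_Q :: fill where
  "get_Q = Fill rQ (N 1) eBits (N 1) (SMul (N 2))"

definition get_pow :: fill where
  "get_pow = Fill rPw eN Ix (N 1) (SMul (Rd rQ (N 0)))"

text \<open>Accepting digits with digit * L * D < n * X * Q realises the probability n X / (L D),
  rounded up to a multiple of 1 / Q. The digit is a remainder, written with
  \<open>Dv\<close>.\<close>

definition get_sel :: fill where
  "get_sel = Fill rSel eN (N 0)
     (let z = Dv (Rd rV (N 0)) (Rd rPw Ix); q = Rd rQ (N 0); digit = Sub z (Mul q (Dv z q)) in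
      Lt (Mul (Mul digit (Rd rLam (N 0))) eD) (Mul (Mul eN (Rd rX Ix)) q)) noop"

definition get_load :: fill where
  "get_load = Fill rLoad (Mul eM eN) eN (N 0)
     (let s' = Rd rB (Add (Add eN eM) (Add (Mul (Dv Ix eN) eN) Lx)); s = Rd rB (Add (Add eN eM) Ix) in
      SAdd (Mul (Rd rSel Lx) (Mul (Sub (N 1) (Lt s' s)) s')))"

definition keep_step :: step where
  "keep_step = SIf (N 0) (Mul (Lt (N 0) (eS Lx Ix)) (Lt (eC Lx) (Rd rLoad (Add (Mul Lx eN) Ix)))) (N 0)"

definition get_keep :: fill where
  "get_keep = Fill rKeep eN eM (Rd rSel Ix) keep_step"

definition get_out :: fill where
  "get_out = Fill 0 eN (N 0) (Rd rKeep Ix) noop"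

definition post_fills :: "fill list" where
  "post_fills = [get_Q, get_pow, get_sel, get_load, get_keep, get_out]"

lemma fills_wf:
  "list_all fill_wf pre_fills" "list_all fill_wf mw_fills" "list_all fill_wf mid_fills"
  "list_all fill_wf coin_fills" "list_all fill_wf post_fills"
  by (simp_all add: pre_fills_def mw_fills_def mid_fills_def coin_fills_def post_fills_def entry_ex_def Let_def
      get_m_def get_n_def get_dens_def get_num_def get_cnt_def get_D_def get_wgt_def get_coef_def init_Y_def init_T_def
      get_cost_def get_best_def incr_X_def scale_Y_def decr_K_def
      get_rowsum_def get_lam_def init_flips_def
      get_Q_def get_pow_def get_sel_def get_load_def get_keep_def get_out_def
      best_step_def lam_step_def keep_step_def)

definition loop_cond :: aexp where
  "loop_cond = compile (Rd rK (N 0))"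

definition coin_body :: com where
  "coin_body = Seq (Flip (addr_exp rCoin (Const 0))) (fills_com coin_fills)"

definition pip_alg :: com where
  "pip_alg = Seq (fills_com pre_fills) (Seq (While loop_cond (fills_com mw_fills))
     (Seq (fills_com mid_fills) (Seq (While loop_cond coin_body) (fills_com post_fills))))"

section \<open>Values computed by the array assignments\<close>

primrec fill_target :: "fill \<Rightarrow> nat" where
  "fill_target (Fill r len bnd init s) = r"

lemma fill_den_other: "fill_target f \<noteq> r \<Longrightarrow> fill_den f \<sigma> r = \<sigma> r"
  by (cases f) auto

lemma fills_den_other: "r \<notin> fill_target ` set fs \<Longrightarrow> fills_den fs \<sigma> r = \<sigma> r"
  by (induction fs arbitrary: \<sigma>) (auto simp: fill_den_other)

lemma fill_val_noop: "fill_val (Fill r len (N 0) init s) \<sigma> i = ev init (int i) 0 (\<sigma> r i) \<sigma>"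
  by simp

lemma iter_SAdd: "no_acc e \<Longrightarrow> iter (step_ex (SAdd e)) \<sigma> i a b = a + (\<Sum>l<b. ev e i (int l) 0 \<sigma>)"
proof (induction b)
  case (Suc b)
  thus ?case using ev_no_acc[of e i "int b" _ \<sigma> 0] by simp
qed simp

lemma iter_SMul: "no_acc e \<Longrightarrow> iter (step_ex (SMul e)) \<sigma> i a b = a * (\<Prod>l<b. ev e i (int l) 0 \<sigma>)"
proof (induction b)
  case (Suc b)
  thus ?case using ev_no_acc[of e i "int b" _ \<sigma> 0] by simp
qed simp

lemma iter_clear:
  assumes "\<And>l a. l < b \<Longrightarrow> ev e i (int l) a \<sigma> = (if p l then 0 else a)"
  shows "iter e \<sigma> i a b = (if \<exists>l<b. p l then 0 else a)"
  using assms by (induction b) (auto simp: less_Suc_eq)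

lemma iter_max:
  assumes "\<And>l a. l < b \<Longrightarrow> ev e i (int l) a \<sigma> = max a (g l)"
  shows "a \<le> iter e \<sigma> i a b" "\<And>l. l < b \<Longrightarrow> g l \<le> iter e \<sigma> i a b"
    "iter e \<sigma> i a b = a \<or> (\<exists>l<b. iter e \<sigma> i a b = g l)"
  using assms
proof (induction b)
  case (Suc b)
  case 1
  thus ?case using Suc(1) by (simp add: max_def)
next
  case (Suc b)
  case (2 l)
  thus ?case using Suc(2) by (auto simp: less_Suc_eq max_def intro: order.trans)
next
  case (Suc b)
  case 3
  thus ?case using Suc(3) by (auto simp: less_Suc_eq max_def)
qed auto

text \<open>The instance as the program sees it: \<open>inp\<close> is the encoded input, and all numbers are
  scaled by the product \<open>dens\<close> of all denominators.\<close>

locale encoded =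
  fixes m n :: nat and inp :: "nat \<Rightarrow> int"
  assumes inp01: "inp 0 = int m" "inp 1 = int n"
begin

definition tot :: nat where "tot = n + m + m * n"
definition dens :: int where "dens = (\<Prod>l<tot. inp (2 * l + 3))"
definition num :: "nat \<Rightarrow> int" where "num l = inp (2 * l + 2) * (dens div inp (2 * l + 3))"
definition cp :: "nat \<Rightarrow> int" where "cp j = num (n + j)"
definition sz :: "nat \<Rightarrow> nat \<Rightarrow> int" where "sz j i = num (n + m + (j * n + i))"
definition cnt :: "nat \<Rightarrow> int" where "cnt i = (\<Sum>j<m. of_bool (0 < sz j i))"
definition wgt :: "nat \<Rightarrow> int" where "wgt i = (if \<exists>j<m. cp j < sz j i then 0 else num i)"
definition nrows :: nat where "nrows = 2 * m + n"
text \<open>Rounding down keeps integral solutions feasible. A row of capacity 0 becomes a zero row,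
  as division by 0 gives 0; items with a positive entry there have weight 0 by
  \<open>wgt\<close>.\<close>

definition coef :: "nat \<Rightarrow> nat \<Rightarrow> int" where
  "coef q i = (if q < m then int n * sz q i div cp q
     else if q < 2 * m then int n * of_bool (cp (q - m) < 2 * sz (q - m) i)
     else int n * of_bool (q - 2 * m = i))"
text \<open>The last conjunct yields D <= k + 1000 for every k that bounds the column counts, which
  is how the unknown k enters.\<close>

definition is_D :: "int \<Rightarrow> bool" where
  "is_D D \<longleftrightarrow> 1000 \<le> D \<and> (\<forall>i<n. cnt i + 1000 \<le> D) \<and> (D = 1000 \<or> (\<exists>i<n. D = cnt i + 1000))"

definition base :: "int \<Rightarrow> arrays \<Rightarrow> bool" where
  "base D \<sigma> \<longleftrightarrow> \<sigma> rM 0 = int m \<and> \<sigma> rN 0 = int n \<and> (\<forall>l<tot. \<sigma> rB l = num l) \<and> \<sigma> rD 0 = D \<and>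
     (\<forall>i<n. \<sigma> rW i = wgt i) \<and> (\<forall>q<nrows. \<forall>i<n. \<sigma> rA (q * n + i) = coef q i)"

lemma cell_less: "j < k \<Longrightarrow> i < n \<Longrightarrow> j * n + i < k * n"
proof -
  assume "j < k" "i < n"
  hence "j * n + i < Suc j * n" by simp
  also have "\<dots> \<le> k * n" using \<open>j < k\<close> by (intro mult_le_mono) auto
  finally show ?thesis .
qed

lemma tot_less: "i < n \<Longrightarrow> i < tot" "j < m \<Longrightarrow> n + j < tot"
  "j < m \<Longrightarrow> i < n \<Longrightarrow> n + m + (j * n + i) < tot"
  using cell_less[of j m i] by (auto simp: tot_def)

text \<open>Normal forms for the absolute values that \<open>ev\<close> puts around array
  indices.\<close>

lemma nat_index [simp]:
  "nat \<bar>int a * int b + int c\<bar> = a * b + c" "nat (int a * int b + int c) = a * b + c"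
  "nat \<bar>int a + int b\<bar> = a + b" "nat (int a + int b) = a + b"
  "nat \<bar>int a + int b + int c\<bar> = a + b + c" "nat (int a + int b + int c) = a + b + c"
  "nat \<bar>int a + int b + (int c * int d + int e)\<bar> = a + b + (c * d + e)" "nat (int a + int b + (int c * int d + int e)) = a + b + (c * d + e)"
  "nat \<bar>2 * int a + 2\<bar> = 2 * a + 2" "nat (2 * int a + 2) = 2 * a + 2"
  "nat \<bar>2 * int a + 3\<bar> = 2 * a + 3" "nat (2 * int a + 3) = 2 * a + 3"
  by (simp_all flip: of_nat_mult of_nat_add add: nat_add_distrib nat_mult_distrib abs_of_nonneg)

text \<open>Symbolic execution with one named state per assignment; \<open>keep\<close> transports
  each array past the assignments that do not target it.\<close>

lemma pre_fills_den:
  assumes "\<sigma> 0 = inp" and U: "4 * (m + n + 1) * (m + n + 1) < U"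
  shows "\<exists>D. is_D D \<and> base D (fills_den pre_fills \<sigma>) \<and>
     fills_den pre_fills \<sigma> rK 0 = int n * int nrows * D * D \<and>
     (\<forall>q<nrows. fills_den pre_fills \<sigma> rY q = 1) \<and> fills_ok U pre_fills \<sigma>"
proof -
  note fs = get_m_def get_n_def get_dens_def get_num_def get_cnt_def get_D_def get_wgt_def get_coef_def init_Y_def init_T_def
  note pre = pre_fills_def
  have tgt: "fill_target get_m = rM" "fill_target get_n = rN" "fill_target get_dens = rP" "fill_target get_num = rB"
    "fill_target get_cnt = rC" "fill_target get_D = rD" "fill_target get_wgt = rW" "fill_target get_coef = rA"
    "fill_target init_Y = rY" "fill_target init_T = rK" by (simp_all add: fs)
  define s1 where "s1 = fill_den get_m \<sigma>"
  define s2 where "s2 = fill_den get_n s1"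
  define s3 where "s3 = fill_den get_dens s2"
  define s4 where "s4 = fill_den get_num s3"
  define s5 where "s5 = fill_den get_cnt s4"
  define s6 where "s6 = fill_den get_D s5"
  define s7 where "s7 = fill_den get_wgt s6"
  define s8 where "s8 = fill_den get_coef s7"
  define s9 where "s9 = fill_den init_Y s8"
  define s10 where "s10 = fill_den init_T s9"
  have keep: "r \<noteq> rM \<Longrightarrow> s1 r = \<sigma> r" "r \<noteq> rN \<Longrightarrow> s2 r = s1 r" "r \<noteq> rP \<Longrightarrow> s3 r = s2 r"
    "r \<noteq> rB \<Longrightarrow> s4 r = s3 r" "r \<noteq> rC \<Longrightarrow> s5 r = s4 r" "r \<noteq> rD \<Longrightarrow> s6 r = s5 r"
    "r \<noteq> rW \<Longrightarrow> s7 r = s6 r" "r \<noteq> rA \<Longrightarrow> s8 r = s7 r" "r \<noteq> rY \<Longrightarrow> s9 r = s8 r"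
    "r \<noteq> rK \<Longrightarrow> s10 r = s9 r" for r
    by (simp_all add: s1_def s2_def s3_def s4_def s5_def s6_def s7_def s8_def s9_def s10_def fill_den_other tgt)
  have v1: "s1 rM 0 = int m"
    unfolding s1_def get_m_def by (simp add: assms(1) inp01)
  have v2: "s2 rN 0 = int n"
    unfolding s2_def get_n_def using inp01 by (simp add: keep assms(1))
  have mn: "s2 rM 0 = int m" "s3 rM 0 = int m" "s4 rM 0 = int m" "s5 rM 0 = int m" "s6 rM 0 = int m"
      "s7 rM 0 = int m" "s8 rM 0 = int m" "s9 rM 0 = int m" "s10 rM 0 = int m"
      "s3 rN 0 = int n" "s4 rN 0 = int n" "s5 rN 0 = int n" "s6 rN 0 = int n"
      "s7 rN 0 = int n" "s8 rN 0 = int n" "s9 rN 0 = int n" "s10 rN 0 = int n"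
    by (simp_all add: keep v1 v2)
  have inp: "s2 0 = inp" "s3 0 = inp" by (simp_all add: keep assms(1))
  have tot: "nat (int n + int m + int m * int n) = tot"
    by (simp add: tot_def nat_add_distrib nat_mult_distrib)
  have v3: "s3 rP 0 = dens"
    unfolding s3_def get_dens_def
    by (simp add: iter_SMul[simplified] mn v2 inp tot dens_def)
  have v4: "s4 rB l = num l" if "l < tot" for l
  proof -
    have "int l < int n + int m + int m * int n" using that by (simp add: tot_def flip: of_nat_mult of_nat_add)
    thus ?thesis unfolding s4_def get_num_def by (simp add: mn inp v3 num_def)
  qed
  have B: "s5 rB l = num l" "s6 rB l = num l" "s7 rB l = num l" "s10 rB l = num l" if "l < tot" for l
    using that by (simp_all add: keep v4)
  have v5: "s5 rC i = cnt i" if "i < n" for i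
    unfolding s5_def get_cnt_def using that tot_less
    by (simp add: iter_SAdd[simplified] mn v4 cnt_def sz_def)
  have "is_D (s6 rD 0)"
  proof -
    have val: "s6 rD 0 = iter (step_ex (SIf Ac (Add (Rd rC Lx) (N 1000)) (Add (Rd rC Lx) (N 1000)))) s5 0 1000 n"
      unfolding s6_def get_D_def by (simp add: mn)
    have st: "ev (step_ex (SIf Ac (Add (Rd rC Lx) (N 1000)) (Add (Rd rC Lx) (N 1000)))) 0 (int l) a s5
        = max a (cnt l + 1000)" if "l < n" for l a
      using that by (simp add: v5 max_def)
    show ?thesis unfolding is_D_def val using iter_max[OF st] by auto
  qed
  moreover have v7: "s7 rW i = wgt i" if "i < n" for i
  proof -
    have st: "ev (step_ex (SIf (eC Lx) (eS Lx Ix) (N 0))) (int i) (int l) a s6 = (if cp l < sz l i then 0 else a)"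
      if "l < m" for l a
      using that \<open>i < n\<close> tot_less by (simp add: mn B cp_def sz_def)
    have "s7 rW i = iter (step_ex (SIf (eC Lx) (eS Lx Ix) (N 0))) s6 (int i) (num i) m"
      unfolding s7_def get_wgt_def using that tot_less by (simp add: mn B)
    also have "\<dots> = wgt i" unfolding wgt_def by (rule iter_clear[OF st])
    finally show ?thesis .
  qed
  moreover have v8: "s8 rA (q * n + i) = coef q i" if q: "q < nrows" and i: "i < n" for q i
  proof -
    have len: "int (q * n + i) < ev (Mul eR eN) 0 0 0 s7"
    proof -
      have "int (q * n + i) < int ((2 * m + n) * n)"
        using cell_less[OF q i] unfolding nrows_def by (simp only: of_nat_less_iff)
      thus ?thesis by (simp add: mn)
    qed
    have dv: "(int q * int n + int i) div int n = int q"
      using i by (simp flip: of_nat_mult of_nat_add zdiv_int)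
    have ix: "nat \<bar>int n + int m + (int q * int n + (int q * int n + int i - int n * int q))\<bar> = n + m + (q * n + i)"
      by (simp add: algebra_simps nat_add_distrib nat_mult_distrib)
    have ix': "nat (int n + int m + ((int q - int m) * int n + int i)) = n + m + ((q - m) * n + i)"
      "nat (int n + (int q - int m)) = n + (q - m)" if "m \<le> q"
      using that by (auto simp: le_iff_add algebra_simps nat_add_distrib nat_mult_distrib)
    have "s8 rA (q * n + i) = ev entry_ex (int (q * n + i)) 0 (s7 rA (q * n + i)) s7"
      unfolding s8_def get_coef_def using len by (simp add: fill_val_noop)
    also have "\<dots> = coef q i"
    proof -
      consider "q < m" | "m \<le> q" "q < 2 * m" | "2 * m \<le> q" by linarith
      thus ?thesis
      proof cases
        case 1
        thus ?thesis using i tot_less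
          by (simp add: entry_ex_def Let_def mn dv ix B coef_def cp_def sz_def)
      next
        case 2
        hence "n + m + ((q - m) * n + i) < tot" "n + (q - m) < tot"
          using tot_less(2)[of "q - m"] tot_less(3)[of "q - m" i] i by simp_all
        thus ?thesis using i 2
          by (simp add: entry_ex_def Let_def mn dv ix' B coef_def cp_def sz_def)
      next
        case 3
        moreover have "(int q - int m - int m = int q * int n + int i - int n * int q) \<longleftrightarrow> q - 2 * m = i"
          using 3 by (auto simp: algebra_simps)
        ultimately show ?thesis
          by (simp add: entry_ex_def Let_def mn dv coef_def)
      qed
    qed
    finally show ?thesis .
  qed
  moreover have v9: "s9 rY q = 1" if "q < nrows" for q
    using that unfolding s9_def init_Y_def by (simp add: mn nrows_def)
  moreover have v10: "s10 rK 0 = int n * int nrows * s6 rD 0 * s6 rD 0"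
    unfolding s10_def init_T_def by (simp add: v1 v2 keep nrows_def)
  moreover have s10: "fills_den pre_fills \<sigma> = s10"
    by (simp add: pre s10_def s9_def s8_def s7_def s6_def s5_def s4_def s3_def s2_def s1_def)
  moreover have "fills_ok U pre_fills \<sigma>"
  proof -
    have le: "n < U" "m < U" "n + m + m * n < U" "(2 * m + n) * n < U" "2 * m + n < U" "1 < U"
      by (rule order.strict_trans1[OF _ U], simp add: algebra_simps)+
    hence "int (n + m + m * n) < int U" "int ((2 * m + n) * n) < int U" "int (2 * m + n) < int U"
      by (simp_all only: of_nat_less_iff)
    hence le': "int n < int U" "int m < int U" "int n + int m + int m * int n < int U"
      "(2 * int m + int n) * int n < int U" "2 * int m + int n < int U" "1 < int U"
      using le by simp_all
    show ?thesis unfolding pre fills_ok.simps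
      unfolding s1_def[symmetric] s2_def[symmetric] s3_def[symmetric] s4_def[symmetric] s5_def[symmetric]
        s6_def[symmetric] s7_def[symmetric] s8_def[symmetric] s9_def[symmetric]
      using le' by (simp add: fs mn v2)
  qed
  ultimately show ?thesis
    unfolding s10 base_def by (intro exI[of _ "s6 rD 0"]) (simp add: v1 v2 v4 keep)
qed

end

subsection \<open>The multiplicative weights loop\<close>

lemma bits_sum: "(\<And>l. l < k \<Longrightarrow> bits (f l) \<le> g) \<Longrightarrow> bits (\<Sum>l<k. f l) \<le> 1 + k * g"
proof (induction k)
  case (Suc k)
  have "bits (\<Sum>l<Suc k. f l) \<le> bits (\<Sum>l<k. f l) + bits (f k)" using bits_add by simp
  also have "\<dots> \<le> (1 + k * g) + g" using Suc by (intro add_mono) auto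
  finally show ?case by simp
qed simp

lemma aval_loop_cond: "aval loop_cond (mem_of \<sigma>) = \<sigma> rK 0"
  unfolding loop_cond_def work_mem_0[symmetric] by simp

definition mw_growth :: "nat \<Rightarrow> nat" where
  "mw_growth U = 1 + 3 * U + 3 * U * U + U * (2 * U + 3 * U * U)"

lemma poly_bounded_mw_growth: "poly_bounded (\<lambda>U. mw_growth U)"
  unfolding mw_growth_def by (intro poly_bounded_intros)

text \<open>Applying \<open>fill_growth\<close> once per round would compound beyond any polynomial.
  Instead a round adds at most 2 bits to \<open>rX\<close> and \<open>rK\<close>, and at most
  \<open>3 * U\<close> bits to \<open>rY\<close>, which is multiplied by a number built from three
  cells the loop never writes. \<open>rCost\<close> and \<open>rBest\<close> are recomputed from the
  others.\<close>

definition mw_bound :: "nat \<Rightarrow> nat \<Rightarrow> arrays \<Rightarrow> bool" where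
  "mw_bound U t \<sigma> \<longleftrightarrow> (\<forall>r i. r \<notin> {rCost, rBest, rX, rY, rK} \<longrightarrow> bits (\<sigma> r i) \<le> U) \<and>
     (\<forall>i. bits (\<sigma> rX i) \<le> U + 2 * t) \<and> (\<forall>i. bits (\<sigma> rK i) \<le> U + 2 * t) \<and>
     (\<forall>i. bits (\<sigma> rY i) \<le> U + 3 * U * t) \<and>
     (\<forall>i. bits (\<sigma> rCost i) \<le> mw_growth U) \<and> (\<forall>i. bits (\<sigma> rBest i) \<le> mw_growth U)"

lemma mw_bound_arrays_bound:
  assumes "mw_bound U t \<sigma>" "t \<le> U"
  shows "arrays_bound (mw_growth U) \<sigma>"
  unfolding arrays_bound_def
proof (intro allI)
  fix r i
  have "3 * U * t \<le> 3 * U * U" using assms by simp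
  hence le: "U \<le> mw_growth U" "U + 2 * t \<le> mw_growth U" "U + 3 * U * t \<le> mw_growth U"
    using assms(2) unfolding mw_growth_def by linarith+
  have "bits (\<sigma> r i) \<le> U \<or> bits (\<sigma> r i) \<le> U + 2 * t \<or> bits (\<sigma> r i) \<le> U + 3 * U * t \<or>
      bits (\<sigma> r i) \<le> mw_growth U"
    using assms(1) unfolding mw_bound_def by (cases "r \<in> {rCost, rBest, rX, rY, rK}") auto
  thus "bits (\<sigma> r i) \<le> mw_growth U" using le by (meson order.trans)
qed

definition mw_time :: "nat \<Rightarrow> nat" where
  "mw_time U = U * (fills_time mw_fills (mw_growth U) + cost_bound loop_cond (mw_growth U) + 1)
     + cost_bound loop_cond (mw_growth U) + 1"

lemma poly_bounded_mw_time: "poly_bounded (\<lambda>U. mw_time U)"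
  unfolding mw_time_def
  by (intro poly_bounded_intros poly_bounded_compose[OF poly_bounded_fills_time poly_bounded_mw_growth]
      poly_bounded_compose[OF poly_bounded_cost_bound poly_bounded_mw_growth])

context encoded
begin

abbreviation "mwX D t \<equiv> fst (mw n nrows D coef wgt t)"
abbreviation "mwY D t \<equiv> snd (mw n nrows D coef wgt t)"

definition mw_state :: "int \<Rightarrow> nat \<Rightarrow> arrays \<Rightarrow> bool" where
  "mw_state D t \<sigma> \<longleftrightarrow> base D \<sigma> \<and> (\<forall>i<n. \<sigma> rX i = mwX D t i) \<and> (\<forall>q<nrows. \<sigma> rY q = mwY D t q)"

lemma mw_body:
  assumes st: "mw_state D t \<sigma>" and n: "0 < n" and U: "nrows < U" "n < U"
    and bd: "mw_bound U t \<sigma>" and t: "t < U"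
  shows "mw_state D (Suc t) (fills_den mw_fills \<sigma>)" "fills_den mw_fills \<sigma> rK 0 = \<sigma> rK 0 - 1"
    "fills_ok U mw_fills \<sigma>" "mw_bound U (Suc t) (fills_den mw_fills \<sigma>)"
proof -
  note fs = get_cost_def get_best_def incr_X_def scale_Y_def decr_K_def
  note fills = mw_fills_def
  define s1 where "s1 = fill_den get_cost \<sigma>"
  define s2 where "s2 = fill_den get_best s1"
  define s3 where "s3 = fill_den incr_X s2"
  define s4 where "s4 = fill_den scale_Y s3"
  define s5 where "s5 = fill_den decr_K s4"
  have s5: "fills_den mw_fills \<sigma> = s5"
    by (simp add: fills s5_def s4_def s3_def s2_def s1_def)
  have keep: "r \<noteq> rCost \<Longrightarrow> s1 r = \<sigma> r" "r \<noteq> rBest \<Longrightarrow> s2 r = s1 r" "r \<noteq> rX \<Longrightarrow> s3 r = s2 r"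
    "r \<noteq> rY \<Longrightarrow> s4 r = s3 r" "r \<noteq> rK \<Longrightarrow> s5 r = s4 r" for r
    by (simp_all add: s1_def s2_def s3_def s4_def s5_def fill_den_other fs)
  have mn: "\<sigma> rM 0 = int m" "\<sigma> rN 0 = int n" "\<sigma> rD 0 = D"
    and W: "\<And>i. i < n \<Longrightarrow> \<sigma> rW i = wgt i"
    and A: "\<And>q i. q < nrows \<Longrightarrow> i < n \<Longrightarrow> \<sigma> rA (q * n + i) = coef q i"
    and X: "\<And>i. i < n \<Longrightarrow> \<sigma> rX i = mwX D t i"
    and Y: "\<And>q. q < nrows \<Longrightarrow> \<sigma> rY q = mwY D t q"
    using st by (auto simp: mw_state_def base_def)
  have nr: "2 * int m + int n = int nrows" by (simp add: nrows_def)
  define cost where "cost = mw_cost nrows coef (mwY D t)"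
  define b where "b = argmin_upto cost wgt n"
  have bn: "b < n" unfolding b_def by (rule argmin_upto_less[OF n])
  have v1: "s1 rCost i = (\<Sum>q<nrows. \<sigma> rY q * \<sigma> rA (q * n + i))" if "i < n" for i
    unfolding s1_def get_cost_def using that by (simp add: iter_SAdd[simplified] mn nr)
  have c1: "s1 rCost i = cost i" if "i < n" for i
    unfolding v1[OF that] cost_def mw_cost_def using that by (intro sum.cong) (auto simp: A Y)
  have it: "iter (step_ex best_step) s1 0 0 l = int (argmin_upto cost wgt l)" if "l \<le> n" for l
    using that
  proof (induction l)
    case (Suc l)
    have "argmin_upto cost wgt l < n" using argmin_upto_le[of cost wgt l] Suc.prems by simp
    thus ?case using Suc by (simp add: best_step_def c1 W keep)
  qed simp
  have v2: "s2 rBest 0 = int b"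
    unfolding s2_def get_best_def using it[of n] by (simp add: mn keep b_def)
  have v3: "s3 rX i = \<sigma> rX i + of_bool (i = b)" if "i < n" for i
    unfolding s3_def incr_X_def using that by (simp add: mn keep v2)
  have v4: "s4 rY q = \<sigma> rY q * (D * int n + \<sigma> rA (q * n + b))" if "q < nrows" for q
    unfolding s4_def scale_Y_def using that by (simp add: mn keep v2 nr)
  have v5: "s5 rK 0 = \<sigma> rK 0 - 1"
    unfolding s5_def decr_K_def by (simp add: keep)
  show "fills_den mw_fills \<sigma> rK 0 = \<sigma> rK 0 - 1" unfolding s5 by (rule v5)
  show "mw_state D (Suc t) (fills_den mw_fills \<sigma>)"
    unfolding s5 using st bn
    by (auto simp: mw_state_def base_def keep v3 v4 Let_def cost_def[symmetric] b_def[symmetric] X Y A)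
  show "fills_ok U mw_fills \<sigma>"
    unfolding fills fills_ok.simps s1_def[symmetric] s2_def[symmetric] s3_def[symmetric] s4_def[symmetric]
    using U n by (simp add: fs mn keep nr)
  have oth: "bits (\<sigma> r i) \<le> U" if "r \<notin> {rCost, rBest, rX, rY, rK}" for r i
    using bd that unfolding mw_bound_def by blast
  have bX: "bits (\<sigma> rX i) \<le> U + 2 * t" and bK: "bits (\<sigma> rK i) \<le> U + 2 * t"
    and bY: "bits (\<sigma> rY i) \<le> U + 3 * U * t" and bC: "bits (\<sigma> rCost i) \<le> mw_growth U"
    and bB: "bits (\<sigma> rBest i) \<le> mw_growth U" for i
    using bd unfolding mw_bound_def by blast+
  have bX': "bits (s5 rX i) \<le> U + 2 * Suc t" for i
  proof (cases "i < n")
    case True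
    thus ?thesis using bits_add[of "\<sigma> rX i" "of_bool (i = b)"] bits_of_bool[of "i = b"] bX[of i]
      by (simp add: keep v3 del: of_bool_eq_iff)
  next
    case False
    hence "s3 rX i = s2 rX i" by (simp add: s3_def incr_X_def keep mn)
    thus ?thesis using bX[of i] by (simp add: keep)
  qed
  have bK': "bits (s5 rK i) \<le> U + 2 * Suc t" for i
  proof (cases "i = 0")
    case True
    have "bits (1 :: int) \<le> 2" using bits_of_nat[of 1] by simp
    thus ?thesis using True bits_diff[of "\<sigma> rK 0" 1] bK[of 0] by (simp add: v5)
  next
    case False
    hence "s5 rK i = s4 rK i" by (simp add: s5_def decr_K_def keep)
    thus ?thesis using bK[of i] by (simp add: keep)
  qed
  have bY': "bits (s5 rY q) \<le> U + 3 * U * Suc t" for q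
  proof (cases "q < nrows")
    case True
    have "bits (D * int n + \<sigma> rA (q * n + b)) \<le> bits (\<sigma> rD 0) + bits (\<sigma> rN 0) + bits (\<sigma> rA (q * n + b))"
      using bits_add[of "D * int n" "\<sigma> rA (q * n + b)"] bits_mult[of D "int n"] by (simp add: mn)
    also have "\<dots> \<le> U + U + U" by (intro add_mono oth) auto
    finally show ?thesis using True bY[of q] bits_mult[of "\<sigma> rY q" "D * int n + \<sigma> rA (q * n + b)"]
      by (simp add: keep v4 algebra_simps)
  next
    case False
    hence "s4 rY q = s3 rY q" by (simp add: s4_def scale_Y_def keep mn nr)
    thus ?thesis using bY[of q] by (simp add: keep)
  qed
  have bC': "bits (s5 rCost i) \<le> mw_growth U" for i
  proof (cases "i < n")
    case True
    have "bits (s1 rCost i) \<le> 1 + nrows * (U + 3 * U * U + U)"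
      unfolding v1[OF True]
    proof (rule bits_sum)
      fix q
      have "bits (\<sigma> rY q * \<sigma> rA (q * n + i)) \<le> bits (\<sigma> rY q) + bits (\<sigma> rA (q * n + i))" by (rule bits_mult)
      also have "\<dots> \<le> (U + 3 * U * t) + U" by (intro add_mono bY oth) auto
      also have "\<dots> \<le> U + 3 * U * U + U" using t by simp
      finally show "bits (\<sigma> rY q * \<sigma> rA (q * n + i)) \<le> U + 3 * U * U + U" .
    qed
    also have "\<dots> \<le> 1 + U * (U + 3 * U * U + U)" using U by (intro add_mono mult_le_mono) auto
    also have "\<dots> \<le> mw_growth U" by (simp add: mw_growth_def algebra_simps)
    finally show ?thesis by (simp add: keep)
  next
    case False
    hence "s1 rCost i = \<sigma> rCost i" by (simp add: s1_def get_cost_def mn)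
    thus ?thesis using bC[of i] by (simp add: keep)
  qed
  have bB': "bits (s5 rBest i) \<le> mw_growth U" for i
  proof (cases "i = 0")
    case True
    have "bits (int b) \<le> mw_growth U" using bits_of_nat[of b] bn U by (simp add: mw_growth_def)
    thus ?thesis using True by (simp add: keep v2)
  next
    case False
    hence "s2 rBest i = s1 rBest i" by (simp add: s2_def get_best_def)
    thus ?thesis using bB[of i] by (simp add: keep)
  qed
  show "mw_bound U (Suc t) (fills_den mw_fills \<sigma>)"
    unfolding s5 mw_bound_def using bX' bK' bY' bC' bB' oth by (auto simp: keep)
qed

text \<open>The round count is itself below \<open>U\<close>, so \<open>mw_bound\<close> never
  exceeds \<open>mw_growth U\<close> and every round is charged at that one length. Without items
  \<open>T\<close> is 0 and the body is never entered.\<close>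

lemma mw_loop:
  assumes st: "mw_state D 0 \<sigma>" and T: "\<sigma> rK 0 = int T" "T < U" "0 < T \<Longrightarrow> 0 < n"
    and U: "nrows < U" "n < U" "arrays_bound U \<sigma>"
  shows "\<exists>\<sigma>'. runs (While loop_cond (fills_com mw_fills)) (mem_of \<sigma>) (mem_of \<sigma>') (mw_time U) \<and>
     arrays_bound (mw_growth U) \<sigma>' \<and> mw_state D T \<sigma>' \<and>
     (\<forall>r. r \<notin> {rCost, rBest, rX, rY, rK} \<longrightarrow> \<sigma>' r = \<sigma> r)"
proof -
  define \<sigma>s where "\<sigma>s t = (fills_den mw_fills ^^ t) \<sigma>" for t
  have step: "\<sigma>s (Suc t) = fills_den mw_fills (\<sigma>s t)" for t by (simp add: \<sigma>s_def)
  have mg: "U \<le> mw_growth U" by (simp add: mw_growth_def)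
  have inv: "mw_state D t (\<sigma>s t) \<and> mw_bound U t (\<sigma>s t) \<and> \<sigma>s t rK 0 = int T - int t" if "t \<le> T" for t
    using that
  proof (induction t)
    case 0
    show ?case using st U(3) T(1) mg
      by (auto simp: \<sigma>s_def mw_bound_def arrays_bound_def intro: order.trans[where b = U])
  next
    case (Suc t)
    hence "mw_state D t (\<sigma>s t)" "mw_bound U t (\<sigma>s t)" "\<sigma>s t rK 0 = int T - int t" "0 < n" "t < U"
      using T by auto
    thus ?case using mw_body[of D t "\<sigma>s t" U] U by (simp add: step)
  qed
  have ab: "arrays_bound (mw_growth U) (\<sigma>s t)" if "t \<le> T" for t
    using inv[OF that] that T by (intro mw_bound_arrays_bound) auto
  have run: "runs (While loop_cond (fills_com mw_fills)) (mem_of (\<sigma>s 0)) (mem_of (\<sigma>s T))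
    (T * (fills_time mw_fills (mw_growth U) + cost_bound loop_cond (mw_growth U) + 1)
      + cost_bound loop_cond (mw_growth U) + 1)"
  proof (rule runs_While)
    fix t assume t: "t < T"
    show "0 < aval loop_cond (mem_of (\<sigma>s t))" using inv[of t] t by (simp add: aval_loop_cond)
    have "fills_ok U mw_fills (\<sigma>s t)"
      using mw_body(3)[of D t "\<sigma>s t" U] inv[of t] t T U by auto
    hence "fills_ok (mw_growth U) mw_fills (\<sigma>s t)" using mg by (rule fills_ok_mono)
    thus "runs (fills_com mw_fills) (mem_of (\<sigma>s t)) (mem_of (\<sigma>s (Suc t))) (fills_time mw_fills (mw_growth U))"
      unfolding step using runs_fills[OF fills_wf(2)] ab t by simp
  next
    show "\<not> 0 < aval loop_cond (mem_of (\<sigma>s T))" using inv[of T] by (simp add: aval_loop_cond)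
    show "acost loop_cond (mem_of (\<sigma>s t)) \<le> cost_bound loop_cond (mw_growth U)" if "t \<le> T" for t
      by (intro acost_le mem_bound_mem_of ab that)
  qed
  have "\<sigma>s 0 = \<sigma>" by (simp add: \<sigma>s_def)
  hence "runs (While loop_cond (fills_com mw_fills)) (mem_of \<sigma>) (mem_of (\<sigma>s T)) (mw_time U)"
    using runs_mono[OF run, of "mw_time U"] T(2) unfolding mw_time_def
    by (simp only: add_le_mono mult_le_mono less_imp_le order_refl)
  moreover have "\<sigma>s t r = \<sigma> r" if "r \<notin> {rCost, rBest, rX, rY, rK}" for r t
    using that by (induction t) (simp_all add: \<sigma>s_def fills_den_other mw_fills_def get_cost_def get_best_def incr_X_def scale_Y_def decr_K_def)
  ultimately show ?thesis using inv[of T] ab[of T] by blast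
qed

end

subsection \<open>Coin flips\<close>

text \<open>The final time may depend on the coin flips, so only the distribution of the memory is
  prescribed, together with a worst-case time bound.\<close>

definition pruns :: "com \<Rightarrow> mem \<Rightarrow> mem pmf \<Rightarrow> nat \<Rightarrow> bool" where
  "pruns C M \<nu> \<tau> \<longleftrightarrow>
     (\<forall>t. \<exists>\<mu>. exec C (M, t) \<mu> \<and> map_pmf fst \<mu> = \<nu> \<and> (\<forall>s\<in>set_pmf \<mu>. snd s \<le> t + \<tau>))"

lemma runs_imp_pruns: "runs C M M' \<tau> \<Longrightarrow> pruns C M (return_pmf M') \<tau>"
  unfolding runs_def pruns_def
proof (intro allI)
  fix t assume "\<forall>t. \<exists>t'\<le>t + \<tau>. exec C (M, t) (return_pmf (M', t'))"
  then obtain t' where "t' \<le> t + \<tau>" "exec C (M, t) (return_pmf (M', t'))" by blast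
  thus "\<exists>\<mu>. exec C (M, t) \<mu> \<and> map_pmf fst \<mu> = return_pmf M' \<and> (\<forall>s\<in>set_pmf \<mu>. snd s \<le> t + \<tau>)"
    by (intro exI[of _ "return_pmf (M', t')"]) auto
qed

text \<open>\<open>f\<close> depends on the memory alone, an execution also on the time. A
  continuation is therefore chosen for each pair, and projecting to the memory removes the time
  again.\<close>

lemma pruns_bind_aux:
  assumes "map_pmf fst \<mu> = \<nu>" and le: "\<And>s. s \<in> set_pmf \<mu> \<Longrightarrow> snd s \<le> t'"
    and D: "\<And>M'. M' \<in> set_pmf \<nu> \<Longrightarrow> pruns D M' (f M') \<tau>'"
  obtains \<rho> where "\<And>s. s \<in> set_pmf \<mu> \<Longrightarrow> exec D s (\<rho> s)"
    "map_pmf fst (bind_pmf \<mu> \<rho>) = bind_pmf \<nu> f" "\<And>s. s \<in> set_pmf (bind_pmf \<mu> \<rho>) \<Longrightarrow> snd s \<le> t' + \<tau>'"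
proof -
  have "\<forall>s. \<exists>\<rho>. s \<in> set_pmf \<mu> \<longrightarrow> exec D s \<rho> \<and> map_pmf fst \<rho> = f (fst s) \<and> (\<forall>s'\<in>set_pmf \<rho>. snd s' \<le> snd s + \<tau>')"
  proof
    fix s
    show "\<exists>\<rho>. s \<in> set_pmf \<mu> \<longrightarrow> exec D s \<rho> \<and> map_pmf fst \<rho> = f (fst s) \<and> (\<forall>s'\<in>set_pmf \<rho>. snd s' \<le> snd s + \<tau>')"
    proof (cases "s \<in> set_pmf \<mu>")
      case True
      hence "fst s \<in> set_pmf \<nu>" using assms(1) by auto
      from D[OF this, unfolded pruns_def, rule_format, of "snd s"] show ?thesis by auto
    qed simp
  qed
  then obtain \<rho> where \<rho>: "\<And>s. s \<in> set_pmf \<mu> \<Longrightarrow>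
      exec D s (\<rho> s) \<and> map_pmf fst (\<rho> s) = f (fst s) \<and> (\<forall>s'\<in>set_pmf (\<rho> s). snd s' \<le> snd s + \<tau>')"
    by metis
  show thesis
  proof (rule that)
    show "exec D s (\<rho> s)" if "s \<in> set_pmf \<mu>" for s using \<rho>[OF that] by blast
    have "map_pmf fst (bind_pmf \<mu> \<rho>) = bind_pmf \<mu> (\<lambda>s. map_pmf fst (\<rho> s))" by (simp add: map_bind_pmf)
    also have "\<dots> = bind_pmf \<mu> (\<lambda>s. f (fst s))" using \<rho> by (intro bind_pmf_cong) auto
    also have "\<dots> = bind_pmf \<nu> f" unfolding assms(1)[symmetric] by (simp add: bind_map_pmf)
    finally show "map_pmf fst (bind_pmf \<mu> \<rho>) = bind_pmf \<nu> f" .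
    show "snd s \<le> t' + \<tau>'" if "s \<in> set_pmf (bind_pmf \<mu> \<rho>)" for s
    proof -
      obtain s0 where s0: "s0 \<in> set_pmf \<mu>" "s \<in> set_pmf (\<rho> s0)" using \<open>s \<in> set_pmf (bind_pmf \<mu> \<rho>)\<close> by auto
      have "snd s \<le> snd s0 + \<tau>'" using \<rho>[OF s0(1)] s0(2) by blast
      thus ?thesis using le[OF s0(1)] by simp
    qed
  qed
qed

lemma pruns_Seq:
  assumes C: "pruns C M \<nu> \<tau>" and D: "\<And>M'. M' \<in> set_pmf \<nu> \<Longrightarrow> pruns D M' (f M') \<tau>'"
  shows "pruns (Seq C D) M (bind_pmf \<nu> f) (\<tau> + \<tau>')"
  unfolding pruns_def
proof (intro allI)
  fix t
  obtain \<mu> where \<mu>: "exec C (M, t) \<mu>" "map_pmf fst \<mu> = \<nu>" "\<And>s. s \<in> set_pmf \<mu> \<Longrightarrow> snd s \<le> t + \<tau>"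
    using C unfolding pruns_def by blast
  obtain \<rho> where \<rho>: "\<And>s. s \<in> set_pmf \<mu> \<Longrightarrow> exec D s (\<rho> s)"
    "map_pmf fst (bind_pmf \<mu> \<rho>) = bind_pmf \<nu> f" "\<And>s. s \<in> set_pmf (bind_pmf \<mu> \<rho>) \<Longrightarrow> snd s \<le> t + \<tau> + \<tau>'"
    using pruns_bind_aux[OF \<mu>(2,3) D] by blast
  have "exec (Seq C D) (M, t) (bind_pmf \<mu> \<rho>)" using \<mu>(1) \<rho>(1) by (rule exec.Seq)
  thus "\<exists>\<mu>. exec (Seq C D) (M, t) \<mu> \<and> map_pmf fst \<mu> = bind_pmf \<nu> f \<and> (\<forall>s\<in>set_pmf \<mu>. snd s \<le> t + (\<tau> + \<tau>'))"
    using \<rho>(2,3) by (intro exI[of _ "bind_pmf \<mu> \<rho>"]) (auto simp: add.assoc)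
qed

lemma pruns_While_step:
  assumes b: "0 < aval b M" "acost b M \<le> c" and C: "pruns C M \<nu> \<tau>"
    and D: "\<And>M'. M' \<in> set_pmf \<nu> \<Longrightarrow> pruns (While b C) M' (f M') \<tau>'"
  shows "pruns (While b C) M (bind_pmf \<nu> f) (c + 1 + \<tau> + \<tau>')"
  unfolding pruns_def
proof (intro allI)
  fix t
  let ?t = "t + acost b M + 1"
  obtain \<mu> where \<mu>: "exec C (M, ?t) \<mu>" "map_pmf fst \<mu> = \<nu>" "\<And>s. s \<in> set_pmf \<mu> \<Longrightarrow> snd s \<le> ?t + \<tau>"
    using C unfolding pruns_def by blast
  obtain \<rho> where \<rho>: "\<And>s. s \<in> set_pmf \<mu> \<Longrightarrow> exec (While b C) s (\<rho> s)"
    "map_pmf fst (bind_pmf \<mu> \<rho>) = bind_pmf \<nu> f" "\<And>s. s \<in> set_pmf (bind_pmf \<mu> \<rho>) \<Longrightarrow> snd s \<le> ?t + \<tau> + \<tau>'"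
    using pruns_bind_aux[OF \<mu>(2,3) D] by blast
  have ex: "exec (While b C) (M, t) (bind_pmf \<mu> \<rho>)" using b(1) \<mu>(1) \<rho>(1) by (rule exec.While_True)
  have "snd s \<le> t + (c + 1 + \<tau> + \<tau>')" if "s \<in> set_pmf (bind_pmf \<mu> \<rho>)" for s
    using \<rho>(3)[OF that] b(2) by linarith
  thus "\<exists>\<mu>. exec (While b C) (M, t) \<mu> \<and> map_pmf fst \<mu> = bind_pmf \<nu> f \<and> (\<forall>s\<in>set_pmf \<mu>. snd s \<le> t + (c + 1 + \<tau> + \<tau>'))"
    using ex \<rho>(2) by (intro exI[of _ "bind_pmf \<mu> \<rho>"]) blast
qed

lemma pruns_While_stop:
  assumes "\<not> 0 < aval b M" "acost b M \<le> c"
  shows "pruns (While b C) M (return_pmf M) (c + 1)"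
proof -
  have "exec (While b C) (M, t) (return_pmf (M, t + acost b M + 1))" for t
    using assms(1) by (rule exec.While_False)
  hence "runs (While b C) M M (c + 1)"
    unfolding runs_def using assms(2) by (metis add.assoc add_le_mono le_refl)
  thus ?thesis by (rule runs_imp_pruns)
qed

lemma pruns_mono: "pruns C M \<nu> \<tau> \<Longrightarrow> \<tau> \<le> \<tau>' \<Longrightarrow> pruns C M \<nu> \<tau>'"
  unfolding pruns_def by (meson add_left_mono order_trans)

lemma pruns_Flip:
  assumes "mem_bound U M"
  shows "pruns (Flip a) M (map_pmf (\<lambda>h. M(aval a M := of_bool h)) (bernoulli_pmf (1 / 2)))
    (cost_bound a U + val_bound a U + 1)"
  unfolding pruns_def
proof (intro allI)
  fix t
  have "exec (Flip a) (M, t) (map_pmf (\<lambda>h. (M(aval a M := of_bool h), t + acost a M + bits (aval a M) + 1))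
        (bernoulli_pmf (1 / 2)))" by (rule exec.Flip)
  moreover have "t + acost a M + bits (aval a M) + 1 \<le> t + (cost_bound a U + val_bound a U + 1)"
    using acost_le[OF assms, of a] bits_aval[OF assms, of a] by simp
  ultimately show "\<exists>\<mu>. exec (Flip a) (M, t) \<mu> \<and>
      map_pmf fst \<mu> = map_pmf (\<lambda>h. M(aval a M := of_bool h)) (bernoulli_pmf (1 / 2)) \<and>
      (\<forall>s\<in>set_pmf \<mu>. snd s \<le> t + (cost_bound a U + val_bound a U + 1))"
    by (intro exI conjI) (auto simp: pmf.map_comp o_def)
qed

text \<open>The fair bit becomes the leading digit: pairs of a bit and a number below
  \<open>K\<close> are in bijection with the numbers below \<open>2 * K\<close>.\<close>

lemma pmf_of_set_double:
  assumes "0 < K"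
  shows "bind_pmf (bernoulli_pmf (1 / 2)) (\<lambda>h. map_pmf (\<lambda>u. of_bool h * K + u) (pmf_of_set {..<K}))
    = pmf_of_set {..<2 * K :: nat}"
proof -
  define g :: "bool \<times> nat \<Rightarrow> nat" where "g = (\<lambda>(h, u). of_bool h * K + u)"
  have bij: "bij_betw g (UNIV \<times> {..<K}) {..<2 * K}"
    by (rule bij_betw_byWitness[where f' = "\<lambda>v. (K \<le> v, if K \<le> v then v - K else v)"])
       (auto simp: g_def split: if_splits)
  have "bind_pmf (bernoulli_pmf (1 / 2)) (\<lambda>h. map_pmf (\<lambda>u. of_bool h * K + u) (pmf_of_set {..<K}))
      = map_pmf g (pair_pmf (pmf_of_set UNIV) (pmf_of_set {..<K}))"
    by (simp add: bernoulli_pmf_half_conv_pmf_of_set pair_pmf_def map_pmf_def bind_assoc_pmf bind_return_pmf g_def)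
  also have "pair_pmf (pmf_of_set (UNIV :: bool set)) (pmf_of_set {..<K}) = pmf_of_set (UNIV \<times> {..<K})"
  proof (rule pmf_eqI)
    fix x :: "bool \<times> nat"
    have ne: "{..<K} \<noteq> {}" using assms by auto
    show "pmf (pair_pmf (pmf_of_set UNIV) (pmf_of_set {..<K})) x = pmf (pmf_of_set (UNIV \<times> {..<K})) x"
      using ne by (cases x) (simp add: pmf_pair pmf_of_set card_cartesian_product indicator_def)
  qed
  also have "map_pmf g \<dots> = pmf_of_set {..<2 * K}"
    using assms by (intro map_pmf_of_set_bij_betw[OF bij]) auto
  finally show ?thesis .
qed

definition arrays_of :: "mem \<Rightarrow> arrays" where
  "arrays_of M r i = M (addr r i)"

lemma arrays_of_mem_of [simp]: "arrays_of (mem_of \<sigma>) = \<sigma>"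
  by (auto simp: arrays_of_def fun_eq_iff)

definition coin_state :: "arrays \<Rightarrow> nat \<Rightarrow> nat \<Rightarrow> arrays" where
  "coin_state \<sigma> v k = \<sigma>(rV := (\<sigma> rV)(0 := int v), rK := (\<sigma> rK)(0 := int k))"

definition coin_time :: "nat \<Rightarrow> nat" where
  "coin_time U = cost_bound loop_cond U + 1 + (cost_bound (addr_exp rCoin (Const 0)) U +
     val_bound (addr_exp rCoin (Const 0)) U + 1 + fills_time coin_fills U)"

lemma poly_bounded_coin_time: "poly_bounded (\<lambda>U. coin_time U)"
  unfolding coin_time_def by (intro poly_bounded_intros poly_bounded_fills_time)

lemma fill_den_scalar:
  "fill_den (Fill r (N 1) (N 0) init s) \<sigma> = \<sigma>(r := (\<sigma> r)(0 := ev init 0 0 (\<sigma> r 0) \<sigma>))"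
  by (auto simp: fun_eq_iff)

lemma coin_fills_den:
  assumes "\<sigma> rCoin 0 = 0"
  shows "fills_den coin_fills ((coin_state \<sigma> v (Suc k))(rCoin := (\<sigma> rCoin)(0 := of_bool h)))
    = coin_state \<sigma> (2 * v + of_bool h) k"
  using assms by (auto simp: coin_fills_def fill_den_scalar coin_state_def fun_eq_iff)

lemma coin_fills_ok: "1 < U \<Longrightarrow> fills_ok U coin_fills \<sigma>"
  by (simp add: coin_fills_def)

text \<open>\<open>j\<close> flips are done and \<open>k\<close> remain: \<open>v\<close> is the
  known prefix, and the remaining flips fill the low \<open>k\<close> digits uniformly. The sum
  \<open>j + k\<close> is invariant and keeps both written cells within \<open>U\<close>
  bits.\<close>

lemma coin_loop:
  assumes coin: "\<sigma> rCoin 0 = 0" and U: "arrays_bound U \<sigma>" "1 < U" and "j + k < U" "v < 2 ^ j"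
  shows "pruns (While loop_cond coin_body) (mem_of (coin_state \<sigma> v k))
    (map_pmf (\<lambda>u. mem_of (coin_state \<sigma> (v * 2 ^ k + u) 0)) (pmf_of_set {..<2 ^ k}))
    (k * coin_time U + cost_bound loop_cond U + 1)"
  using assms(4,5)
proof (induction k arbitrary: j v)
  have bnd: "arrays_bound U (coin_state \<sigma> v k)" if "j + k < U" "v < 2 ^ j" for j v k
  proof -
    have "bits (int v) \<le> Suc j" using that by (simp add: bits_le_iff)
    moreover have "bits (int k) \<le> Suc k" using bits_of_nat[of k] by simp
    ultimately show ?thesis using U that by (auto simp: arrays_bound_def coin_state_def)
  qed
  have cK: "coin_state \<sigma> v k rK 0 = int k" for v k by (simp add: coin_state_def)
  {
    case 0
    have "pruns (While loop_cond coin_body) (mem_of (coin_state \<sigma> v 0)) (return_pmf (mem_of (coin_state \<sigma> v 0)))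
        (cost_bound loop_cond U + 1)"
      using bnd[OF 0] by (intro pruns_While_stop acost_le mem_bound_mem_of) (simp_all add: aval_loop_cond cK)
    thus ?case by (simp add: lessThan_Suc pmf_of_set_singleton)
  next
    case (Suc k)
    let ?\<sigma> = "coin_state \<sigma> v (Suc k)"
    have b: "arrays_bound U ?\<sigma>" using bnd[OF Suc.prems] .
    note mb = mem_bound_mem_of[OF b]
    define \<nu> where "\<nu> = bind_pmf (bernoulli_pmf (1 / 2)) (\<lambda>h. return_pmf (mem_of (coin_state \<sigma> (2 * v + of_bool h) k)))"
    have flip: "(mem_of ?\<sigma>)(aval (addr_exp rCoin (Const 0)) (mem_of ?\<sigma>) := of_bool h)
        = mem_of (?\<sigma>(rCoin := (\<sigma> rCoin)(0 := of_bool h)))" for h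
      by (simp add: mem_of_upd) (simp add: coin_state_def)
    have body: "pruns coin_body (mem_of ?\<sigma>) \<nu> (cost_bound (addr_exp rCoin (Const 0)) U +
        val_bound (addr_exp rCoin (Const 0)) U + 1 + fills_time coin_fills U)"
    proof -
      define F where "F M = mem_of (fills_den coin_fills (arrays_of M))" for M
      have ab: "arrays_bound U (?\<sigma>(rCoin := (\<sigma> rCoin)(0 := of_bool h)))" for h
        using b U bits_of_bool[of h] arrays_boundD[OF U(1)] by (auto simp: arrays_bound_def intro: order.trans[of _ 2])
      have F: "F (mem_of (?\<sigma>(rCoin := (\<sigma> rCoin)(0 := of_bool h)))) = mem_of (coin_state \<sigma> (2 * v + of_bool h) k)" for h
        unfolding F_def using coin_fills_den[where \<sigma> = \<sigma>, OF coin] by simp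
      have "pruns coin_body (mem_of ?\<sigma>)
        (bind_pmf (map_pmf (\<lambda>h. (mem_of ?\<sigma>)(aval (addr_exp rCoin (Const 0)) (mem_of ?\<sigma>) := of_bool h)) (bernoulli_pmf (1 / 2)))
          (\<lambda>M. return_pmf (F M)))
        (cost_bound (addr_exp rCoin (Const 0)) U + val_bound (addr_exp rCoin (Const 0)) U + 1 + fills_time coin_fills U)"
        unfolding coin_body_def
      proof (rule pruns_Seq[OF pruns_Flip[OF mb]])
        fix M' assume "M' \<in> set_pmf (map_pmf (\<lambda>h. (mem_of ?\<sigma>)(aval (addr_exp rCoin (Const 0)) (mem_of ?\<sigma>) := of_bool h)) (bernoulli_pmf (1 / 2)))"
        then obtain h where M': "M' = mem_of (?\<sigma>(rCoin := (\<sigma> rCoin)(0 := of_bool h)))"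
          by (auto simp: flip simp del: aval_addr_exp)
        show "pruns (fills_com coin_fills) M' (return_pmf (F M')) (fills_time coin_fills U)"
          unfolding M' F coin_fills_den[where \<sigma> = \<sigma>, OF coin, symmetric]
          using runs_fills[OF fills_wf(4) coin_fills_ok[OF U(2)] ab] by (intro runs_imp_pruns) auto
      qed
      thus ?thesis unfolding \<nu>_def by (simp add: flip F bind_map_pmf del: aval_addr_exp)
    qed
    \<comment> \<open>The continuation must be a function of the memory, so the prefix is read back
      from \<open>rV\<close>.\<close>
    define f where "f M = map_pmf (\<lambda>u. mem_of (coin_state \<sigma> (nat (arrays_of M rV 0) * 2 ^ k + u) 0)) (pmf_of_set {..<2 ^ k})" for M
    have f: "f (mem_of (coin_state \<sigma> v' k)) = map_pmf (\<lambda>u. mem_of (coin_state \<sigma> (v' * 2 ^ k + u) 0)) (pmf_of_set {..<2 ^ k})" for v'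
    proof -
      have "coin_state \<sigma> v' k rV 0 = int v'" by (simp add: coin_state_def)
      thus ?thesis unfolding f_def by simp
    qed
    have "pruns (While loop_cond coin_body) (mem_of ?\<sigma>) (bind_pmf \<nu> f)
       (cost_bound loop_cond U + 1 + (cost_bound (addr_exp rCoin (Const 0)) U +
        val_bound (addr_exp rCoin (Const 0)) U + 1 + fills_time coin_fills U) + (k * coin_time U + cost_bound loop_cond U + 1))"
    proof (rule pruns_While_step[OF _ _ body])
      show "0 < aval loop_cond (mem_of ?\<sigma>)" by (simp add: aval_loop_cond cK)
      show "acost loop_cond (mem_of ?\<sigma>) \<le> cost_bound loop_cond U" by (rule acost_le[OF mb])
    next
      fix M' assume "M' \<in> set_pmf \<nu>"
      then obtain h where M': "M' = mem_of (coin_state \<sigma> (2 * v + of_bool h) k)" by (auto simp: \<nu>_def)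
      have "2 * v + of_bool h < 2 ^ Suc j" using Suc.prems by (cases h) auto
      thus "pruns (While loop_cond coin_body) M' (f M') (k * coin_time U + cost_bound loop_cond U + 1)"
        unfolding M' f using Suc.prems by (intro Suc.IH[of "Suc j"]) auto
    qed
    also have "bind_pmf \<nu> f = bind_pmf (bernoulli_pmf (1 / 2)) (\<lambda>h. map_pmf (\<lambda>u. mem_of (coin_state \<sigma> ((2 * v + of_bool h) * 2 ^ k + u) 0)) (pmf_of_set {..<2 ^ k}))"
      unfolding \<nu>_def bind_assoc_pmf bind_return_pmf f ..
    also have "\<dots> = map_pmf (\<lambda>u. mem_of (coin_state \<sigma> (v * 2 ^ Suc k + u) 0))
        (bind_pmf (bernoulli_pmf (1 / 2)) (\<lambda>h. map_pmf (\<lambda>u. of_bool h * 2 ^ k + u) (pmf_of_set {..<2 ^ k})))"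
      by (simp add: map_bind_pmf pmf.map_comp o_def algebra_simps)
    also have "\<dots> = map_pmf (\<lambda>u. mem_of (coin_state \<sigma> (v * 2 ^ Suc k + u) 0)) (pmf_of_set {..<2 ^ Suc k})"
      by (subst pmf_of_set_double) auto
    finally show ?case by (rule pruns_mono) (simp add: coin_time_def)
  }
qed

subsection \<open>Selecting the items\<close>

context encoded
begin

text \<open>Enough digits that rounding the probabilities of all \<open>n\<close> items up to
  multiples of \<open>1 / 2 ^ nbits\<close> adds at most 1 / D^2 in total.\<close>

definition nbits :: nat where "nbits = n + 2 * m + 20"

lemma base_cong:
  assumes "base D \<sigma>" "\<And>r. r \<in> {rM, rN, rB, rD, rW, rA} \<Longrightarrow> \<sigma>' r = \<sigma> r"
  shows "base D \<sigma>'"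
  using assms by (simp add: base_def)

lemma mid_fills_den:
  assumes st: "mw_state D T \<sigma>" and U: "nrows < U" "n < U" "1 < U"
  defines "\<sigma>' \<equiv> fills_den mid_fills \<sigma>"
  shows "base D \<sigma>'" "\<And>i. i < n \<Longrightarrow> \<sigma>' rX i = mwX D T i" "\<sigma>' rK 0 = int (n * nbits)"
    "\<And>q. q < nrows \<Longrightarrow> (\<Sum>i<n. coef q i * mwX D T i) \<le> \<sigma>' rLam 0"
    "\<sigma>' rLam 0 = 0 \<or> (\<exists>q<nrows. (\<Sum>i<n. coef q i * mwX D T i) = \<sigma>' rLam 0)"
    "fills_ok U mid_fills \<sigma>"
proof -
  note fs = get_rowsum_def get_lam_def init_flips_def
  note fills = mid_fills_def
  define s1 where "s1 = fill_den get_rowsum \<sigma>"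
  define s2 where "s2 = fill_den get_lam s1"
  define s3 where "s3 = fill_den init_flips s2"
  have s3: "\<sigma>' = s3" by (simp add: \<sigma>'_def fills s3_def s2_def s1_def)
  have keep: "r \<noteq> rLd \<Longrightarrow> s1 r = \<sigma> r" "r \<noteq> rLam \<Longrightarrow> s2 r = s1 r" "r \<noteq> rK \<Longrightarrow> s3 r = s2 r" for r
    by (simp_all add: s1_def s2_def s3_def fill_den_other fs)
  have mn: "\<sigma> rM 0 = int m" "\<sigma> rN 0 = int n"
    and A: "\<And>q i. q < nrows \<Longrightarrow> i < n \<Longrightarrow> \<sigma> rA (q * n + i) = coef q i"
    and X: "\<And>i. i < n \<Longrightarrow> \<sigma> rX i = mwX D T i" and b: "base D \<sigma>"
    using st by (auto simp: mw_state_def base_def)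
  have nr: "2 * int m + int n = int nrows" by (simp add: nrows_def)
  show "base D \<sigma>'" unfolding s3 by (rule base_cong[OF b]) (auto simp: keep)
  show "\<sigma>' rX i = mwX D T i" if "i < n" for i unfolding s3 using that by (simp add: keep X)
  show "\<sigma>' rK 0 = int (n * nbits)"
    unfolding s3 s3_def init_flips_def by (simp add: keep mn nbits_def)
  have v1: "s1 rLd q = (\<Sum>i<n. coef q i * mwX D T i)" if "q < nrows" for q
    unfolding s1_def get_rowsum_def using that by (simp add: iter_SAdd[simplified] mn nr A X)
  have step: "ev (step_ex lam_step) 0 (int l) a s1 = max a (\<Sum>i<n. coef l i * mwX D T i)" if "l < nrows" for l a
    unfolding lam_step_def using that by (simp add: v1 max_def)
  have "s2 rLam 0 = iter (step_ex lam_step) s1 0 0 nrows"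
    unfolding s2_def get_lam_def by (simp add: keep mn nr)
  hence lam: "\<sigma>' rLam 0 = iter (step_ex lam_step) s1 0 0 nrows" unfolding s3 by (simp add: keep)
  show "(\<Sum>i<n. coef q i * mwX D T i) \<le> \<sigma>' rLam 0" if "q < nrows" for q
    unfolding lam using iter_max(2)[OF step] that by simp
  show "\<sigma>' rLam 0 = 0 \<or> (\<exists>q<nrows. (\<Sum>i<n. coef q i * mwX D T i) = \<sigma>' rLam 0)"
  proof -
    have "iter (step_ex lam_step) s1 0 0 nrows = 0 \<or>
        (\<exists>l<nrows. iter (step_ex lam_step) s1 0 0 nrows = (\<Sum>i<n. coef l i * mwX D T i))"
      by (rule iter_max(3)[OF step])
    thus ?thesis unfolding lam by metis
  qed
  show "fills_ok U mid_fills \<sigma>"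
    unfolding fills fills_ok.simps s1_def[symmetric] s2_def[symmetric] using U by (simp add: fs keep mn nr)
qed

lemma post_fills_den:
  assumes b: "base D \<sigma>" and V: "\<sigma> rV 0 = int V" and L: "\<sigma> rLam 0 = L"
    and X: "\<And>i. i < n \<Longrightarrow> \<sigma> rX i = X i"
    and sz: "\<And>j i. j < m \<Longrightarrow> i < n \<Longrightarrow> 0 \<le> sz j i"
    and U: "n < U" "m < U" "m * n < U" "nbits < U" "1 < U"
  shows "\<And>i. i < n \<Longrightarrow> fills_den post_fills \<sigma> 0 i =
      of_bool (rounding.kept n m (2 ^ nbits) sz cp (\<lambda>i d. int d * L * D < int n * X i * 2 ^ nbits) V i)"
    and "fills_ok U post_fills \<sigma>"
proof -
  interpret rounding n m "2 ^ nbits" sz cp "\<lambda>i d. int d * L * D < int n * X i * 2 ^ nbits"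
    by unfold_locales (simp_all add: sz)
  note fs = get_Q_def get_pow_def get_sel_def get_load_def get_keep_def get_out_def
  note fills = post_fills_def
  define s1 where "s1 = fill_den get_Q \<sigma>"
  define s2 where "s2 = fill_den get_pow s1"
  define s3 where "s3 = fill_den get_sel s2"
  define s4 where "s4 = fill_den get_load s3"
  define s5 where "s5 = fill_den get_keep s4"
  define s6 where "s6 = fill_den get_out s5"
  have s6: "fills_den post_fills \<sigma> = s6" by (simp add: fills s6_def s5_def s4_def s3_def s2_def s1_def)
  have keep: "r \<noteq> rQ \<Longrightarrow> s1 r = \<sigma> r" "r \<noteq> rPw \<Longrightarrow> s2 r = s1 r" "r \<noteq> rSel \<Longrightarrow> s3 r = s2 r"
    "r \<noteq> rLoad \<Longrightarrow> s4 r = s3 r" "r \<noteq> rKeep \<Longrightarrow> s5 r = s4 r" "r \<noteq> 0 \<Longrightarrow> s6 r = s5 r" for r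
    by (simp_all add: s1_def s2_def s3_def s4_def s5_def s6_def fill_den_other fs)
  have mn: "\<sigma> rM 0 = int m" "\<sigma> rN 0 = int n" "\<sigma> rD 0 = D" and B: "\<And>l. l < tot \<Longrightarrow> \<sigma> rB l = num l"
    using b by (auto simp: base_def)
  have nb: "nat (int n + 2 * int m + 20) = nbits" "int n + 2 * int m + 20 = int nbits"
    by (simp_all add: nbits_def nat_add_distrib nat_mult_distrib)
  have v1: "s1 rQ 0 = 2 ^ nbits"
    unfolding s1_def get_Q_def by (simp add: iter_SMul[simplified] mn nb)
  have v2: "s2 rPw i = (2 ^ nbits) ^ i" if "i < n" for i
    unfolding s2_def get_pow_def using that by (simp add: iter_SMul[simplified] mn keep v1)
  have v3: "s3 rSel i = of_bool (sel V i)" if "i < n" for i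
  proof -
    have z: "int V div (2 ^ nbits) ^ i mod 2 ^ nbits = int (V div (2 ^ nbits) ^ i mod 2 ^ nbits)"
      by (simp add: zdiv_int zmod_int)
    have "s3 rSel i = of_bool ((int V div (2 ^ nbits) ^ i mod 2 ^ nbits) * L * D < int n * X i * 2 ^ nbits)"
      unfolding s3_def get_sel_def using that
      by (simp add: Let_def mn keep v1 v2 V L X minus_mult_div_eq_mod)
    thus ?thesis unfolding z sel_def .
  qed
  define ld where "ld j i = (\<Sum>i'<n. if sel V i' \<and> sz j i \<le> sz j i' then sz j i' else 0)" for j i
  have v4: "s4 rLoad (j * n + i) = ld j i" if j: "j < m" and i: "i < n" for j i
  proof -
    have "int (j * n + i) < int (m * n)" using cell_less[OF j i] by (simp only: of_nat_less_iff)
    hence len: "int j * int n + int i < int m * int n" by simp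
    have dv: "(int j * int n + int i) div int n = int j"
      using i by (simp flip: of_nat_mult of_nat_add zdiv_int)
    have own: "\<sigma> rB (n + m + (j * n + i)) = sz j i" if "i < n" for i
      using B tot_less(3)[OF j that] by (simp add: sz_def)
    have "s4 rLoad (j * n + i) = (\<Sum>l<n. of_bool (sel V l) * ((1 - of_bool (sz j l < sz j i)) * sz j l))"
      unfolding s4_def get_load_def using len i own
      by (simp add: Let_def iter_SAdd[simplified] mn keep dv v3)
    also have "\<dots> = ld j i" unfolding ld_def by (intro sum.cong) auto
    finally show ?thesis .
  qed
  have v5: "s5 rKeep i = of_bool (kept V i)" if i: "i < n" for i
  proof -
    have step: "ev (step_ex keep_step) (int i) (int l) a s4 = (if 0 < sz l i \<and> cp l < ld l i then 0 else a)"
      if "l < m" for l a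
      unfolding keep_step_def using that i tot_less by (simp add: keep mn B v4 sz_def cp_def)
    have "s5 rKeep i = iter (step_ex keep_step) s4 (int i) (of_bool (sel V i)) m"
      unfolding s5_def get_keep_def using i by (simp add: keep mn v3)
    also have "\<dots> = (if \<exists>l<m. 0 < sz l i \<and> cp l < ld l i then 0 else of_bool (sel V i))"
      by (rule iter_clear[OF step])
    also have "\<dots> = of_bool (kept V i)"
    proof -
      have "0 < sz l i \<and> cp l < ld l i \<longleftrightarrow> \<not> (sz l i = 0 \<or> ld l i \<le> cp l)" if "l < m" for l
        using sz[OF that i] by auto
      hence "(\<exists>l<m. 0 < sz l i \<and> cp l < ld l i) \<longleftrightarrow> \<not> (\<forall>l<m. sz l i = 0 \<or> ld l i \<le> cp l)" by blast
      moreover have "kept V i \<longleftrightarrow> sel V i \<and> (\<forall>l<m. sz l i = 0 \<or> ld l i \<le> cp l)"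
        unfolding kept_def ld_def ..
      ultimately show ?thesis by simp
    qed
    finally show ?thesis .
  qed
  show "fills_den post_fills \<sigma> 0 i = of_bool (kept V i)" if "i < n" for i
    unfolding s6 s6_def get_out_def using that by (simp add: keep mn v5)
  have mnU: "int m * int n < int U" using U(3) by (simp flip: of_nat_mult)
  show "fills_ok U post_fills \<sigma>"
    unfolding fills fills_ok.simps s1_def[symmetric] s2_def[symmetric] s3_def[symmetric] s4_def[symmetric] s5_def[symmetric]
    using U mnU by (auto simp: fs keep mn nb Let_def)
qed

end

subsection \<open>Expected weight of the output\<close>

text \<open>The admissible d are naturals up to y / K; counting 0 as well gives the extra 1, an
  excess of 1 / Q in the sampling probability.\<close>

lemma card_mult_less_le:
  fixes K y :: int
  assumes "0 < K" "0 \<le> y"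
  shows "real (card {d. d < Q \<and> int d * K < y}) \<le> y / K + 1"
proof -
  have "{d. d < Q \<and> int d * K < y} \<subseteq> {..nat (y div K)}"
  proof
    fix d assume "d \<in> {d. d < Q \<and> int d * K < y}"
    hence "int d * K \<le> y" by simp
    hence "int d \<le> y div K" using assms(1) zdiv_mono1[of "int d * K" y K] by simp
    thus "d \<in> {..nat (y div K)}" by simp
  qed
  hence "card {d. d < Q \<and> int d * K < y} \<le> card {..nat (y div K)}" by (intro card_mono) auto
  hence "real (card {d. d < Q \<and> int d * K < y}) \<le> real (nat (y div K)) + 1" by simp
  also have "real (nat (y div K)) = real_of_int (y div K)" using assms by (simp add: pos_imp_zdiv_nonneg_iff)
  also have "\<dots> \<le> y / K" by (rule real_of_int_div4)
  finally show ?thesis by simp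
qed

text \<open>\<open>y \<le> K * int Q\<close> keeps the ceiling of y / K within the range of digits,
  so the cut at \<open>Q\<close> loses nothing.\<close>

lemma card_mult_less_ge:
  fixes K y :: int
  assumes "0 < K" "y \<le> K * int Q"
  shows "y / K \<le> real (card {d. d < Q \<and> int d * K < y})"
proof -
  have "y / K \<le> real Q"
  proof -
    have "real_of_int y \<le> real_of_int (K * int Q)" using assms(2) by (simp only: of_int_le_iff)
    thus ?thesis using assms(1) by (simp add: divide_le_eq mult.commute)
  qed
  hence "\<lceil>y / K\<rceil> \<le> int Q" by (simp add: ceiling_le_iff)
  hence "{..<nat \<lceil>y / K\<rceil>} \<subseteq> {d. d < Q \<and> int d * K < y}"
  proof (intro subsetI)
    fix d assume Q: "\<lceil>y / K\<rceil> \<le> int Q" and "d \<in> {..<nat \<lceil>y / K\<rceil>}"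
    hence d: "int d < \<lceil>y / K\<rceil>" by auto
    hence "real d < y / K" by (simp add: less_ceiling_iff)
    hence "real d * K < y" using assms(1) by (simp add: pos_less_divide_eq)
    hence "real_of_int (int d * K) < real_of_int y" by simp
    hence "int d * K < y" by (simp only: of_int_less_iff)
    thus "d \<in> {d. d < Q \<and> int d * K < y}" using d Q by simp
  qed
  hence "card {..<nat \<lceil>y / K\<rceil>} \<le> card {d. d < Q \<and> int d * K < y}" by (intro card_mono) auto
  hence "real (nat \<lceil>y / K\<rceil>) \<le> real (card {d. d < Q \<and> int d * K < y})" by simp
  moreover have "y / K \<le> real (nat \<lceil>y / K\<rceil>)" by linarith
  ultimately show ?thesis by linarith
qed

context encoded
begin

lemma D_le: "is_D D \<Longrightarrow> D \<le> int m + 1000"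
proof -
  have "cnt i \<le> int m" for i
    unfolding cnt_def using sum_mono[of "{..<m}" "\<lambda>j. of_bool (0 < sz j i)" "\<lambda>_. 1 :: int"] by simp
  thus "is_D D \<Longrightarrow> D \<le> int m + 1000" unfolding is_D_def by fastforce
qed

text \<open>D is at most m + 1000 and hence at most 1024 * 2^m, whose square accounts for 2 m + 20
  bits; the factor n accounts for the other n.\<close>

lemma Q_ge:
  assumes "is_D D"
  shows "real n * D\<^sup>2 \<le> 2 ^ nbits"
proof -
  have D0: "0 \<le> D" using assms by (simp add: is_D_def)
  have m: "real m + 1 \<le> 2 ^ m" using of_nat_less_two_power[of m, where 'a = real] by (metis Suc_leI less_exp of_nat_Suc of_nat_le_iff of_nat_numeral of_nat_power add.commute)
  have n: "real n \<le> 2 ^ n" using of_nat_less_two_power[of n, where 'a = real] by simp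
  have "real_of_int D \<le> real m + 1000" using D_le[OF assms] by linarith
  also have "\<dots> \<le> 2 ^ m * 1024" using m by linarith
  finally have "(real_of_int D)\<^sup>2 \<le> (2 ^ m * 1024)\<^sup>2" using D0 by (intro power_mono) auto
  hence "real n * (real_of_int D)\<^sup>2 \<le> 2 ^ n * (2 ^ m * 1024)\<^sup>2" using n by (intro mult_mono) auto
  also have "\<dots> = 2 ^ nbits" by (simp add: nbits_def power_add power_mult power_mult_distrib power2_eq_square mult.commute[of 2 m])
  finally show ?thesis by simp
qed

text \<open>Items of a feasible set fit individually, so zeroing the other weights leaves its value
  unchanged. It satisfies the three blocks of rows because rounding was downwards, because two big
  items would overflow a row, and because a unit row meets at most one item.\<close>

lemma packing_opt:
  assumes D: "is_D D" and num: "\<And>l. l < tot \<Longrightarrow> 0 \<le> num l"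
    and S: "S \<subseteq> {..<n}" "\<And>j. j < m \<Longrightarrow> (\<Sum>i\<in>S. sz j i) \<le> cp j" and opt: "0 < (\<Sum>i\<in>S. num i)"
  shows "packing n nrows D coef wgt S" "(\<Sum>i\<in>S. wgt i) = (\<Sum>i\<in>S. num i)"
proof -
  have finS: "finite S" using S(1) finite_subset by blast
  have sz: "0 \<le> sz j i" if "j < m" "i < n" for i j
    unfolding sz_def using that tot_less by (intro num) auto
  have cp: "0 \<le> cp j" if "j < m" for j
    unfolding cp_def using that tot_less by (intro num) auto
  have fitS: "sz j i \<le> cp j" if "i \<in> S" "j < m" for i j
  proof -
    have "sz j i \<le> (\<Sum>i\<in>S. sz j i)" using that S(1) sz finS by (intro member_le_sum) auto
    thus ?thesis using S(2)[OF that(2)] by simp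
  qed
  have wS: "wgt i = num i" if "i \<in> S" for i
  proof -
    have "\<not> (\<exists>j<m. cp j < sz j i)" using fitS[OF that] by (meson not_less)
    thus ?thesis unfolding wgt_def by (rule if_not_P)
  qed
  show eq: "(\<Sum>i\<in>S. wgt i) = (\<Sum>i\<in>S. num i)" using wS by simp
  show "packing n nrows D coef wgt S"
  proof
    show "0 < D" using D by (simp add: is_D_def)
    show "0 \<le> wgt i" if "i < n" for i using that tot_less num by (auto simp: wgt_def)
    show "0 \<le> coef q i" if "q < nrows" "i < n" for q i
      using that sz cp by (auto simp: coef_def intro!: div_int_pos_iff[THEN iffD2])
    show "coef q i \<le> int n" if "q < nrows" "i < n" "0 < wgt i" for q i
    proof -
      have fit: "sz j i \<le> cp j" if "j < m" for j
        using \<open>0 < wgt i\<close> that by (metis wgt_def less_irrefl not_less)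
      have "int n * sz q i div cp q \<le> int n" if "q < m"
      proof (cases "cp q = 0")
        case False
        hence "0 < cp q" using cp[OF that] by simp
        moreover have "int n * sz q i \<le> int n * cp q" using fit[OF that] by (intro mult_left_mono) auto
        ultimately show ?thesis using zdiv_mono1[of "int n * sz q i" "int n * cp q" "cp q"] by simp
      qed simp
      thus ?thesis by (simp add: coef_def)
    qed
    show "\<exists>q<nrows. coef q i = int n" if "i < n" for i
      using that by (intro exI[of _ "2 * m + i"]) (simp add: coef_def nrows_def)
    show "S \<subseteq> {..<n}" by fact
    show "0 < (\<Sum>i\<in>S. wgt i)" using opt eq by simp
    show "(\<Sum>i\<in>S. coef q i) \<le> int n" if "q < nrows" for q
    proof -
      consider "q < m" | "m \<le> q" "q < 2 * m" | "2 * m \<le> q" by linarith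
      thus ?thesis
      proof cases
        case 1
        show ?thesis
        proof (cases "cp q = 0")
          case True
          thus ?thesis using 1 by (simp add: coef_def)
        next
          case False
          hence c: "0 < cp q" using cp[OF 1] by simp
          have "cp q * (\<Sum>i\<in>S. coef q i) = (\<Sum>i\<in>S. cp q * (int n * sz q i div cp q))"
            using 1 by (simp add: coef_def sum_distrib_left)
          also have "\<dots> \<le> (\<Sum>i\<in>S. int n * sz q i)"
            by (intro sum_mono) (use c mult_div_mod_eq[of "cp q"] pos_mod_sign[OF c] in \<open>smt (verit)\<close>)
          also have "\<dots> = int n * (\<Sum>i\<in>S. sz q i)" by (simp add: sum_distrib_left)
          also have "\<dots> \<le> int n * cp q" using S(2)[OF 1] by (intro mult_left_mono) auto
          finally have "cp q * (\<Sum>i\<in>S. coef q i) \<le> cp q * int n" by (simp add: mult.commute)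
          thus ?thesis using c by simp
        qed
      next
        case 2
        define j where "j = q - m"
        have j: "j < m" using 2 by (simp add: j_def)
        define G where "G = {i \<in> S. cp j < 2 * sz j i}"
        have "(\<Sum>i\<in>S. coef q i) = (\<Sum>i\<in>G. int n)"
          using 2 finS by (intro sum.mono_neutral_cong_right) (auto simp: G_def coef_def j_def)
        also have "\<dots> = int (card G) * int n" by simp
        also have "\<dots> \<le> 1 * int n"
        proof (intro mult_right_mono)
          have "card G \<le> 1"
          proof (rule ccontr)
            assume "\<not> card G \<le> 1"
            hence "\<exists>x\<in>G. \<exists>y\<in>G. x \<noteq> y"
              by (metis One_nat_def card_le_Suc0_iff_eq finS G_def finite_Collect_conjI finite_subset mem_Collect_eq subsetI)
            then obtain x y where xy: "x \<in> G" "y \<in> G" "x \<noteq> y" by blast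
            have "sz j x + sz j y = (\<Sum>i\<in>{x, y}. sz j i)" using xy by simp
            also have "\<dots> \<le> (\<Sum>i\<in>S. sz j i)"
              using xy finS S(1) sz[OF j] by (intro sum_mono2) (auto simp: G_def)
            also have "\<dots> \<le> cp j" by (rule S(2)[OF j])
            finally show False using xy by (simp add: G_def)
          qed
          thus "int (card G) \<le> 1" by simp
        qed simp
        finally show ?thesis by simp
      next
        case 3
        have "(\<Sum>i\<in>S. coef q i) = (\<Sum>i\<in>S. if q - 2 * m = i then int n else 0)"
          using 3 by (intro sum.cong) (auto simp: coef_def)
        also have "\<dots> \<le> int n" using finS by (simp add: sum.delta')
        finally show ?thesis .
      qed
    qed
  qed
qed

lemma expected_weight:
  assumes D: "is_D D" and num: "\<And>l. l < tot \<Longrightarrow> 0 \<le> num l"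
    and S: "S \<subseteq> {..<n}" "\<And>j. j < m \<Longrightarrow> (\<Sum>i\<in>S. sz j i) \<le> cp j"
    and T: "int T = int n * int nrows * D * D"
    and L: "\<And>q. q < nrows \<Longrightarrow> (\<Sum>i<n. coef q i * mwX D T i) \<le> L"
      "L = 0 \<or> (\<exists>q<nrows. (\<Sum>i<n. coef q i * mwX D T i) = L)"
  shows "exp (- 1) * (\<Sum>i\<in>S. num i) / D \<le>
    (\<Sum>V<(2 ^ nbits) ^ n. \<Sum>i<n. real_of_int (num i) * of_bool (rounding.kept n m (2 ^ nbits) sz cp
        (\<lambda>i d. int d * L * D < int n * mwX D T i * 2 ^ nbits) V i)) / (2 ^ nbits) ^ n"
proof -
  define Q :: nat where "Q = 2 ^ nbits"
  define P where "P = (\<lambda>i d. int d * L * D < int n * mwX D T i * 2 ^ nbits)"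
  have sz: "0 \<le> sz j i" if "j < m" "i < n" for i j
    unfolding sz_def using that tot_less by (intro num) auto
  interpret rounding n m Q sz cp P
    by unfold_locales (simp_all add: Q_def sz)
  have cp: "0 \<le> cp j" if "j < m" for j
    unfolding cp_def using that tot_less by (intro num) auto
  define opt where "opt = (\<Sum>i\<in>S. num i)"
  have num0: "0 \<le> num i" if "i < n" for i using that tot_less num by auto
  have mean_sum': "(\<Sum>V<Q ^ n. \<Sum>i<n. real_of_int (num i) * of_bool (kept V i)) / Q ^ n
      = (\<Sum>i<n. num i * mean (\<lambda>V. of_bool (kept V i)))"
  proof -
    have "(\<Sum>V<Q ^ n. \<Sum>i<n. real_of_int (num i) * of_bool (kept V i)) / Q ^ n = mean (\<lambda>V. \<Sum>i<n. real_of_int (num i) * of_bool (kept V i))"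
      by (simp add: mean_def)
    thus ?thesis by (simp only: mean_sum mean_cmult)
  qed
  have mean0: "0 \<le> mean (\<lambda>V. of_bool (kept V i))" for i
    by (simp add: mean_def sum_nonneg)
  have D1: "1000 \<le> real_of_int D" using D by (simp add: is_D_def)
  \<comment> \<open>\<open>packing\<close> needs a positive optimum; otherwise it suffices that the
    mean is nonnegative.\<close>
  have "exp (- 1) * real_of_int opt / D \<le> (\<Sum>i<n. num i * mean (\<lambda>V. of_bool (kept V i)))"
  proof (cases "opt \<le> 0")
    case True
    have "exp (- 1) * real_of_int opt / D \<le> 0" using True D1 by (simp add: divide_nonpos_pos mult_nonneg_nonpos)
    also have "0 \<le> (\<Sum>i<n. num i * mean (\<lambda>V. of_bool (kept V i)))" using num0 mean0 by (intro sum_nonneg) auto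
    finally show ?thesis .
  next
    case False
    hence opt: "0 < (\<Sum>i\<in>S. num i)" by (simp add: opt_def)
    interpret p: packing n nrows D coef wgt S by (rule packing_opt(1)[OF D num S opt])
    have wS: "(\<Sum>i\<in>S. wgt i) = opt" using packing_opt(2)[OF D num S opt] by (simp add: opt_def)
    define X where "X = mwX D T"
    have Xnn: "0 \<le> X i" for i unfolding X_def by (rule p.X_nonneg)
    \<comment> \<open>The running maximum starts at 0, so \<open>L = 0\<close> need not stem from a
      row. In that case row 0 attains it: its sum is nonnegative and at most 0.\<close>
    obtain q0 where q0: "q0 < nrows" "(\<Sum>i<n. coef q0 i * mwX D T i) = L"
    proof (cases "L = 0")
      case True
      have "0 \<le> (\<Sum>i<n. coef 0 i * mwX D T i)"
        using p.A p.R_pos p.X_nonneg by (intro sum_nonneg mult_nonneg_nonneg) auto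
      thus ?thesis using that[of 0] L(1)[of 0] p.R_pos True by simp
    qed (use L(2) that in blast)
    have apx: "(1 - 2 / real_of_int D) * real_of_int opt * real_of_int L \<le> real n * real_of_int (\<Sum>i<n. wgt i * X i)"
      using p.mw_approx(1)[OF T L(1) q0] unfolding wS[symmetric] X_def by simp
    have L0: "0 < L" using p.mw_approx(2)[OF T L(1) q0] .
    have nX: "int n * X i \<le> L" if "i < n" for i
      using p.mw_approx(3)[OF T L(1) q0 that] by (simp add: X_def)
    have n0: "0 < real n" using p.n_pos by simp
    have Qr: "0 < real Q" by (simp add: Q_def)
    \<comment> \<open>n X / L is the fractional solution for row capacity \<open>n\<close>; the
      further factor 1 / D turns it into sampling rates.\<close>
    define x where "x i = real n * X i / (real_of_int L * D)" for i
    have LD: "0 < L * D" using L0 D1 by simp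
    have LDr: "0 < real_of_int L * real_of_int D" using L0 D1 by simp
    have prb_eq: "prb i = real (card {d. d < Q \<and> int d * (L * D) < int n * X i * int Q}) / Q" for i
    proof -
      have "P i d \<longleftrightarrow> int d * (L * D) < int n * X i * int Q" for d
        by (simp add: P_def Q_def X_def mult.assoc)
      thus ?thesis unfolding prb_def by simp
    qed
    have yK: "real_of_int (int n * X i * int Q) / real_of_int (L * D) = x i * Q" for i
      by (simp add: x_def)
    have prb_ge: "x i \<le> prb i" if "i < n" for i
    proof -
      have "int n * X i * int Q \<le> L * D * int Q"
      proof (intro mult_right_mono)
        have "L * 1 \<le> L * D" using L0 D1 by (intro mult_left_mono) auto
        thus "int n * X i \<le> L * D" using nX[OF that] by simp
      qed simp
      hence "x i * Q \<le> real (card {d. d < Q \<and> int d * (L * D) < int n * X i * int Q})"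
        using card_mult_less_ge[OF LD, of "int n * X i * int Q" Q] unfolding yK by blast
      thus ?thesis unfolding prb_eq using Qr by (simp add: pos_le_divide_eq)
    qed
    have prb_le: "prb i \<le> x i + 1 / Q" for i
    proof -
      have "real (card {d. d < Q \<and> int d * (L * D) < int n * X i * int Q}) \<le> x i * Q + 1"
        using card_mult_less_le[OF LD, of "int n * X i * int Q" Q] Xnn[of i] unfolding yK by simp
      thus ?thesis unfolding prb_eq using Qr by (simp add: pos_divide_le_eq distrib_right)
    qed
    have x0: "0 \<le> x i" for i unfolding x_def using Xnn[of i] LDr by simp
    have nQ: "real n / Q \<le> 1 / (real_of_int D)\<^sup>2"
    proof -
      have "real n * D\<^sup>2 \<le> real Q" using Q_ge[OF D] by (simp add: Q_def)
      thus ?thesis using Qr D1 by (simp add: field_simps)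
    qed
    have "1 / (real_of_int D)\<^sup>2 \<le> 1 / D"
      using D1 by (simp add: field_simps power2_eq_square)
    with nQ have nQ': "real n / Q \<le> 1 / D" by linarith
    have card_le: "real (card A) / Q \<le> real n / Q" if "A \<subseteq> {..<n}" for A
      using card_mono[OF _ that] Qr by (simp add: divide_right_mono)
    \<comment> \<open>1 / D comes from row \<open>m + j\<close>, the one that counts big items, and
      1 / D^2 from rounding at most \<open>n\<close> probabilities up.\<close>
    have big_le: "(\<Sum>i\<in>big j. prb i) \<le> 1 / D + 1 / (real_of_int D)\<^sup>2" if j: "j < m" for j
    proof -
      have "(\<Sum>i\<in>big j. int n * X i) = (\<Sum>i<n. coef (m + j) i * X i)"
        using j by (intro sum.mono_neutral_cong_left) (auto simp: big_def coef_def)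
      also have "\<dots> \<le> L" using L(1)[of "m + j"] j by (simp add: nrows_def X_def)
      finally have "real_of_int (\<Sum>i\<in>big j. int n * X i) \<le> real_of_int L" by (simp only: of_int_le_iff)
      hence bl: "(\<Sum>i\<in>big j. real n * X i) \<le> L" by simp
      have "(\<Sum>i\<in>big j. prb i) \<le> (\<Sum>i\<in>big j. x i + 1 / Q)" by (intro sum_mono prb_le)
      also have "\<dots> = (\<Sum>i\<in>big j. real n * X i) / (real_of_int L * D) + real (card (big j)) / Q"
        by (simp add: x_def sum.distrib sum_divide_distrib)
      also have "\<dots> \<le> L / (real_of_int L * D) + real n / Q"
        using bl LDr by (intro add_mono divide_right_mono card_le) (auto simp: big_def)
      also have "L / (real_of_int L * D) = 1 / D" using L0 by simp
      finally show ?thesis using nQ by linarith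
    qed
    have sumX: "(\<Sum>i<n. real_of_int (X i)) \<le> L"
    proof -
      have "real n * real_of_int (X i) \<le> L" if "i < n" for i
      proof -
        have "real_of_int (int n * X i) \<le> real_of_int L" using nX[OF that] by (simp only: of_int_le_iff)
        thus ?thesis by simp
      qed
      hence "(\<Sum>i<n. real n * real_of_int (X i)) \<le> (\<Sum>i<n. real_of_int L)" by (intro sum_mono) auto
      hence "real n * (\<Sum>i<n. real_of_int (X i)) \<le> real n * real_of_int L" by (simp add: sum_distrib_left)
      thus ?thesis using n0 by simp
    qed
    \<comment> \<open>Of the three shares c / D, one is the row constraint, one the loss from
      rounding matrix entries down (absorbed through \<open>sumX\<close>), and one the rounding of
      probabilities up.\<close>
    have small_le: "(\<Sum>i\<in>small j. sz j i * prb i) \<le> 3 * cp j / D" if j: "j < m" and c: "0 < cp j" for j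
    proof -
      have szn: "real n * sz j i \<le> cp j * (real_of_int (coef j i) + 1)" if "i < n" for i
      proof -
        have "int n * sz j i \<le> cp j * (int n * sz j i div cp j + 1)"
          using pos_mod_bound[OF c, of "int n * sz j i"] mult_div_mod_eq[of "cp j" "int n * sz j i"]
          unfolding distrib_left mult_1_right by linarith
        hence "real_of_int (int n * sz j i) \<le> real_of_int (cp j * (int n * sz j i div cp j + 1))"
          by (simp only: of_int_le_iff)
        thus ?thesis using j by (simp add: coef_def)
      qed
      have "(\<Sum>i\<in>small j. sz j i * (real n * X i)) \<le> (\<Sum>i<n. sz j i * (real n * X i))"
        using sz[OF j] Xnn by (intro sum_mono2) (auto simp: small_def)
      also have "\<dots> \<le> (\<Sum>i<n. cp j * (real_of_int (coef j i) + 1) * X i)"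
      proof (intro sum_mono)
        fix i assume "i \<in> {..<n}"
        hence "real n * sz j i * X i \<le> cp j * (real_of_int (coef j i) + 1) * X i"
          using szn Xnn[of i] by (intro mult_right_mono) auto
        thus "sz j i * (real n * X i) \<le> cp j * (real_of_int (coef j i) + 1) * X i" by (simp add: ac_simps)
      qed
      also have "\<dots> = cp j * ((\<Sum>i<n. real_of_int (coef j i) * X i) + (\<Sum>i<n. real_of_int (X i)))"
        by (simp add: sum_distrib_left sum.distrib algebra_simps)
      also have "\<dots> \<le> real_of_int (cp j) * (real_of_int L + real_of_int L)"
      proof -
        have "real_of_int (\<Sum>i<n. coef j i * X i) \<le> real_of_int L"
          using L(1)[of j] j by (simp only: of_int_le_iff X_def) (simp add: nrows_def)
        thus ?thesis using sumX c by (intro mult_left_mono add_mono) auto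
      qed
      finally have 1: "(\<Sum>i\<in>small j. sz j i * (real n * X i)) \<le> real_of_int (cp j) * (2 * real_of_int L)" by simp
      have 2: "(\<Sum>i\<in>small j. real_of_int (sz j i)) / Q \<le> cp j / D"
      proof -
        have "(\<Sum>i\<in>small j. real_of_int (sz j i)) \<le> (\<Sum>i\<in>small j. real_of_int (cp j))"
        proof (intro sum_mono)
          fix i assume "i \<in> small j"
          hence "sz j i \<le> cp j" using sz[OF j, of i] by (simp add: small_def)
          thus "real_of_int (sz j i) \<le> real_of_int (cp j)" by simp
        qed
        also have "\<dots> = cp j * real (card (small j))" by simp
        finally have "(\<Sum>i\<in>small j. real_of_int (sz j i)) / Q \<le> cp j * real (card (small j)) / Q"
          using Qr by (intro divide_right_mono) auto
        also have "\<dots> = cp j * (real (card (small j)) / Q)" by simp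
        also have "\<dots> \<le> cp j * (1 / D)"
          using c by (intro mult_left_mono order.trans[OF card_le nQ']) (auto simp: small_def)
        finally show ?thesis by simp
      qed
      have "(\<Sum>i\<in>small j. sz j i * prb i) \<le> (\<Sum>i\<in>small j. sz j i * (x i + 1 / Q))"
        using sz[OF j] by (intro sum_mono mult_left_mono prb_le) (auto simp: small_def)
      also have "\<dots> = (\<Sum>i\<in>small j. sz j i * (real n * X i)) / (real_of_int L * D) + (\<Sum>i\<in>small j. real_of_int (sz j i)) / Q"
        by (simp add: x_def sum.distrib sum_divide_distrib distrib_left)
      also have "\<dots> \<le> real_of_int (cp j) * (2 * real_of_int L) / (real_of_int L * D) + cp j / D"
        using 1 2 LDr by (intro add_mono divide_right_mono) auto
      also have "real_of_int (cp j) * (2 * real_of_int L) / (real_of_int L * D) = 2 * cp j / D" using L0 by simp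
      finally show ?thesis by (simp add: add_divide_distrib)
    qed
    have kept_ge: "wgt i * (x i * (exp (- 1) * (1 + 782 / D))) \<le> num i * mean (\<lambda>V. of_bool (kept V i))" if i: "i < n" for i
    proof (cases "\<exists>j<m. cp j < sz j i")
      case True
      thus ?thesis using num0[OF i] mean0 by (simp add: wgt_def)
    next
      case False
      have w: "wgt i = num i" unfolding wgt_def using False by (rule if_not_P)
      define k where "k = nat (D - 1000)"
      have k: "real_of_int D = real k + 1000" using D by (simp add: k_def is_D_def)
      have "int (card (rows_of i)) = cnt i"
      proof -
        have "cnt i = (\<Sum>j\<in>rows_of i. 1)"
          unfolding cnt_def by (intro sum.mono_neutral_cong_right) (auto simp: rows_of_def)
        thus ?thesis by simp
      qed
      moreover have "cnt i + 1000 \<le> D" using D i by (simp add: is_D_def)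
      ultimately have ck: "card (rows_of i) \<le> k" using k by linarith
      have "x i * (exp (- 1) * (1 + 782 / D)) \<le> prb i * (exp (- 1) * (1 + 782 / D))"
        using prb_ge[OF i] D1 by (intro mult_right_mono) auto
      also have "\<dots> = prb i * exp (- 1) * (1 + 782 / D)" by simp
      also have "\<dots> \<le> mean (\<lambda>V. of_bool (kept V i))"
        using False by (intro mean_kept_ge_numeric[OF i _ k ck big_le small_le]) (meson not_less)+
      finally show ?thesis unfolding w using num0[OF i] by (intro mult_left_mono) auto
    qed
    \<comment> \<open>The product is 1 + 780 / D - 1564 / D^2, and D >= 1000 lets the linear term
      win.\<close>
    have ge1: "1 \<le> (1 - 2 / D) * (1 + 782 / real_of_int D)"
    proof -
      have "1564 / D \<le> (780 :: real)" using D1 by (simp add: field_simps)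
      hence "1564 / D / D \<le> 780 / real_of_int D" using D1 by (intro divide_right_mono) auto
      moreover have "(1 - 2 / D) * (1 + 782 / real_of_int D) = 1 + 780 / D - 1564 / D / D"
        using D1 by (simp add: field_simps)
      ultimately show ?thesis by linarith
    qed
    have "exp (- 1) * real_of_int opt / D = exp (- 1) * real_of_int opt / D * 1" by simp
    also have "\<dots> \<le> exp (- 1) * real_of_int opt / D * ((1 - 2 / D) * (1 + 782 / real_of_int D))"
      using ge1 False D1 by (intro mult_left_mono) auto
    also have "\<dots> = (exp (- 1) * (1 + 782 / D)) / (real_of_int L * D) * ((1 - 2 / D) * opt * L)"
      using L0 by (simp add: ac_simps)
    also have "\<dots> \<le> (exp (- 1) * (1 + 782 / D)) / (real_of_int L * D) * (real n * real_of_int (\<Sum>i<n. wgt i * X i))"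
      using LDr D1 by (intro mult_left_mono apx) auto
    also have "\<dots> = (\<Sum>i<n. wgt i * (x i * (exp (- 1) * (1 + 782 / D))))"
      by (simp add: x_def sum_distrib_left sum_divide_distrib ac_simps)
    also have "\<dots> \<le> (\<Sum>i<n. num i * mean (\<lambda>V. of_bool (kept V i)))"
      by (intro sum_mono kept_ge) auto
    finally show ?thesis .
  qed
  hence "exp (- 1) * real_of_int opt / D \<le> (\<Sum>V<Q ^ n. \<Sum>i<n. real_of_int (num i) * of_bool (kept V i)) / Q ^ n"
    by (simp only: mean_sum')
  thus ?thesis by (simp only: opt_def Q_def P_def of_nat_power of_nat_numeral)
qed

end

subsection \<open>Running time and encoding\<close>

lemma fills_growth_ge: "U \<le> fills_growth fs U"
proof (induction fs arbitrary: U)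
  case (Cons f fs)
  show ?case using order.trans[OF fill_growth_ge[of U f] Cons.IH] by simp
qed simp

section \<open>Decoding the input list\<close>

lemma length_encode_rats: "length (concat (map encode_rat vs)) = 2 * length vs"
  by (induction vs) (auto simp: encode_rat_def)

lemma nth_encode_rats:
  "l < length vs \<Longrightarrow> concat (map encode_rat vs) ! (2 * l) = fst (quotient_of (vs ! l))"
  "l < length vs \<Longrightarrow> concat (map encode_rat vs) ! Suc (2 * l) = snd (quotient_of (vs ! l))"
proof (induction vs arbitrary: l)
  case (Cons v vs)
  { case 1 thus ?case using Cons(1)[of "l - 1"] by (cases l) (auto simp: encode_rat_def) }
  { case 2 thus ?case using Cons(2)[of "l - 1"] by (cases l) (auto simp: encode_rat_def) }
qed auto

lemma nth_concat_uniform: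
  "(\<And>xs. xs \<in> set xss \<Longrightarrow> length xs = n) \<Longrightarrow> j < length xss \<Longrightarrow> i < n \<Longrightarrow>
    concat xss ! (j * n + i) = xss ! j ! i"
proof (induction xss arbitrary: j)
  case (Cons xs xss)
  show ?case
  proof (cases j)
    case 0
    thus ?thesis using Cons.prems by (simp add: nth_append)
  next
    case (Suc j')
    have "concat (xs # xss) ! (j * n + i) = concat xss ! (j' * n + i)"
      using Cons.prems(1)[of xs] Suc by (simp add: nth_append)
    also have "\<dots> = xss ! j' ! i" using Cons Suc by (intro Cons.IH) auto
    finally show ?thesis using Suc by simp
  qed
qed simp

lemma length_concat_uniform:
  "(\<And>xs. xs \<in> set xss \<Longrightarrow> length xs = n) \<Longrightarrow> length (concat xss) = length xss * n"
  by (induction xss) auto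

definition entries :: "rat vec \<Rightarrow> rat mat \<Rightarrow> rat vec \<Rightarrow> rat list" where
  "entries w S c = list_of_vec w @ list_of_vec c @ concat (map list_of_vec (rows S))"

lemma entries_nth:
  assumes "dim_vec w = dim_col S" "dim_vec c = dim_row S"
  shows "length (entries w S c) = dim_col S + dim_row S + dim_row S * dim_col S"
    "i < dim_col S \<Longrightarrow> entries w S c ! i = w $ i"
    "j < dim_row S \<Longrightarrow> entries w S c ! (dim_col S + j) = c $ j"
    "j < dim_row S \<Longrightarrow> i < dim_col S \<Longrightarrow>
       entries w S c ! (dim_col S + dim_row S + (j * dim_col S + i)) = S $$ (j, i)"
proof -
  let ?R = "map list_of_vec (rows S)"
  have len: "length xs = dim_col S" if "xs \<in> set ?R" for xs
    using that by (auto simp: rows_def)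
  show "length (entries w S c) = dim_col S + dim_row S + dim_row S * dim_col S"
  proof -
    have "length (concat ?R) = length ?R * dim_col S" by (rule length_concat_uniform[OF len])
    thus ?thesis unfolding entries_def length_append by (simp add: assms del: length_concat)
  qed
  show "i < dim_col S \<Longrightarrow> entries w S c ! i = w $ i"
    using assms by (simp add: entries_def nth_append list_of_vec_index)
  show "j < dim_row S \<Longrightarrow> entries w S c ! (dim_col S + j) = c $ j"
    using assms by (simp add: entries_def nth_append list_of_vec_index)
  assume j: "j < dim_row S" and i: "i < dim_col S"
  have "entries w S c ! (dim_col S + dim_row S + (j * dim_col S + i)) = concat ?R ! (j * dim_col S + i)"
    using assms by (simp add: entries_def nth_append)
  also have "\<dots> = ?R ! j ! i" using len j i by (intro nth_concat_uniform) auto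
  also have "\<dots> = S $$ (j, i)" using i j by (simp add: list_of_vec_index)
  finally show "entries w S c ! (dim_col S + dim_row S + (j * dim_col S + i)) = S $$ (j, i)" .
qed

definition init_arrays :: "int list \<Rightarrow> arrays" where
  "init_arrays zs r i = (if r = 0 \<and> i < length zs then zs ! i else 0)"

lemma load_eq: "load zs = mem_of (init_arrays zs)"
  by (auto simp: load_def mem_of_def init_arrays_def fun_eq_iff split: prod.splits)

lemma bits_le_input_size: "z \<in> set zs \<Longrightarrow> bits z \<le> input_size zs"
  unfolding input_size_def by (intro member_le_sum_list) auto

lemma length_le_input_size: "length zs \<le> input_size zs"
proof (induction zs)
  case (Cons z zs)
  thus ?case using bits_pos[of z] by (simp add: input_size_def)
qed (simp add: input_size_def)

lemma arrays_bound_init: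
  assumes "1 \<le> input_size zs"
  shows "arrays_bound (input_size zs) (init_arrays zs)"
  using assms by (auto simp: arrays_bound_def init_arrays_def intro: bits_le_input_size)

text \<open>With y = z + 2000, which exceeds D, the largest quantity to dominate is the round count,
  at most 2 y^4. One more factor y beats all constants.\<close>

definition bound0 :: "nat \<Rightarrow> nat" where "bound0 z = (z + 2000) ^ 5"
definition bound1 :: "nat \<Rightarrow> nat" where "bound1 z = fills_growth pre_fills (bound0 z)"
definition bound2 :: "nat \<Rightarrow> nat" where "bound2 z = mw_growth (bound1 z)"
definition bound3 :: "nat \<Rightarrow> nat" where "bound3 z = fills_growth mid_fills (bound2 z)"

definition alg_time :: "nat \<Rightarrow> nat" where
  "alg_time z = fills_time pre_fills (bound0 z) + (mw_time (bound1 z) + (fills_time mid_fills (bound2 z) +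
     (bound3 z * coin_time (bound3 z) + cost_bound loop_cond (bound3 z) + 1 + fills_time post_fills (bound3 z))))"

lemma bounds_mono: "bound0 z \<le> bound1 z" "bound1 z \<le> bound2 z" "bound2 z \<le> bound3 z"
  by (auto simp: bound1_def bound2_def bound3_def fills_growth_ge mw_growth_def)

lemma poly_bounded_alg_time: "poly_bounded (\<lambda>z. alg_time z)"
proof -
  have b0: "poly_bounded (\<lambda>z. bound0 z)" unfolding bound0_def by (intro poly_bounded_intros)
  have b1: "poly_bounded (\<lambda>z. bound1 z)" unfolding bound1_def
    by (rule poly_bounded_compose[OF poly_bounded_fills_growth b0])
  have b2: "poly_bounded (\<lambda>z. bound2 z)" unfolding bound2_def
    by (rule poly_bounded_compose[OF poly_bounded_mw_growth b1])
  have b3: "poly_bounded (\<lambda>z. bound3 z)" unfolding bound3_def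
    by (rule poly_bounded_compose[OF poly_bounded_fills_growth b2])
  show ?thesis unfolding alg_time_def
    by (intro poly_bounded_intros b3 poly_bounded_compose[OF poly_bounded_fills_time b0] poly_bounded_compose[OF poly_bounded_mw_time b1]
        poly_bounded_compose[OF poly_bounded_fills_time b2] poly_bounded_compose[OF poly_bounded_fills_time b3]
        poly_bounded_compose[OF poly_bounded_coin_time b3] poly_bounded_compose[OF poly_bounded_cost_bound b3])
qed

lemma bound0_ge:
  assumes "n + m + m * n \<le> z" "D \<le> m + 1000"
  shows "4 * (m + n + 1) * (m + n + 1) < bound0 z" "n * (2 * m + n) * D * D < bound0 z"
    "2 * m + n < bound0 z" "n * (n + 2 * m + 20) < bound0 z" "m * n < bound0 z" "n + 2 * m + 20 < bound0 z"
    "n < bound0 z" "m < bound0 z" "1 < bound0 z" "z \<le> bound0 z"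
proof -
  define y where "y = z + 2000"
  have y: "2000 \<le> y" "n \<le> y" "m \<le> y" "m + n + 1 \<le> y" "2 * m + n \<le> 2 * y" "D \<le> y" "n + 2 * m + 20 \<le> 3 * y"
    "m * n \<le> y" "z \<le> y"
    using assms by (auto simp: y_def)
  have b: "bound0 z = y * y * y * y * y" 
    unfolding bound0_def y_def[symmetric] by (simp add: eval_nat_numeral)
  have grow: "k * x < y * x" if "k < 2000" "0 < x" for k x using that y by simp
  have y1: "y \<le> y * y" using y(1) by (intro le_square)
  have "1 * 1 \<le> y * y" using y(1) by (intro mult_le_mono) auto
  hence "y * y * 1 \<le> y * y * (y * y)" by (intro mult_le_mono) auto
  hence y2: "y * y \<le> y * y * y * y" by (simp add: mult.assoc)
  have yb: "5 * y < bound0 z" "5 * (y * y) < bound0 z" "5 * (y * y * y * y) < bound0 z"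
  proof -
    show 4: "5 * (y * y * y * y) < bound0 z" using grow[of 5 "y * y * y * y"] y by (simp add: b)
    show 2: "5 * (y * y) < bound0 z" using y2 4 by linarith
    show "5 * y < bound0 z" using y1 2 by linarith
  qed
  have "4 * (m + n + 1) * (m + n + 1) \<le> 4 * y * y" using y by (intro mult_le_mono) auto
  thus "4 * (m + n + 1) * (m + n + 1) < bound0 z" using yb by linarith
  have "n * (2 * m + n) * D * D \<le> y * (2 * y) * y * y" using y by (intro mult_le_mono) auto
  also have "\<dots> = 2 * (y * y * y * y)" by simp
  finally show "n * (2 * m + n) * D * D < bound0 z" using yb by linarith
  have "n * (n + 2 * m + 20) \<le> y * (3 * y)" using y by (intro mult_le_mono) auto
  thus "n * (n + 2 * m + 20) < bound0 z" using yb by linarith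
  show "2 * m + n < bound0 z" "m * n < bound0 z" "n + 2 * m + 20 < bound0 z"
    "n < bound0 z" "m < bound0 z" "1 < bound0 z" "z \<le> bound0 z" using y yb by linarith+
qed

context encoded
begin

text \<open>Everything before the coin flips is deterministic, so \<open>D\<close>, \<open>T\<close>
  and \<open>L\<close> are fixed numbers and the final memory is a function \<open>F\<close> of the
  random number alone.\<close>

lemma alg_runs:
  assumes \<sigma>: "\<sigma> 0 = inp" "\<And>r. r \<noteq> 0 \<Longrightarrow> \<sigma> r = (\<lambda>_. 0)"
    and z: "tot \<le> z" "arrays_bound (bound0 z) \<sigma>"
    and num: "\<And>l. l < tot \<Longrightarrow> 0 \<le> num l"
  obtains D T L F where "is_D D" "int T = int n * int nrows * D * D"
    "\<And>q. q < nrows \<Longrightarrow> (\<Sum>i<n. coef q i * mwX D T i) \<le> L"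
    "L = 0 \<or> (\<exists>q<nrows. (\<Sum>i<n. coef q i * mwX D T i) = L)"
    "pruns pip_alg (mem_of \<sigma>) (map_pmf F (pmf_of_set {..<2 ^ (n * nbits)})) (alg_time z)"
    "\<And>V i. i < n \<Longrightarrow> F V (int i) = of_bool (rounding.kept n m (2 ^ nbits) sz cp
        (\<lambda>i d. int d * L * D < int n * mwX D T i * 2 ^ nbits) V i)"
proof -
  define s1 where "s1 = fills_den pre_fills \<sigma>"
  have b0: "4 * (m + n + 1) * (m + n + 1) < bound0 z" using z(1) by (intro bound0_ge(1)[of n m z 0]) (auto simp: tot_def)
  obtain D where D: "is_D D" "base D s1" "s1 rK 0 = int n * int nrows * D * D"
    "\<And>q. q < nrows \<Longrightarrow> s1 rY q = 1" "fills_ok (bound0 z) pre_fills \<sigma>"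
    using pre_fills_den[where \<sigma> = \<sigma>, OF \<sigma>(1) b0] unfolding s1_def by blast
  have D0: "0 \<le> D" using D(1) by (simp add: is_D_def)
  define T where "T = n * nrows * nat D * nat D"
  have T: "int T = int n * int nrows * D * D" using D0 by (simp add: T_def)
  have "nat D \<le> m + 1000" using D_le[OF D(1)] by simp
  note le0 = bound0_ge[of n m z "nat D", OF z(1)[unfolded tot_def] this]
  note run1 = runs_fills[OF fills_wf(1) D(5) z(2), folded s1_def bound1_def]
  have other: "s1 r = \<sigma> r" if "r \<notin> {rM, rN, rP, rB, rC, rD, rW, rA, rY, rK}" for r
    unfolding s1_def using that by (intro fills_den_other) (auto simp: pre_fills_def get_m_def get_n_def get_dens_def get_num_def
      get_cnt_def get_D_def get_wgt_def get_coef_def init_Y_def init_T_def)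
  have st0: "mw_state D 0 s1"
    unfolding mw_state_def using D(2,4) other[of rX] \<sigma>(2) by simp
  have T0: "0 < T \<Longrightarrow> 0 < n" by (auto simp: T_def)
  have le1: "T < bound1 z" "nrows < bound1 z" "n < bound1 z"
    using le0(2,3,7) bounds_mono(1)[of z] unfolding T_def nrows_def by linarith+
  obtain s2 where s2: "runs (While loop_cond (fills_com mw_fills)) (mem_of s1) (mem_of s2) (mw_time (bound1 z))"
     "arrays_bound (bound2 z) s2" "mw_state D T s2" "\<And>r. r \<notin> {rCost, rBest, rX, rY, rK} \<Longrightarrow> s2 r = s1 r"
    using mw_loop[OF st0 _ le1(1) T0 le1(2,3)] run1 D(3) T unfolding bound2_def by auto
  have le2: "nrows < bound2 z" "n < bound2 z" "1 < bound2 z"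
    using le1 le0(9) bounds_mono[of z] by linarith+
  define s3 where "s3 = fills_den mid_fills s2"
  note mid = mid_fills_den[OF s2(3) le2, folded s3_def]
  note run3 = runs_fills[OF fills_wf(3) mid(6) s2(2), folded s3_def bound3_def]
  have other3: "s3 r = s2 r" if "r \<notin> {rLd, rLam, rK}" for r
    unfolding s3_def using that by (intro fills_den_other) (auto simp: mid_fills_def get_rowsum_def get_lam_def init_flips_def)
  have coin0: "s3 rCoin 0 = 0" "s3 rV 0 = 0"
    using other3[of rCoin] s2(4)[of rCoin] other[of rCoin] other3[of rV] s2(4)[of rV] other[of rV] \<sigma>(2) by simp_all
  \<comment> \<open>No earlier assignment targets \<open>rV\<close>, so it still holds 0 and
    \<open>s3\<close> already has the shape required by \<open>coin_loop\<close>.\<close>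
  have cs: "coin_state s3 0 (n * nbits) = s3"
    using mid(3) coin0(2) by (auto simp: coin_state_def fun_eq_iff)
  have le3: "n < bound3 z" "m < bound3 z" "m * n < bound3 z" "nbits < bound3 z" "1 < bound3 z" "n * nbits < bound3 z"
    using le0(4-9) bounds_mono[of z] unfolding nbits_def by linarith+
  have ab3: "arrays_bound (bound3 z) s3" using run3 by simp
  have coin: "pruns (While loop_cond coin_body) (mem_of s3)
      (map_pmf (\<lambda>u. mem_of (coin_state s3 u 0)) (pmf_of_set {..<2 ^ (n * nbits)}))
      (bound3 z * coin_time (bound3 z) + cost_bound loop_cond (bound3 z) + 1)"
    using coin_loop[where \<sigma> = s3, OF coin0(1) ab3 le3(5), of 0 "n * nbits" 0] le3(6)
    by (auto simp: cs elim!: pruns_mono intro!: mult_le_mono)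
  define L where "L = s3 rLam 0"
  have sz: "0 \<le> sz j i" if "j < m" "i < n" for i j
    unfolding sz_def using that tot_less by (intro num) auto
  have post: "(\<forall>i<n. fills_den post_fills (coin_state s3 V 0) 0 i = of_bool (rounding.kept n m (2 ^ nbits) sz cp
        (\<lambda>i d. int d * L * D < int n * mwX D T i * 2 ^ nbits) V i)) \<and>
      fills_ok (bound3 z) post_fills (coin_state s3 V 0)" for V
  proof -
    have "base D (coin_state s3 V 0)" by (rule base_cong[OF mid(1)]) (auto simp: coin_state_def)
    moreover have "coin_state s3 V 0 rV 0 = int V" "coin_state s3 V 0 rLam 0 = L"
      "\<And>i. i < n \<Longrightarrow> coin_state s3 V 0 rX i = mwX D T i"
      using mid(2) by (simp_all add: coin_state_def L_def)
    note p = post_fills_den[OF calculation this sz le3(1-5)]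
    show ?thesis using p by blast
  qed
  define F where "F V = mem_of (fills_den post_fills (coin_state s3 V 0))" for V
  have ab: "arrays_bound (bound3 z) (coin_state s3 V 0)" if "V < 2 ^ (n * nbits)" for V
  proof -
    have "bits (int V) \<le> Suc (n * nbits)" using that by (simp add: bits_le_iff)
    thus ?thesis using ab3 le3(5,6) by (auto simp: arrays_bound_def coin_state_def)
  qed
  have fin: "pruns (Seq (While loop_cond coin_body) (fills_com post_fills)) (mem_of s3)
      (bind_pmf (map_pmf (\<lambda>u. mem_of (coin_state s3 u 0)) (pmf_of_set {..<2 ^ (n * nbits)}))
        (\<lambda>M. return_pmf (mem_of (fills_den post_fills (arrays_of M)))))
      (bound3 z * coin_time (bound3 z) + cost_bound loop_cond (bound3 z) + 1 + fills_time post_fills (bound3 z))"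
  proof (rule pruns_Seq[OF coin])
    fix M' assume "M' \<in> set_pmf (map_pmf (\<lambda>u. mem_of (coin_state s3 u 0)) (pmf_of_set {..<2 ^ (n * nbits)}))"
    then obtain V where V: "V < 2 ^ (n * nbits)" "M' = mem_of (coin_state s3 V 0)"
      by (auto simp: set_pmf_of_set lessThan_empty_iff)
    show "pruns (fills_com post_fills) M' (return_pmf (mem_of (fills_den post_fills (arrays_of M')))) (fills_time post_fills (bound3 z))"
      using runs_fills[OF fills_wf(5) _ ab[OF V(1)]] post unfolding V(2) by (auto intro: runs_imp_pruns)
  qed
  have "bind_pmf (map_pmf (\<lambda>u. mem_of (coin_state s3 u 0)) (pmf_of_set {..<2 ^ (n * nbits)}))
        (\<lambda>M. return_pmf (mem_of (fills_den post_fills (arrays_of M)))) = map_pmf F (pmf_of_set {..<2 ^ (n * nbits)})"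
    by (simp add: map_pmf_def F_def bind_assoc_pmf bind_return_pmf)
  note fin = fin[unfolded this]
  have run: "pruns pip_alg (mem_of \<sigma>) (map_pmf F (pmf_of_set {..<2 ^ (n * nbits)})) (alg_time z)"
  proof -
    have seq: "pruns (Seq C C') M \<nu> (\<tau> + \<tau>')" if "runs C M M' \<tau>" "pruns C' M' \<nu> \<tau>'" for C C' M M' \<nu> \<tau> \<tau>'
      using pruns_Seq[OF runs_imp_pruns[OF that(1)], of C' "\<lambda>_. \<nu>" \<tau>'] that(2) by (simp add: bind_return_pmf)
    show ?thesis unfolding pip_alg_def alg_time_def
      by (rule seq[OF _ seq[OF s2(1) seq[OF _ fin]]]) (use run1 run3 in auto)
  qed
  show thesis
    by (rule that[OF D(1) T mid(4,5)[folded L_def] run]) (use post in \<open>auto simp: F_def mem_of_def\<close>)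
qed

end

section \<open>Feasible vectors, the optimum and the final guarantee\<close>

lemma finite_feasible: "finite (feasible S (c :: rat vec))"
proof (rule finite_subset)
  let ?n = "dim_col S"
  show "feasible S c \<subseteq> (\<lambda>A. vec ?n (\<lambda>i. of_bool (i \<in> A))) ` Pow {..<?n}"
  proof
    fix x assume x: "x \<in> feasible S c"
    have "x = vec ?n (\<lambda>i. of_bool (i \<in> {i. i < ?n \<and> x $ i = 1}))"
      using x by (intro eq_vecI) (auto simp: feasible_def)
    thus "x \<in> (\<lambda>A. vec ?n (\<lambda>i. of_bool (i \<in> A))) ` Pow {..<?n}" by blast
  qed
qed simp

lemma feasible_iff:
  fixes S :: "rat mat"
  assumes "dim_vec c = dim_row S"
  shows "x \<in> feasible S c \<longleftrightarrow> dim_vec x = dim_col S \<and> (\<forall>i<dim_col S. vec_index x i \<in> {0, 1}) \<and>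
    (\<forall>j<dim_row S. (\<Sum>i<dim_col S. index_mat S (j, i) * vec_index x i) \<le> vec_index c j)"
proof -
  have "vec_index (mult_mat_vec S x) j = (\<Sum>i<dim_col S. index_mat S (j, i) * vec_index x i)"
    if "j < dim_row S" "dim_vec x = dim_col S" for j
    using that by (simp add: scalar_prod_def atLeast0LessThan)
  thus ?thesis
    unfolding feasible_def less_eq_vec_def carrier_vec_def mem_Collect_eq dim_mult_mat_vec assms
    by (metis (no_types, lifting))
qed

lemma OPT_attained:
  assumes "pip w S (c :: rat vec)"
  obtains x where "x \<in> feasible S c" "OPT w S c = scalar_prod w x"
proof -
  have "0\<^sub>v (dim_col S) \<in> feasible S c"
    using assms by (subst feasible_iff) (auto simp: pip_def)
  hence "OPT w S c \<in> (\<lambda>x. scalar_prod w x) ` feasible S c"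
    unfolding OPT_def using finite_feasible by (intro Max_in) auto
  thus thesis using that by auto
qed

lemma encode_pip_entries:
  "encode_pip w S c = [int (dim_row S), int (dim_col S)] @ concat (map encode_rat (entries w S c))"
  by (simp add: encode_pip_def entries_def)

theorem theorem4:
  shows "\<exists>(alg :: com) (p :: nat poly) (r :: nat \<Rightarrow> real).
    r \<in> o(\<lambda>k. real k) \<and>
    (\<forall>k\<ge>1. 0 < exp 1 * real k + r k) \<and>
    (\<forall>(w :: rat vec) (S :: rat mat) (c :: rat vec). pip w S c \<longrightarrow>
      (\<exists>\<mu>. exec alg (load (encode_pip w S c), 0) \<mu> \<and>
        (\<forall>(M, t) \<in> set_pmf \<mu>.
           t \<le> poly p (input_size (encode_pip w S c)) \<and>
           output_vec (dim_col S) M \<in> feasible S c) \<and>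
        (\<forall>k\<ge>1. column_sparse k S \<longrightarrow>
           measure_pmf.expectation \<mu>
             (\<lambda>(M, t). real_of_rat (scalar_prod w (output_vec (dim_col S) M)))
           \<ge> real_of_rat (OPT w S c) / (exp 1 * real k + r k))))"
proof -
  obtain p :: "nat poly" where p: "\<And>z. alg_time z \<le> poly p z"
    using poly_bounded_alg_time unfolding poly_bounded_def by blast
  \<comment> \<open>The ratio obtained is e D with D at most k + 1000, so the lower-order term is
    the constant 1000 e.\<close>
  define r :: "nat \<Rightarrow> real" where "r = (\<lambda>_. 1000 * exp 1)"
  have r: "r \<in> o(\<lambda>k. real k)"
    unfolding r_def
    by (rule smalloI_tendsto[OF lim_const_over_n]) (auto simp: eventually_at_top_linorder intro!: exI[of _ 1])
  have pos: "\<forall>k\<ge>1. 0 < exp 1 * real k + r k"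
    by (simp add: r_def add_nonneg_pos)
  have main: "\<exists>\<mu>. exec pip_alg (load (encode_pip w S c), 0) \<mu> \<and>
        (\<forall>(M, t) \<in> set_pmf \<mu>.
           t \<le> poly p (input_size (encode_pip w S c)) \<and>
           output_vec (dim_col S) M \<in> feasible S c) \<and>
        (\<forall>k\<ge>1. column_sparse k S \<longrightarrow>
           measure_pmf.expectation \<mu>
             (\<lambda>(M, t). real_of_rat (scalar_prod w (output_vec (dim_col S) M)))
           \<ge> real_of_rat (OPT w S c) / (exp 1 * real k + r k))"
    if pip: "pip w S c" for w :: "rat vec" and S :: "rat mat" and c :: "rat vec"
  proof -
    define m where "m = dim_row S"
    define n where "n = dim_col S"
    define zs where "zs = encode_pip w S c"
    define vs where "vs = entries w S c"
    define inp where "inp = init_arrays zs 0"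
    define z where "z = input_size zs"
    have dims: "dim_vec w = n" "dim_vec c = m" "dim_row S = m" "dim_col S = n"
      using pip by (auto simp: pip_def m_def n_def)
    note vs_nth = entries_nth[of w S c, unfolded dims, OF refl refl, folded vs_def]
    have zs: "zs = [int m, int n] @ concat (map encode_rat vs)"
      by (simp add: zs_def vs_def encode_pip_entries dims)
    have len: "length zs = 2 + 2 * length vs" by (simp add: zs length_encode_rats)
    interpret encoded m n inp
      by unfold_locales (simp_all add: inp_def init_arrays_def zs)
    have tot: "length vs = tot" using vs_nth(1) by (simp add: tot_def)
    have inp: "inp (2 * l + 2) = fst (quotient_of (vs ! l))" "inp (2 * l + 3) = snd (quotient_of (vs ! l))"
      if "l < tot" for l
      using that nth_encode_rats[of l vs] len tot
      by (simp_all add: inp_def init_arrays_def zs numeral_3_eq_3 numeral_2_eq_2 length_encode_rats)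
    have snd_pos: "0 < inp (2 * l + 3)" if "l < tot" for l
      using inp(2)[OF that] by (simp add: quotient_of_denom_pos')
    have dens: "0 < dens" unfolding dens_def using snd_pos by (intro prod_pos) auto
    \<comment> \<open>Each denominator divides the product \<open>dens\<close>, so the integer
      division in \<open>num\<close> is exact and scaling preserves all comparisons.\<close>
    have num_eq: "of_int (num l) = (of_int dens :: rat) * vs ! l" if l: "l < tot" for l
    proof -
      have "inp (2 * l + 3) dvd dens" unfolding dens_def using l by (intro dvd_prodI) auto
      then obtain e where e: "dens = inp (2 * l + 3) * e" by (auto elim: dvdE)
      have "num l = inp (2 * l + 2) * e" unfolding num_def e using snd_pos[OF l] by simp
      moreover have "vs ! l = of_int (inp (2 * l + 2)) / of_int (inp (2 * l + 3))"
        using quotient_of_div[of "vs ! l"] inp[OF l] by (metis prod.collapse)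
      ultimately show ?thesis using snd_pos[OF l] by (simp add: e)
    qed
    have nonneg: "0 \<le> x" if "x \<in> set vs" for x
    proof -
      have in_list: "\<exists>i<dim_vec v. y = v $ i" if "y \<in> set (list_of_vec v)" for y and v :: "rat vec"
        using that by (auto simp: in_set_conv_nth list_of_vec_index)
      have "x \<in> set (list_of_vec w) \<or> x \<in> set (list_of_vec c) \<or> (\<exists>j<m. x \<in> set (list_of_vec (row S j)))"
        using that by (auto simp: vs_def entries_def rows_def dims)
      thus ?thesis using pip by (auto simp: pip_def dims dest!: in_list)
    qed
    have num0: "0 \<le> num l" if "l < tot" for l
    proof -
      have "0 \<le> (of_int (num l) :: rat)"
        unfolding num_eq[OF that] using dens nonneg[of "vs ! l"] that tot by simp
      thus ?thesis by simp
    qed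
    have wq: "of_int (num i) = of_int dens * w $ i" if "i < n" for i
      using num_eq[of i] tot_less(1)[OF that] vs_nth(2)[OF that] by simp
    have cq: "of_int (cp j) = of_int dens * c $ j" if "j < m" for j
      using num_eq[of "n + j"] tot_less(2)[OF that] vs_nth(3)[OF that] by (simp add: cp_def)
    have sq: "of_int (sz j i) = of_int dens * S $$ (j, i)" if "j < m" "i < n" for i j
      using num_eq[of "n + m + (j * n + i)"] tot_less(3)[OF that] vs_nth(4)[OF that] by (simp add: sz_def)
    have dq: "0 < (of_int dens :: rat)" using dens by simp
    have z: "tot \<le> z" using length_le_input_size[of zs] len tot by (simp add: z_def)
    have "arrays_bound z (init_arrays zs)"
      unfolding z_def using length_le_input_size[of zs] len by (intro arrays_bound_init) simp
    moreover have "z \<le> bound0 z"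
      using z by (intro bound0_ge(10)[of n m z 0]) (simp_all add: tot_def)
    ultimately have ab: "arrays_bound (bound0 z) (init_arrays zs)" by (rule arrays_bound_mono)
    obtain D T L F where DT: "is_D D" "int T = int n * int nrows * D * D"
      and L: "\<And>q. q < nrows \<Longrightarrow> (\<Sum>i<n. coef q i * mwX D T i) \<le> L"
        "L = 0 \<or> (\<exists>q<nrows. (\<Sum>i<n. coef q i * mwX D T i) = L)"
      and run: "pruns pip_alg (mem_of (init_arrays zs)) (map_pmf F (pmf_of_set {..<2 ^ (n * nbits)})) (alg_time z)"
      and F: "\<And>V i. i < n \<Longrightarrow> F V (int i) = of_bool (rounding.kept n m (2 ^ nbits) sz cp
        (\<lambda>i d. int d * L * D < int n * mwX D T i * 2 ^ nbits) V i)"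
    proof (rule alg_runs[OF _ _ z ab num0])
      show "init_arrays zs 0 = inp" by (simp add: inp_def)
      show "init_arrays zs r = (\<lambda>_. 0)" if "r \<noteq> 0" for r using that by (auto simp: init_arrays_def)
    qed blast+
    have sz: "0 \<le> sz j i" if "j < m" "i < n" for i j
      unfolding sz_def using that tot_less by (intro num0) auto
    interpret rounding n m "2 ^ nbits" sz cp "\<lambda>i d. int d * L * D < int n * mwX D T i * 2 ^ nbits"
      by unfold_locales (simp_all add: sz)
    obtain \<mu> where \<mu>: "exec pip_alg (load zs, 0) \<mu>"
      "map_pmf fst \<mu> = map_pmf F (pmf_of_set {..<2 ^ (n * nbits)})"
      "\<And>s. s \<in> set_pmf \<mu> \<Longrightarrow> snd s \<le> alg_time z"
      using run unfolding pruns_def load_eq by (metis add_0)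
    have out: "output_vec n (F V) = vec n (\<lambda>i. of_bool (kept V i))" for V
      by (rule eq_vecI) (auto simp: output_vec_def F)
    have feas: "output_vec n (F V) \<in> feasible S c" for V
      unfolding out
    proof (subst feasible_iff, simp add: dims, intro conjI allI impI)
      fix j assume j: "j < dim_row S"
      hence jm: "j < m" by (simp add: dims)
      have "0 \<le> cp j" unfolding cp_def using jm tot_less by (intro num0) auto
      hence "(of_int (\<Sum>i<n. sz j i * of_bool (kept V i)) :: rat) \<le> of_int (cp j)"
        using kept_feasible[OF jm] by (simp only: of_int_le_iff)
      also have "(of_int (\<Sum>i<n. sz j i * of_bool (kept V i)) :: rat)
          = (\<Sum>i<n. of_int (sz j i) * of_bool (kept V i))"
        by (simp only: of_int_sum of_int_mult of_int_of_bool)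
      also have "\<dots> = (\<Sum>i<n. of_int dens * (S $$ (j, i) * of_bool (kept V i)))"
        using sq[OF jm] by (intro sum.cong) (auto simp only: lessThan_iff mult.assoc)
      also have "\<dots> = of_int dens * (\<Sum>i<n. S $$ (j, i) * of_bool (kept V i))"
        by (simp only: sum_distrib_left)
      also have "of_int (cp j) = of_int dens * c $ j" by (rule cq[OF jm])
      finally have "(\<Sum>i<n. S $$ (j, i) * of_bool (kept V i)) \<le> c $ j"
        using dq by (simp only: mult_le_cancel_left_pos)
      thus "(\<Sum>i<dim_col S. S $$ (j, i) * vec n (\<lambda>i. of_bool (kept V i)) $ i) \<le> c $ j"
        by (simp add: dims cong: sum.cong_simp)
    qed (auto simp: dims)
    have wout: "real_of_int dens * real_of_rat (scalar_prod w (output_vec n (F V)))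
        = (\<Sum>i<n. real_of_int (num i) * of_bool (kept V i))" for V
    proof -
      have "of_int dens * scalar_prod w (output_vec n (F V)) = (\<Sum>i<n. of_int (num i) * of_bool (kept V i) :: rat)"
        unfolding out scalar_prod_def sum_distrib_left
        by (auto simp: atLeast0LessThan wq mult.assoc intro!: sum.cong)
      hence "real_of_rat (of_int dens * scalar_prod w (output_vec n (F V)))
          = real_of_rat (\<Sum>i<n. of_int (num i) * of_bool (kept V i))" by (rule arg_cong)
      moreover have "real_of_rat (of_bool b) = of_bool b" for b by (cases b) auto
      ultimately show ?thesis by (simp only: of_rat_mult of_rat_sum of_rat_of_int_eq)
    qed
    define E where "E = measure_pmf.expectation \<mu> (\<lambda>(M, t). real_of_rat (scalar_prod w (output_vec n M)))"
    have E: "real_of_int dens * E = (\<Sum>V<(2 ^ nbits) ^ n. \<Sum>i<n. real_of_int (num i) * of_bool (kept V i)) / (2 ^ nbits) ^ n"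
    proof -
      have "E = measure_pmf.expectation (map_pmf fst \<mu>) (\<lambda>M. real_of_rat (scalar_prod w (output_vec n M)))"
        unfolding E_def by (simp add: case_prod_unfold)
      also have "\<dots> = measure_pmf.expectation (pmf_of_set {..<2 ^ (n * nbits)})
          (\<lambda>V. real_of_rat (scalar_prod w (output_vec n (F V))))"
        unfolding \<mu>(2) by simp
      also have "\<dots> = (\<Sum>V<2 ^ (n * nbits). real_of_rat (scalar_prod w (output_vec n (F V)))) / 2 ^ (n * nbits)"
        by (subst integral_pmf_of_set) (auto simp: lessThan_empty_iff)
      finally have "real_of_int dens * E
          = (\<Sum>V<2 ^ (n * nbits). real_of_int dens * real_of_rat (scalar_prod w (output_vec n (F V)))) / 2 ^ (n * nbits)"
        by (simp add: sum_distrib_left)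
      thus ?thesis unfolding wout by (simp only: power_mult mult.commute[of n nbits])
    qed
    obtain x where x: "x \<in> feasible S c" "OPT w S c = scalar_prod w x" using OPT_attained[OF pip] .
    have fx: "dim_vec x = n" "\<And>i. i < n \<Longrightarrow> x $ i = 0 \<or> x $ i = 1"
      "\<And>j. j < m \<Longrightarrow> (\<Sum>i<n. S $$ (j, i) * x $ i) \<le> c $ j"
      using x(1) feasible_iff[of c S x] by (simp_all add: dims)
    \<comment> \<open>The support of an optimal solution is the competitor \<open>S\<close> of the
      multiplicative weights analysis.\<close>
    define A where "A = {i. i < n \<and> x $ i = 1}"
    have xA: "x $ i = of_bool (i \<in> A)" if "i < n" for i
      using fx(2)[OF that] that by (auto simp: A_def)
    have A1: "A \<subseteq> {..<n}" by (auto simp: A_def)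
    have sumA: "(\<Sum>i<n. f i * x $ i) = (\<Sum>i\<in>A. f i)" for f :: "nat \<Rightarrow> rat"
      using A1 by (intro sum.mono_neutral_cong_right) (auto simp: xA subset_eq)
    have A2: "(\<Sum>i\<in>A. sz j i) \<le> cp j" if j: "j < m" for j
    proof -
      have "(of_int (\<Sum>i\<in>A. sz j i) :: rat) = of_int dens * (\<Sum>i\<in>A. S $$ (j, i))"
        unfolding of_int_sum sum_distrib_left using A1 sq[OF j] by (intro sum.cong) auto
      also have "\<dots> \<le> of_int dens * c $ j"
      proof (intro mult_left_mono)
        show "(\<Sum>i\<in>A. S $$ (j, i)) \<le> c $ j"
          using fx(3)[OF j] unfolding sumA .
      qed (use dq in simp)
      also have "\<dots> = of_int (cp j)" using cq[OF j] by simp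
      finally show ?thesis by (simp only: of_int_le_iff)
    qed
    have optA: "real_of_int (\<Sum>i\<in>A. num i) = real_of_int dens * real_of_rat (OPT w S c)"
    proof -
      have "OPT w S c = (\<Sum>i\<in>A. w $ i)"
        unfolding x(2) scalar_prod_def fx(1) sumA[symmetric] by (simp add: atLeast0LessThan)
      hence "of_int (\<Sum>i\<in>A. num i) = of_int dens * OPT w S c"
        unfolding of_int_sum using A1 wq by (simp add: sum_distrib_left subset_eq)
      hence "real_of_rat (of_int (\<Sum>i\<in>A. num i)) = real_of_rat (of_int dens * OPT w S c)" by (rule arg_cong)
      thus ?thesis by (simp only: of_rat_mult of_rat_of_int_eq)
    qed
    have D1: "1000 \<le> real_of_int D" using DT(1) by (simp add: is_D_def)
    have dr: "0 < real_of_int dens" using dens by simp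
    have "exp (- 1) * real_of_int (\<Sum>i\<in>A. num i) / D \<le> real_of_int dens * E"
      unfolding E by (rule expected_weight[OF DT(1) num0 A1 A2 DT(2) L])
    hence "real_of_int dens * (exp (- 1) * real_of_rat (OPT w S c) / D) \<le> real_of_int dens * E"
      unfolding optA by (simp add: ac_simps)
    hence "exp (- 1) * real_of_rat (OPT w S c) / D \<le> E"
      using dr by (simp only: mult_le_cancel_left_pos)
    hence Ege: "real_of_rat (OPT w S c) / (exp 1 * D) \<le> E" by (simp add: exp_minus field_simps)
    have opt0: "0 \<le> real_of_rat (OPT w S c)"
    proof -
      have "0 \<le> (\<Sum>i\<in>A. num i)" using A1 num0 tot_less(1) by (intro sum_nonneg) auto
      hence "0 \<le> real_of_int dens * real_of_rat (OPT w S c)" unfolding optA[symmetric] by (simp only: of_int_0_le_iff)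
      thus ?thesis using dr by (simp add: zero_le_mult_iff)
    qed
    \<comment> \<open>\<open>D\<close> stems from the true column counts, hence is at most k + 1000
      for every admissible k; since the optimum is nonnegative, enlarging the denominator only
      weakens the bound.\<close>
    have exp: "real_of_rat (OPT w S c) / (exp 1 * real k + r k) \<le> E" if k: "column_sparse k S" for k
    proof -
      have "cnt i \<le> int k" if i: "i < n" for i
      proof -
        have "cnt i = (\<Sum>j\<in>{j. j < dim_row S \<and> S $$ (j, i) \<noteq> 0}. 1)"
          unfolding cnt_def
        proof (rule sum.mono_neutral_cong_right)
          have pos_iff: "0 < sz j i \<longleftrightarrow> S $$ (j, i) \<noteq> 0" if j: "j < m" for j
          proof -
            have "sz j i = 0 \<longleftrightarrow> (of_int (sz j i) :: rat) = 0" by simp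
            also have "\<dots> \<longleftrightarrow> S $$ (j, i) = 0" unfolding sq[OF j i] using dq by simp
            finally show ?thesis using sz[OF j i] by auto
          qed
          show "\<forall>j\<in>{..<m} - {j. j < dim_row S \<and> S $$ (j, i) \<noteq> 0}. of_bool (0 < sz j i) = (0 :: int)"
            using pos_iff by (auto simp: dims)
          show "of_bool (0 < sz j i) = (1 :: int)" if "j \<in> {j. j < dim_row S \<and> S $$ (j, i) \<noteq> 0}" for j
            using pos_iff that by (auto simp: dims)
        qed (auto simp: dims)
        also have "\<dots> = int (card {j. j < dim_row S \<and> S $$ (j, i) \<noteq> 0})" by simp
        also have "\<dots> \<le> int k" using k i unfolding column_sparse_def dims by simp
        finally show ?thesis .
      qed
      hence "D \<le> int k + 1000" using DT(1) by (force simp: is_D_def)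
      hence "real_of_int D \<le> real k + 1000" by linarith
      hence "exp 1 * real_of_int D \<le> exp 1 * (real k + 1000)" by (intro mult_left_mono) auto
      also have "\<dots> = exp 1 * real k + r k" by (simp add: r_def algebra_simps)
      finally have "real_of_rat (OPT w S c) / (exp 1 * real k + r k) \<le> real_of_rat (OPT w S c) / (exp 1 * D)"
        using opt0 D1 by (intro divide_left_mono mult_pos_pos) (auto simp: r_def add_nonneg_pos)
      thus ?thesis using Ege by linarith
    qed
    have set: "t \<le> poly p z \<and> output_vec n M \<in> feasible S c" if "(M, t) \<in> set_pmf \<mu>" for M t
    proof -
      have "M \<in> set_pmf (map_pmf fst \<mu>)" using that by force
      hence "M \<in> set_pmf (map_pmf F (pmf_of_set {..<2 ^ (n * nbits)}))" unfolding \<mu>(2) .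
      then obtain V where "M = F V" by auto
      thus ?thesis using feas \<mu>(3)[OF that] p[of z] by auto
    qed
    show ?thesis
      using \<mu>(1) set exp unfolding E_def dims(4) zs_def[symmetric] z_def[symmetric] by blast
  qed
  show ?thesis
    by (intro exI[of _ pip_alg] exI[of _ p] exI[of _ r] conjI r pos allI impI main)
qed

end
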